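(* Let $1<k\leq n$ and let $\mathcal{M}$ be a $k$-convex hypersurface in $\mathbb{R}^{n+1}$. Then for all $f\in C^2(\mathcal{M})$ we have $$\int_{\mathcal{M}} \frac{\left(\operatorname{tr}_{\dot{\sigma}_k}(\operatorname{Hess}f)\right)^2}{\sigma_k}\,d\mu \geq k\int_{\mathcal{M}} \langle \mathcal{W}(\nabla f),\nabla f\rangle_{\dot{\sigma}_k}\,d\mu.$$
   Context: All hypersurfaces are smooth, closed and embedded in $\mathbb{R}^{n+1}$, with induced metric $g$, Levi-Civita connection $\nabla$, area measure $d\mu$, unit outward normal $\nu$, second fundamental form $h(X,Y)=\langle D_X\nu,Y\rangle$ ($D$ the flat connection), Weingarten map $\mathcal{W}=(h_i^j)$, $h_i^j=g^{jl}h_{il}$, and principal curvatures $\kappa=(\kappa_1,\ldots,\kappa_n)$, the eigenvalues of $\mathcal{W}$. $\sigma_k=\sigma_k(\kappa)$ is the $k$th elementary symmetric polynomial of the principal curvatures, regarded as a function of $(g,h)$, and $\sigma_k^{ij}=\partial\sigma_k/\partial h_{ij}$. $\mathcal{M}$ is $k$-convex if $\sigma_i(\kappa)>0$ on $\mathcal{M}$ for $i=1,\ldots,k$. $\operatorname{Hess} f=(f_{;ij})$ is the Hessian of $f$ with respect to $g$. The notation is $\operatorname{tr}_{\dot\sigma_k}(\operatorname{Hess} f)=\sigma_k^{ij}f_{;ij}$ and $\langle \mathcal{W}(\nabla f),\nabla f\rangle_{\dot\sigma_k}=\sigma_k^{im}h_m^{j}\,\partial_i f\,\partial_j f$ (summation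 convention). In an orthonormal frame diagonalizing $h$, the latter equals $\sum_i \frac{\partial\sigma_k}{\partial\kappa_i}\kappa_i(\partial_i f)^2$. *)

theory Defs
  imports "HOL-Analysis.Analysis"
begin

section \<open>Smooth closed embedded hypersurfaces of $\mathbb{R}^{n+1}$\<close>

text \<open>
  With \<open>n = CARD('n)\<close>, coordinates live in \<open>real ^ 'n\<close>, and the ambient Euclidean space
  of dimension \<open>n + 1\<close> is indexed by \<open>'n option\<close>.
\<close>

type_synonym 'n ambient = "(real, 'n option) vec"

text \<open>Continuous differentiability of order \<open>m\<close>; only used on open sets \<open>U\<close>.\<close>

primrec Ck_on :: "nat \<Rightarrow> 'a::real_normed_vector set \<Rightarrow> ('a \<Rightarrow> 'b::real_normed_vector) \<Rightarrow> bool"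
  where
    "Ck_on 0 U f \<longleftrightarrow> continuous_on U f"
  | "Ck_on (Suc m) U f \<longleftrightarrow>
       (\<forall>x\<in>U. f differentiable (at x)) \<and> (\<forall>v. Ck_on m U (\<lambda>x. frechet_derivative f (at x) v))"

definition smooth_on :: "'a::real_normed_vector set \<Rightarrow> ('a \<Rightarrow> 'b::real_normed_vector) \<Rightarrow> bool"
  where "smooth_on U f \<longleftrightarrow> (\<forall>m. Ck_on m U f)"

definition local_param ::
  "('n::finite) ambient set \<Rightarrow> (real ^ 'n) set \<Rightarrow> (real ^ 'n \<Rightarrow> 'n ambient) \<Rightarrow> bool"
  where "local_param M U \<phi> \<longleftrightarrow>
    open U \<and> smooth_on U \<phi> \<and> (\<forall>x\<in>U. inj (frechet_derivative \<phi> (at x))) \<and>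
    openin (top_of_set M) (\<phi> ` U) \<and> (\<exists>\<psi>. homeomorphism U (\<phi> ` U) \<phi> \<psi>)"

definition closed_hypersurface :: "('n::finite) ambient set \<Rightarrow> bool"
  where "closed_hypersurface M \<longleftrightarrow>
    compact M \<and> (\<forall>p\<in>M. \<exists>U \<phi>. local_param M U \<phi> \<and> p \<in> \<phi> ` U)"

definition C2_function :: "('n::finite) ambient set \<Rightarrow> ('n ambient \<Rightarrow> real) \<Rightarrow> bool"
  where "C2_function M f \<longleftrightarrow> (\<forall>U \<phi>. local_param M U \<phi> \<longrightarrow> Ck_on 2 U (f \<circ> \<phi>))"


subsection \<open>Tangent spaces and derivatives along the hypersurface\<close>

text \<open>Velocities at \<open>p\<close> of curves in \<open>M\<close> through \<open>p\<close>.\<close>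

definition tangent_space :: "'a::euclidean_space set \<Rightarrow> 'a \<Rightarrow> 'a set"
  where "tangent_space M p =
    {v. \<exists>\<gamma>. \<gamma> 0 = p \<and> (\<forall>\<^sub>F t in nhds 0. \<gamma> t \<in> M) \<and> (\<gamma> has_vector_derivative v) (at (0::real))}"

text \<open>
  The flat derivative of a map along \<open>M\<close>. A derivative within \<open>M\<close> is determined only on
  tangent vectors, so this is meaningful for \<open>X \<in> tangent_space M p\<close> only; there it is the
  derivative at \<open>p\<close> in direction \<open>X\<close> of any differentiable extension of \<open>F\<close>.
\<close>

definition deriv_along ::
  "'a::euclidean_space set \<Rightarrow> ('a \<Rightarrow> 'b::real_normed_vector) \<Rightarrow> 'a \<Rightarrow> 'a \<Rightarrow> 'b"
  where "deriv_along M F p X = frechet_derivative F (at p within M) X"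

text \<open>
  An orthonormal basis of a linear subspace. It is used to write index expressions, where
  the frame makes \<open>g\<close> the identity matrix; the resulting sums do not depend on the basis chosen.
\<close>

definition frame :: "'a::euclidean_space set \<Rightarrow> 'a set"
  where "frame T =
    (SOME E. E \<subseteq> T \<and> pairwise orthogonal E \<and> (\<forall>e\<in>E. norm e = 1) \<and> span E = T)"

definition gradient :: "'a::euclidean_space set \<Rightarrow> ('a \<Rightarrow> real) \<Rightarrow> 'a \<Rightarrow> 'a"
  where "gradient M f p =
    (THE v. v \<in> tangent_space M p \<and> (\<forall>X\<in>tangent_space M p. deriv_along M f p X = v \<bullet> X))"

text \<open>
  The Levi-Civita connection of the induced metric, \<open>\<nabla>\<^bsub>X\<^esub> V\<close> at \<open>p\<close>, as the tangential part
  of the flat connection.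
\<close>

definition levi_civita :: "'a::euclidean_space set \<Rightarrow> ('a \<Rightarrow> 'a) \<Rightarrow> 'a \<Rightarrow> 'a \<Rightarrow> 'a"
  where "levi_civita M V p X =
    (\<Sum>e\<in>frame (tangent_space M p). (deriv_along M V p X \<bullet> e) *\<^sub>R e)"

definition hessian :: "'a::euclidean_space set \<Rightarrow> ('a \<Rightarrow> real) \<Rightarrow> 'a \<Rightarrow> 'a \<Rightarrow> 'a \<Rightarrow> real"
  where "hessian M f p X Y = levi_civita M (gradient M f) p X \<bullet> Y"


subsection \<open>Unit normal, second fundamental form, area measure\<close>

text \<open>
  Outward means pointing into the unbounded part of the complement of the component of \<open>M\<close>
  through the point (\<open>M\<close> itself need not be connected).
\<close>

definition outward_unit_normal :: "'a::euclidean_space set \<Rightarrow> ('a \<Rightarrow> 'a) \<Rightarrow> bool"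
  where "outward_unit_normal M \<nu> \<longleftrightarrow>
    continuous_on M \<nu> \<and>
    (\<forall>p\<in>M. norm (\<nu> p) = 1 \<and> (\<forall>X\<in>tangent_space M p. \<nu> p \<bullet> X = 0) \<and>
      (\<forall>\<^sub>F t in at_right 0. p + t *\<^sub>R \<nu> p \<in> outside (connected_component_set M p)))"

definition second_fundamental_form ::
  "'a::euclidean_space set \<Rightarrow> ('a \<Rightarrow> 'a) \<Rightarrow> 'a \<Rightarrow> 'a \<Rightarrow> 'a \<Rightarrow> real"
  where "second_fundamental_form M \<nu> p X Y = deriv_along M \<nu> p X \<bullet> Y"

definition first_fundamental_matrix ::
  "(real ^ 'n \<Rightarrow> ('n::finite) ambient) \<Rightarrow> real ^ 'n \<Rightarrow> real ^ 'n ^ 'n"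
  where "first_fundamental_matrix \<phi> x =
    (\<chi> i j. frechet_derivative \<phi> (at x) (axis i 1) \<bullet> frechet_derivative \<phi> (at x) (axis j 1))"

text \<open>
  \<open>d\<mu> = sqrt (det g) dx\<close> in every local parametrization; as these cover \<open>M\<close>, this determines
  \<open>\<mu>\<close> uniquely.
\<close>

definition area_measure :: "('n::finite) ambient set \<Rightarrow> 'n ambient measure \<Rightarrow> bool"
  where "area_measure M \<mu> \<longleftrightarrow>
    sets \<mu> = sets (restrict_space borel M) \<and>
    (\<forall>U \<phi> A. local_param M U \<phi> \<and> A \<in> sets borel \<and> A \<subseteq> \<phi> ` U \<longrightarrow>
      emeasure \<mu> A =
        (\<integral>\<^sup>+x\<in>{x\<in>U. \<phi> x \<in> A}. ennreal (sqrt (det (first_fundamental_matrix \<phi> x))) \<partial>lborel))"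


subsection \<open>Symmetric functions of the principal curvatures\<close>

text \<open>Eigenvalues with multiplicity, in increasing order, of a self-adjoint \<open>L\<close> on \<open>T\<close>.\<close>

definition eigenvalues :: "'a::euclidean_space set \<Rightarrow> ('a \<Rightarrow> 'a) \<Rightarrow> real list"
  where "eigenvalues T L =
    (THE xs. sorted xs \<and> (\<forall>c. count (mset xs) c = dim {v \<in> T. L v = c *\<^sub>R v}))"

definition elem_sym :: "nat \<Rightarrow> real list \<Rightarrow> real"
  where "elem_sym k xs = (\<Sum>S | S \<subseteq> {..<length xs} \<and> card S = k. \<Prod>i\<in>S. xs ! i)"

text \<open>
  Raising an index of a symmetric bilinear form \<open>b\<close> on \<open>T\<close> (with the ambient inner product
  as metric); for the second fundamental form this is the Weingarten map.
\<close>

definition raise_index :: "'a::euclidean_space set \<Rightarrow> ('a \<Rightarrow> 'a \<Rightarrow> real) \<Rightarrow> 'a \<Rightarrow> 'a"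
  where "raise_index T b X = (\<Sum>e\<in>frame T. b X e *\<^sub>R e)"

definition weingarten :: "'a::euclidean_space set \<Rightarrow> ('a \<Rightarrow> 'a) \<Rightarrow> 'a \<Rightarrow> 'a \<Rightarrow> 'a"
  where "weingarten M \<nu> p = raise_index (tangent_space M p) (second_fundamental_form M \<nu> p)"

text \<open>\<open>\<sigma>\<^sub>k\<close> as a function of the metric (the inner product on \<open>T\<close>) and of the form \<open>b\<close>.\<close>

definition sigma_form :: "nat \<Rightarrow> 'a::euclidean_space set \<Rightarrow> ('a \<Rightarrow> 'a \<Rightarrow> real) \<Rightarrow> real"
  where "sigma_form k T b = elem_sym k (eigenvalues T (raise_index T b))"

text \<open>
  The component \<open>\<partial>\<sigma>\<^sub>k/\<partial>b\<^sub>i\<^sub>j\<close> for orthonormal \<open>u = e\<^sub>i\<close>, \<open>v = e\<^sub>j\<close>. As \<open>\<sigma>\<^sub>k\<close> is a function of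
  symmetric \<open>b\<close>, the entries \<open>ij\<close> and \<open>ji\<close> are varied together with weight one half each, so
  that \<open>(\<partial>\<sigma>\<^sub>k/\<partial>b\<^sub>i\<^sub>j) c\<^sub>i\<^sub>j\<close> is the differential of \<open>\<sigma>\<^sub>k\<close> at \<open>b\<close> applied to \<open>c\<close>.
\<close>

definition sigma_dot ::
  "nat \<Rightarrow> 'a::euclidean_space set \<Rightarrow> ('a \<Rightarrow> 'a \<Rightarrow> real) \<Rightarrow> 'a \<Rightarrow> 'a \<Rightarrow> real"
  where "sigma_dot k T b u v =
    deriv (\<lambda>t. sigma_form k T
      (\<lambda>X Y. b X Y + t * (((u \<bullet> X) * (v \<bullet> Y) + (v \<bullet> X) * (u \<bullet> Y)) / 2))) 0"

definition principal_curvatures :: "'a::euclidean_space set \<Rightarrow> ('a \<Rightarrow> 'a) \<Rightarrow> 'a \<Rightarrow> real list"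
  where "principal_curvatures M \<nu> p = eigenvalues (tangent_space M p) (weingarten M \<nu> p)"

definition sigma_curv :: "nat \<Rightarrow> 'a::euclidean_space set \<Rightarrow> ('a \<Rightarrow> 'a) \<Rightarrow> 'a \<Rightarrow> real"
  where "sigma_curv k M \<nu> p = elem_sym k (principal_curvatures M \<nu> p)"

definition k_convex :: "nat \<Rightarrow> 'a::euclidean_space set \<Rightarrow> ('a \<Rightarrow> 'a) \<Rightarrow> bool"
  where "k_convex k M \<nu> \<longleftrightarrow> (\<forall>p\<in>M. \<forall>i\<in>{1..k}. sigma_curv i M \<nu> p > 0)"

text \<open>\<open>\<sigma>\<^sub>k\<^sup>i\<^sup>j f\<^sub>;\<^sub>i\<^sub>j\<close>\<close>

definition tr_sigma_dot_hess ::
  "nat \<Rightarrow> 'a::euclidean_space set \<Rightarrow> ('a \<Rightarrow> 'a) \<Rightarrow> ('a \<Rightarrow> real) \<Rightarrow> 'a \<Rightarrow> real"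
  where "tr_sigma_dot_hess k M \<nu> f p =
    (let T = tangent_space M p; h = second_fundamental_form M \<nu> p in
      \<Sum>e\<^sub>i\<in>frame T. \<Sum>e\<^sub>j\<in>frame T. sigma_dot k T h e\<^sub>i e\<^sub>j * hessian M f p e\<^sub>i e\<^sub>j)"

text \<open>\<open>\<sigma>\<^sub>k\<^sup>i\<^sup>m h\<^sub>m\<^sup>j \<partial>\<^sub>i f \<partial>\<^sub>j f\<close>\<close>

definition weingarten_grad_sigma_dot ::
  "nat \<Rightarrow> 'a::euclidean_space set \<Rightarrow> ('a \<Rightarrow> 'a) \<Rightarrow> ('a \<Rightarrow> real) \<Rightarrow> 'a \<Rightarrow> real"
  where "weingarten_grad_sigma_dot k M \<nu> f p =
    (let T = tangent_space M p; h = second_fundamental_form M \<nu> p in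
      \<Sum>e\<^sub>i\<in>frame T. \<Sum>e\<^sub>m\<in>frame T. \<Sum>e\<^sub>j\<in>frame T.
        sigma_dot k T h e\<^sub>i e\<^sub>m * (weingarten M \<nu> p e\<^sub>m \<bullet> e\<^sub>j) *
        deriv_along M f p e\<^sub>i * deriv_along M f p e\<^sub>j)"

end

theory Submission
  imports Defs
begin

text \<open>
  At a point where \<open>\<kappa>\<close> lies in the Garding cone, concavity of \<open>\<sigma>\<^sub>k\<^bsup>1/k\<^esup>\<close> reads
  \<open>k \<sigma>\<^sub>k D\<^sup>2\<sigma>\<^sub>k[A, A] \<le> (k - 1) (D\<sigma>\<^sub>k[A])\<^sup>2\<close>. For \<open>A = Hess f\<close> and after integration, the claim
  follows from \<open>\<integral> D\<^sup>2\<sigma>\<^sub>k[Hess f, Hess f] = (k - 1) \<integral> \<langle>\<W>(\<nabla>f), \<nabla>f\<rangle>\<close>.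

  As \<open>f\<close> is only \<open>C\<^sup>2\<close>, this identity is obtained without differentiating its Hessian. In a chart,
  \<open>det D(\<phi> + t \<nabla>f + s \<nu>)\<close> is a null Lagrangian in the \<open>n + 1\<close> variables \<open>(x, s)\<close>, so its integral is
  stationary under the compactly supported variations \<open>a(s) Z\<close>. With a partition of unity \<open>Z\<close> may
  be replaced by \<open>\<nabla>f\<close>. Comparing powers of \<open>t\<close>, and varying \<open>a\<close> to separate powers of \<open>s\<close>, yields
  the identity. The symmetric functions occur as coefficients of determinants of \<open>(n + 1) \<times> (n + 1)\<close>
  matrices that have \<open>\<nu>\<close> in their kernel.
\<close>

section \<open>Elementary symmetric functions and Garding's inequality\<close>

text \<open>For smooth f the integrated identity follows from Codazzi (the tensor
  \<open>\<sigma>\<^sub>k\<^sup>i\<^sup>j\<close> is divergence free) and Gauss (commuting third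
  derivatives of f); the latter makes no sense for a C^2 function. The null Lagrangian asks only for
  C^1 maps, and \<nu> and \<nabla>f are C^1. Its own proof avoids second derivatives too: for small
  e the map x + e w(x) carries a ball bijectively onto itself, so the volume of the image, a
  polynomial in e, is constant. The part of Gauss is played by normal components. Along M the
  derivative of \<nabla>f is Hess f - \<nu> \<otimes> W\<nabla>f, and differentiating a(s) Z in s
  produces Z \<otimes> \<nu>. A Schur complement joins these two borders into the rank one matrix
  \<nabla>f \<otimes> W\<nabla>f, which is the curvature term. The factor k - 1 comes from
  integration by parts in s: the moment of a' against s^(k-1) is -(k-1) times that of a against
  s^(k-2). Garding's inequality contributes k / (k - 1), and the product is k.\<close>

definition esym :: "nat \<Rightarrow> 'i set \<Rightarrow> ('i \<Rightarrow> 'b::idom) \<Rightarrow> 'b"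
  where "esym k I x = coeff (\<Prod>i\<in>I. [:1, x i:]) k"

lemma esym_0 [simp]: "esym 0 I x = 1"
  unfolding esym_def poly_0_coeff_0 [symmetric] poly_prod by simp

lemma esym_insert:
  assumes "finite I" "i \<notin> I"
  shows "esym (Suc k) (insert i I) x = x i * esym k I x + esym (Suc k) I x"
  using assms by (simp add: esym_def algebra_simps)

lemma esym_remove:
  assumes "finite I" "i \<in> I"
  shows "esym (Suc k) I x = x i * esym k (I - {i}) x + esym (Suc k) (I - {i}) x"
  using esym_insert[of "I - {i}" i k x] assms by (simp add: insert_absorb)

lemma esym_Suc_empty [simp]: "esym (Suc k) {} x = 0"
  by (simp add: esym_def)

lemma esym_eq_0:
  assumes "finite I" "card I < k"
  shows "esym k I x = 0"
  using assms
proof (induction I arbitrary: k rule: finite_induct)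
  case empty
  then show ?case by (cases k) auto
next
  case (insert i I)
  then obtain k' where "k = Suc k'" by (cases k) auto
  with insert show ?case by (simp add: esym_insert)
qed

lemma esym_pos:
  fixes x :: "'i \<Rightarrow> real"
  assumes "finite I" "k \<le> card I" "\<And>i. i \<in> I \<Longrightarrow> x i > 0"
  shows "esym k I x > 0"
  using assms
proof (induction I arbitrary: k rule: finite_induct)
  case empty
  then show ?case by simp
next
  case (insert i I)
  show ?case
  proof (cases k)
    case (Suc k')
    have "esym k' I x > 0" using insert Suc by auto
    moreover have "esym k I x \<ge> 0"
      using insert Suc esym_eq_0[of I k x] by (cases "k \<le> card I") (auto simp: less_imp_le)
    ultimately show ?thesis using insert Suc by (simp add: esym_insert add_pos_nonneg)
  qed simp
qed

text \<open>Euler's identity for a homogeneous polynomial, read off from the coefficients of the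
  derivative of the generating polynomial.\<close>

lemma sum_esym_mult:
  assumes "finite I"
  shows "of_nat (Suc k) * esym (Suc k) I x = (\<Sum>i\<in>I. x i * esym k (I - {i}) x)"
proof -
  have "of_nat (Suc k) * esym (Suc k) I x = coeff (pderiv (\<Prod>i\<in>I. [:1, x i:])) k"
    by (simp add: esym_def coeff_pderiv)
  also have "\<dots> = (\<Sum>i\<in>I. x i * esym k (I - {i}) x)"
    by (simp add: pderiv_prod coeff_sum esym_def pderiv_pCons mult.commute)
  finally show ?thesis .
qed

text \<open>This sum is the derivative of e_{k+1} in direction (1, ..., 1). It is a positive
  multiple of e_k as long as k < card I, which drives the monotonicity along shifts. Writing a
  difference of two products avoids subtraction of natural numbers.\<close>

lemma sum_esym_remove:
  assumes "finite I"
  shows "(\<Sum>i\<in>I. esym k (I - {i}) x) = of_nat (card I) * esym k I x - of_nat k * esym k I x"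
proof (cases k)
  case (Suc k')
  have "of_nat (card I) * esym k I x = (\<Sum>i\<in>I. esym k I x)" by simp
  also have "\<dots> = (\<Sum>i\<in>I. x i * esym k' (I - {i}) x + esym k (I - {i}) x)"
    using assms Suc by (intro sum.cong) (auto simp: esym_remove)
  also have "\<dots> = of_nat k * esym k I x + (\<Sum>i\<in>I. esym k (I - {i}) x)"
    using sum_esym_mult[OF assms, of k' x] Suc by (simp add: sum.distrib)
  finally show ?thesis by simp
qed simp

lemma DERIV_esym_shift:
  fixes x :: "'i \<Rightarrow> real"
  assumes "finite I"
  shows "((\<lambda>s. esym (Suc k) I (\<lambda>i. x i + s)) has_real_derivative
    (\<Sum>i\<in>I. esym k (I - {i}) (\<lambda>i. x i + s))) (at s)"
  using assms
proof (induction I arbitrary: k rule: finite_induct)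
  case (insert a I)
  have eq: "(\<Sum>i\<in>I. esym k (insert a I - {i}) (\<lambda>i. x i + s)) =
     (\<Sum>i\<in>I. esym k (insert a (I - {i})) (\<lambda>i. x i + s))"
    using insert by (intro sum.cong refl) (metis insert_Diff_if singletonD)
  show ?case
  proof (cases k)
    case 0
    show ?thesis
      using insert.IH[of 0] insert 0 by (auto simp: esym_insert intro!: derivative_eq_intros)
  next
    case (Suc j)
    show ?thesis
      using insert.IH[of j] insert.IH[of k] insert Suc eq
      by (auto simp: esym_insert sum.distrib mult.commute simp flip: sum_distrib_left intro!: derivative_eq_intros)
  qed
qed simp

section \<open>Garding's cone under shifts and removal of an index\<close>

definition gamma_cone :: "nat \<Rightarrow> 'i set \<Rightarrow> ('i \<Rightarrow> real) \<Rightarrow> bool"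
  where "gamma_cone k I x \<longleftrightarrow> (\<forall>j\<in>{1..k}. esym j I x > 0)"

lemma gamma_cone_mono: "gamma_cone k I x \<Longrightarrow> j \<le> k \<Longrightarrow> gamma_cone j I x"
  by (auto simp: gamma_cone_def)

lemma gamma_cone_esym_pos: "gamma_cone k I x \<Longrightarrow> j \<le> k \<Longrightarrow> esym j I x > 0"
  by (cases j) (auto simp: gamma_cone_def)

text \<open>The derivative of e_{j+1} along the shift is (card I - j) e_j, so positivity of e_j is
  enough for monotonicity of e_{j+1}. The induction therefore reaches one index beyond the cone;
  \<open>gamma_cone_remove\<close> relies on this extra index.\<close>

lemma esym_shift_mono:
  fixes x :: "'i \<Rightarrow> real"
  assumes "finite I" "gamma_cone k I x" "s \<ge> 0" "j \<le> Suc k" "j \<le> card I"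
  shows "esym j I (\<lambda>i. x i + s) \<ge> esym j I x \<and>
    (j > 0 \<longrightarrow> s > 0 \<longrightarrow> esym j I (\<lambda>i. x i + s) > esym j I x)"
  using assms(3-)
proof (induction j arbitrary: s)
  case 0
  then show ?case by simp
next
  case (Suc j)
  let ?f = "\<lambda>s. esym (Suc j) I (\<lambda>i. x i + s)"
  let ?f' = "\<lambda>s. \<Sum>i\<in>I. esym j (I - {i}) (\<lambda>i. x i + s)"
  have d: "(?f has_real_derivative ?f' s) (at s)" for s
    by (rule DERIV_esym_shift[OF assms(1)])
  have pos: "?f' t > 0" if "t \<ge> 0" for t
  proof -
    have "0 < esym j I x" using assms(2) Suc.prems gamma_cone_esym_pos[of k I x j] by auto
    also have "\<dots> \<le> esym j I (\<lambda>i. x i + t)" using Suc.IH[of t] that Suc.prems by auto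
    finally have "0 < (real (card I) - real j) * esym j I (\<lambda>i. x i + t)"
      using Suc.prems by simp
    then show ?thesis using sum_esym_remove[OF assms(1), of j "\<lambda>i. x i + t"]
      by (simp add: algebra_simps)
  qed
  show ?case
  proof (cases "s = 0")
    case False
    have "?f 0 < ?f s"
    proof (rule DERIV_pos_imp_increasing[of 0 s ?f])
      show "0 < s" using False Suc.prems by simp
      show "\<exists>y. (?f has_real_derivative y) (at t) \<and> y > 0" if "0 \<le> t" for t
        using d[of t] pos[OF that] by blast
    qed
    then show ?thesis by simp
  qed simp
qed

lemma gamma_cone_shift:
  assumes "finite I" "gamma_cone k I x" "s \<ge> 0"
  shows "gamma_cone k I (\<lambda>i. x i + s)"
proof -
  have "esym j I (\<lambda>i. x i + s) > 0" if "j \<in> {1..k}" for j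
  proof -
    have p: "esym j I x > 0" using assms that by (auto simp: gamma_cone_def)
    then have "j \<le> card I" using esym_eq_0[OF assms(1), of j x] by force
    then show ?thesis using esym_shift_mono[OF assms, of j] that p by auto
  qed
  then show ?thesis by (simp add: gamma_cone_def)
qed

lemma continuous_esym_shift:
  fixes x :: "'i \<Rightarrow> real"
  assumes "finite I"
  shows "continuous_on S (\<lambda>s. esym k I (\<lambda>i. x i + s))"
proof (cases k)
  case (Suc j)
  then show ?thesis using DERIV_esym_shift[OF assms, of j x]
    by (auto intro!: continuous_at_imp_continuous_on DERIV_isCont)
qed simp

text \<open>
  Were \<open>e\<^sub>k\<^sub>-\<^sub>1(I - {i})\<close> not positive, it would vanish somewhere along the ray \<open>x + s\<close>. There
  \<open>e\<^sub>k(I - {i}) = e\<^sub>k(I) > 0\<close>, whereas \<open>k e\<^sub>k(I - {i}) = - \<Sum> y\<^sub>l\<^sup>2 e\<^sub>k\<^sub>-\<^sub>2(I - {i, l}) \<le> 0\<close>.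
\<close>

lemma gamma_cone_remove:
  assumes "finite I" "gamma_cone (Suc k) I x" "i \<in> I"
  shows "gamma_cone k (I - {i}) x"
  using assms
proof (induction k arbitrary: I x i)
  case 0
  then show ?case by (simp add: gamma_cone_def)
next
  case (Suc k)
  let ?J = "I - {i}"
  have low: "gamma_cone k ?J y" if "gamma_cone (Suc (Suc k)) I y" for y
    using Suc.IH[OF Suc.prems(1) gamma_cone_mono[OF that] Suc.prems(3)] by simp
  have fJ: "finite ?J" using Suc.prems by simp
  have cI: "Suc (Suc k) \<le> card I"
    using esym_eq_0[OF Suc.prems(1), of "Suc (Suc k)" x] gamma_cone_esym_pos[OF Suc.prems(2), of "Suc (Suc k)"]
    by force
  then have cJ: "Suc k \<le> card ?J" using Suc.prems by (simp add: card_Diff_singleton)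
  have "esym (Suc k) ?J x > 0"
  proof (rule ccontr)
    assume neg: "\<not> esym (Suc k) ?J x > 0"
    let ?g = "\<lambda>s. esym (Suc k) ?J (\<lambda>i. x i + s)"
    \<comment> \<open>Shifted by R every entry is positive, hence so is \<open>?g R\<close>, and the
      intermediate value theorem applies on [0, R].\<close>
    define R where "R = (\<Sum>j\<in>?J. \<bar>x j\<bar>) + 1"
    have R: "R > 0" "\<And>j. j \<in> ?J \<Longrightarrow> x j + R > 0"
    proof -
      show "R > 0" unfolding R_def by (simp add: add_nonneg_pos sum_nonneg)
      fix j assume "j \<in> ?J"
      then have "\<bar>x j\<bar> \<le> (\<Sum>j\<in>?J. \<bar>x j\<bar>)" using fJ by (intro member_le_sum) auto
      then show "x j + R > 0" unfolding R_def by linarith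
    qed
    have "?g R > 0" using esym_pos[OF fJ cJ, of "\<lambda>i. x i + R"] R by auto
    moreover have "?g 0 \<le> 0" using neg by simp
    ultimately have "\<exists>s\<ge>0. s \<le> R \<and> ?g s = 0"
      using R by (intro IVT') (auto simp: continuous_esym_shift[OF fJ])
    then obtain s where s: "s \<ge> 0" "?g s = 0" by blast
    define y where "y = (\<lambda>i. x i + s)"
    have gy: "gamma_cone (Suc (Suc k)) I y"
      unfolding y_def by (rule gamma_cone_shift[OF Suc.prems(1,2) s(1)])
    have g0: "esym (Suc k) ?J y = 0" using s by (simp add: y_def)
    have top: "esym (Suc (Suc k)) ?J y > 0"
      using gamma_cone_esym_pos[OF gy, of "Suc (Suc k)"] g0
        esym_remove[OF Suc.prems(1,3), of "Suc k" y] by simp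
    \<comment> \<open>Since e_{k+1} vanishes on \<open>?J\<close> at y, the point is not in the cone
      of order k + 1 for \<open>?J\<close> and the induction hypothesis is not applicable. A shift
      by e > 0 moves it into that cone by strict monotonicity; letting e tend to 0 keeps the weak
      inequality.\<close>
    have nn: "esym k (?J - {l}) y \<ge> 0" if l: "l \<in> ?J" for l
    proof -
      have gJ: "gamma_cone k ?J y" by (rule low[OF gy])
      have "esym k (?J - {l}) (\<lambda>i. y i + e) \<ge> 0" if e: "e > 0" for e
      proof -
        have "esym (Suc k) ?J (\<lambda>i. y i + e) > 0"
          using esym_shift_mono[OF fJ gJ, of e "Suc k"] e cJ g0 by auto
        then have "gamma_cone (Suc k) ?J (\<lambda>i. y i + e)"
          using gamma_cone_shift[OF fJ gJ, of e] e by (auto simp: gamma_cone_def le_Suc_eq)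
        then have "gamma_cone k (?J - {l}) (\<lambda>i. y i + e)"
          using Suc.IH[OF fJ _ l] by blast
        then show ?thesis by (meson gamma_cone_esym_pos less_imp_le order_refl)
      qed
      moreover have "((\<lambda>e. esym k (?J - {l}) (\<lambda>i. y i + e)) \<longlongrightarrow> esym k (?J - {l}) (\<lambda>i. y i + 0)) (at_right 0)"
      proof -
        have "isCont (\<lambda>e. esym k (?J - {l}) (\<lambda>i. y i + e)) 0"
          using continuous_esym_shift[of "?J - {l}" UNIV k y] fJ
          by (simp add: continuous_on_eq_continuous_at)
        then show ?thesis
          unfolding isCont_def by (rule tendsto_within_subset) simp
      qed
      ultimately show ?thesis
        by (intro tendsto_lowerbound[where F = "at_right (0::real)" and f = "\<lambda>e. esym k (?J - {l}) (\<lambda>i. y i + e)"])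
           (auto simp: eventually_at_right_less eventually_at_filter)
    qed
    have "of_nat (Suc (Suc k)) * esym (Suc (Suc k)) ?J y = (\<Sum>l\<in>?J. y l * esym (Suc k) (?J - {l}) y)"
      by (rule sum_esym_mult[OF fJ])
    also have "\<dots> = (\<Sum>l\<in>?J. - ((y l)\<^sup>2 * esym k (?J - {l}) y))"
    proof (rule sum.cong)
      fix l assume l: "l \<in> ?J"
      have "esym (Suc k) (?J - {l}) y = - (y l * esym k (?J - {l}) y)"
        using esym_remove[OF fJ l, of k y] g0 by linarith
      then show "y l * esym (Suc k) (?J - {l}) y = - ((y l)\<^sup>2 * esym k (?J - {l}) y)"
        by (simp add: power2_eq_square)
    qed simp
    also have "\<dots> \<le> 0" using nn by (intro sum_nonpos) auto
    finally show False using top by (simp add: mult_le_0_iff del: of_nat_Suc)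
  qed
  then show ?case using low[OF Suc.prems(2)] by (auto simp: gamma_cone_def le_Suc_eq)
qed

section \<open>Second-order jets and concavity of quotients of symmetric polynomials\<close>

lemma fps_deriv_esym:
  fixes X :: "'i \<Rightarrow> real fps"
  assumes "finite I"
  shows "fps_deriv (esym (Suc k) I X) = (\<Sum>i\<in>I. fps_deriv (X i) * esym k (I - {i}) X)"
  using assms
proof (induction I arbitrary: k rule: finite_induct)
  case (insert a I)
  have eq: "(\<Sum>i\<in>I. fps_deriv (X i) * esym k (insert a I - {i}) X) =
     (\<Sum>i\<in>I. fps_deriv (X i) * esym k (insert a (I - {i})) X)"
    using insert by (intro sum.cong refl) (metis insert_Diff_if singletonD)
  show ?case
  proof (cases k)
    case 0
    show ?thesis
      using insert.IH[of 0] insert 0 by (auto simp: esym_insert)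
  next
    case (Suc j)
    have "(\<Sum>i\<in>I. fps_deriv (X i) * esym (Suc j) (insert a (I - {i})) X) =
      X a * (\<Sum>i\<in>I. fps_deriv (X i) * esym j (I - {i}) X) + (\<Sum>i\<in>I. fps_deriv (X i) * esym (Suc j) (I - {i}) X)"
      using insert by (simp add: esym_insert sum.distrib sum_distrib_left algebra_simps)
    then show ?thesis
      using insert.IH[of j] insert.IH[of k] insert Suc eq
      by (simp add: esym_insert algebra_simps)
  qed
qed simp

lemma esym_fps_nth_0:
  fixes X :: "'i \<Rightarrow> real fps"
  assumes "finite I"
  shows "fps_nth (esym k I X) 0 = esym k I (\<lambda>i. fps_nth (X i) 0)"
  using assms
proof (induction I arbitrary: k rule: finite_induct)
  case empty
  then show ?case by (cases k) auto
next
  case (insert a I)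
  then show ?case by (cases k) (auto simp: esym_insert)
qed

text \<open>The line x + t a as a tuple of formal power series. Since \<open>esym\<close> takes
  values in any integral domain, it can be evaluated here: its coefficients 0, 1, 2 are the value,
  the first derivative and half the second derivative along the line. Quotients are formal and need
  only a nonzero constant term.\<close>

definition jet :: "('i \<Rightarrow> real) \<Rightarrow> ('i \<Rightarrow> real) \<Rightarrow> 'i \<Rightarrow> real fps"
  where "jet x a i = fps_const (x i) + fps_const (a i) * fps_X"

lemma jet_nth: "fps_nth (jet x a i) 0 = x i" "fps_nth (jet x a i) (Suc 0) = a i"
  "fps_nth (jet x a i) 2 = 0" "fps_deriv (jet x a i) = fps_const (a i)"
  by (simp_all add: jet_def)

lemma esym_jet_0:
  assumes "finite I"
  shows "fps_nth (esym k I (jet x a)) 0 = esym k I x"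
  by (simp add: esym_fps_nth_0[OF assms] jet_nth)

lemma esym_jet_1:
  assumes "finite I"
  shows "fps_nth (esym (Suc k) I (jet x a)) 1 = (\<Sum>i\<in>I. a i * esym k (I - {i}) x)"
proof -
  have "fps_nth (esym (Suc k) I (jet x a)) 1 = fps_nth (fps_deriv (esym (Suc k) I (jet x a))) 0"
    by simp
  also have "\<dots> = (\<Sum>i\<in>I. a i * esym k (I - {i}) x)"
    using assms by (simp add: fps_deriv_esym fps_sum_nth jet_nth esym_jet_0)
  finally show ?thesis .
qed

lemma esym_jet_2:
  assumes "finite I"
  shows "2 * fps_nth (esym (Suc (Suc k)) I (jet x a)) 2 =
    (\<Sum>i\<in>I. \<Sum>j\<in>I - {i}. a i * a j * esym k (I - {i} - {j}) x)"
proof -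
  have "2 * fps_nth (esym (Suc (Suc k)) I (jet x a)) 2 =
      fps_nth (fps_deriv (fps_deriv (esym (Suc (Suc k)) I (jet x a)))) 0"
    by (simp add: numeral_2_eq_2)
  also have "\<dots> = (\<Sum>i\<in>I. \<Sum>j\<in>I - {i}. a i * a j * esym k (I - {i} - {j}) x)"
    using assms by (simp add: fps_deriv_esym fps_deriv_sum fps_sum_nth jet_nth esym_jet_0 sum_distrib_left
        mult.assoc)
  finally show ?thesis .
qed

lemma fps_mult_nth_2:
  fixes f g :: "real fps"
  shows "fps_nth (f * g) 2 = fps_nth f 0 * fps_nth g 2 + fps_nth f 1 * fps_nth g 1 + fps_nth f 2 * fps_nth g 0"
  by (simp add: fps_mult_nth numeral_2_eq_2)

lemma fps_mult_nth_1':
  fixes f g :: "real fps"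
  shows "fps_nth (f * g) 1 = fps_nth f 0 * fps_nth g 1 + fps_nth f 1 * fps_nth g 0"
  by (simp add: fps_mult_nth)

text \<open>\<open>(x, y) \<mapsto> x y / (x + y)\<close> is concave and nondecreasing in \<open>y\<close> where \<open>x + y > 0\<close>.\<close>

lemma parallel_sum_concave:
  fixes x y z :: "real fps"
  assumes z: "z * (x + y) = x * y"
    and x2: "fps_nth x 2 = 0" and y2: "fps_nth y 2 \<le> 0"
    and pos: "fps_nth x 0 + fps_nth y 0 > 0"
  shows "fps_nth z 2 \<le> 0"
proof -
  define x0 x1 y0 y1 q where defs: "x0 = fps_nth x 0" "x1 = fps_nth x 1" "y0 = fps_nth y 0" "y1 = fps_nth y 1" "q = fps_nth y 2"
  define z0 z1 z2 where zdefs: "z0 = fps_nth z 0" "z1 = fps_nth z 1" "z2 = fps_nth z 2"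
  define s where "s = x0 + y0"
  have s: "s > 0" using pos by (simp add: defs s_def)
  have e0: "z0 * s = x0 * y0" using arg_cong[OF z, of "\<lambda>f. fps_nth f 0"] by (simp add: defs zdefs s_def)
  have e1: "z0 * (x1 + y1) + z1 * s = x0 * y1 + x1 * y0"
    using arg_cong[OF z, of "\<lambda>f. fps_nth f 1"] unfolding fps_mult_nth_1' by (simp add: defs zdefs s_def)
  have e2: "z0 * q + z1 * (x1 + y1) + z2 * s = x0 * q + x1 * y1"
    using arg_cong[OF z, of "\<lambda>f. fps_nth f 2"] unfolding fps_mult_nth_2 using x2 by (simp add: defs zdefs s_def)
  have "z1 * s * s = (x0 * y1 + x1 * y0) * s - x0 * y0 * (x1 + y1)"
    using e0 e1 by algebra
  \<comment> \<open>After elimination of \<open>z0\<close> and \<open>z1\<close> the mixed terms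
    combine to minus a perfect square, and the other term has the sign of q.\<close>
  then have "z2 * s * s * s = x0\<^sup>2 * q * s - (x1 * y0 - x0 * y1)\<^sup>2"
    using e0 e2 s_def by algebra
  also have "\<dots> \<le> 0"
  proof -
    have "x0\<^sup>2 * q * s \<le> 0" using y2 s by (simp add: defs mult_nonneg_nonpos mult_nonpos_nonneg)
    then show ?thesis using zero_le_power2[of "x1 * y0 - x0 * y1"] by linarith
  qed
  finally show ?thesis using s by (simp add: zdefs mult_le_0_iff)
qed

text \<open>By Euler's identity (k + 2) e_{k+2} / e_{k+1} is the sum over i of x_i e_{k+1}(I - {i})
  / e_{k+1}(I). Each summand is the parallel sum of x_i and e_{k+1}(I - {i}) / e_k(I - {i}); the
  latter is concave by induction, as removing i lowers the order of the cone by one.\<close>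

lemma esym_quotient_concave:
  assumes "finite I" "gamma_cone (Suc k) I x"
  shows "fps_nth (esym (Suc k) I (jet x a) * inverse (esym k I (jet x a))) 2 \<le> 0"
  using assms
proof (induction k arbitrary: I)
  case 0
  have "esym (Suc 0) I (jet x a) = (\<Sum>i\<in>I. jet x a i)"
    using sum_esym_mult[OF 0(1), of 0 "jet x a"] by simp
  then show ?case by (simp add: fps_sum_nth jet_nth)
next
  case (Suc k)
  let ?E = "\<lambda>k I. esym k I (jet x a)"
  have E0: "fps_nth (?E j I) 0 = esym j I x" if "finite I" for j I
    by (rule esym_jet_0[OF that])
  let ?z = "\<lambda>i. jet x a i * ?E (Suc k) (I - {i}) * inverse (?E (Suc k) I)"
  have "fps_nth (?z i) 2 \<le> 0" if i: "i \<in> I" for i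
  proof -
    let ?J = "I - {i}"
    have fJ: "finite ?J" using Suc.prems by simp
    have g: "gamma_cone (Suc k) ?J x" by (rule gamma_cone_remove[OF Suc.prems i])
    define u v where "u = ?E (Suc k) ?J" and "v = ?E k ?J"
    have v: "fps_nth v 0 > 0" using gamma_cone_esym_pos[OF g, of k] E0[OF fJ] by (simp add: v_def)
    have s: "?E (Suc k) I = jet x a i * v + u"
      using esym_remove[OF Suc.prems(1) i] by (simp add: u_def v_def)
    have s0: "fps_nth (jet x a i * v + u) 0 > 0"
      unfolding s[symmetric] using gamma_cone_esym_pos[OF Suc.prems(2), of "Suc k"] E0[OF Suc.prems(1)] by simp
    define y where "y = u * inverse v"
    have vi: "v * inverse v = 1" using v inverse_mult_eq_1' by force
    have si: "(jet x a i * v + u) * inverse (jet x a i * v + u) = 1" using s0 inverse_mult_eq_1' by force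
    have u: "u = y * v" unfolding y_def using vi by (simp add: mult.assoc mult.commute)
    have "?z i * (jet x a i + y) = jet x a i * y * (inverse (jet x a i * v + u) * (jet x a i * v + u))"
      unfolding s u_def[symmetric] by (simp add: u algebra_simps)
    also have "\<dots> = jet x a i * y" using si by (simp add: mult.commute)
    finally have "?z i * (jet x a i + y) = jet x a i * y" .
    moreover have "fps_nth y 2 \<le> 0" unfolding y_def u_def v_def by (rule Suc.IH[OF fJ g])
    moreover have "fps_nth (jet x a i) 0 + fps_nth y 0 > 0"
    proof -
      have "fps_nth v 0 * (fps_nth (jet x a i) 0 + fps_nth y 0) > 0"
        using s0 unfolding u by (simp add: algebra_simps)
      then show ?thesis using v by (simp add: zero_less_mult_iff)
    qed
    ultimately show ?thesis
      using parallel_sum_concave[where x = "jet x a i" and y = y and z = "?z i"] jet_nth(3) by metis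
  qed
  then have "fps_nth (\<Sum>i\<in>I. ?z i) 2 \<le> 0" by (simp add: fps_sum_nth sum_nonpos)
  moreover have "(\<Sum>i\<in>I. ?z i) = of_nat (Suc (Suc k)) * (?E (Suc (Suc k)) I * inverse (?E (Suc k) I))"
    using sum_esym_mult[OF Suc.prems(1), of "Suc k" "jet x a"] by (simp only: sum_distrib_right[symmetric] mult.assoc[symmetric])
  moreover have "fps_nth (of_nat n * f) 2 = real n * fps_nth f 2" for n and f :: "real fps"
    by (simp add: fps_of_nat[symmetric])
  ultimately show ?case by (simp add: mult_le_0_iff del: of_nat_Suc)
qed

text \<open>The geometric mean of concave positive functions is concave, on the level of 2-jets.\<close>

lemma prod_concave_jets:
  fixes q :: "nat \<Rightarrow> real fps"
  assumes "\<And>j. j < k \<Longrightarrow> fps_nth (q j) 0 > 0" "\<And>j. j < k \<Longrightarrow> fps_nth (q j) 2 \<le> 0"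
  defines "l \<equiv> \<lambda>j. fps_nth (q j) 1 / fps_nth (q j) 0" and "p \<equiv> (\<Prod>j<k. q j)"
  shows "fps_nth p 0 > 0 \<and> fps_nth p 1 = fps_nth p 0 * (\<Sum>j<k. l j) \<and>
    2 * fps_nth p 2 \<le> fps_nth p 0 * ((\<Sum>j<k. l j)\<^sup>2 - (\<Sum>j<k. (l j)\<^sup>2))"
  using assms(1,2) unfolding p_def
proof (induction k)
  case (Suc k)
  let ?p = "\<Prod>j<k. q j" let ?S = "\<Sum>j<k. l j" let ?Q = "\<Sum>j<k. (l j)\<^sup>2"
  have IH: "fps_nth ?p 0 > 0" "fps_nth ?p 1 = fps_nth ?p 0 * ?S"
    "2 * fps_nth ?p 2 \<le> fps_nth ?p 0 * (?S\<^sup>2 - ?Q)"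
    using Suc by auto
  have q: "fps_nth (q k) 0 > 0" "fps_nth (q k) 2 \<le> 0" "fps_nth (q k) 1 = fps_nth (q k) 0 * l k"
    using Suc.prems[of k] by (auto simp: l_def)
  have "2 * (fps_nth ?p 2 * fps_nth (q k) 0) \<le> (fps_nth ?p 0 * (?S\<^sup>2 - ?Q)) * fps_nth (q k) 0"
    using IH(3) q(1) by (metis mult.assoc mult_le_cancel_right_pos)
  moreover have "2 * (fps_nth ?p 0 * fps_nth (q k) 2) \<le> 0" using IH(1) q(2) by (simp add: mult_nonneg_nonpos)
  ultimately show ?case
    using IH(1) q(1)
    by (simp add: fps_mult_nth_2 fps_mult_nth_1' IH(2) q(3) power2_eq_square algebra_simps del: One_nat_def)
qed simp

text \<open>On the cone e_k is the telescoping product of the k positive concave quotients e_{j+1} /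
  e_j. If S and Q denote the sum and the sum of squares of their logarithmic derivatives,
  Cauchy-Schwarz gives S^2 \<le> k Q, which is where k - 1 over k arises. The leading 2 is there
  because coefficient 2 is half a second derivative.\<close>

lemma garding_esym:
  assumes "finite I" "gamma_cone k I x"
  shows "2 * real k * fps_nth (esym k I (jet x a)) 2 * esym k I x
    \<le> (real k - 1) * (fps_nth (esym k I (jet x a)) 1)\<^sup>2"
proof -
  let ?E = "\<lambda>k. esym k I (jet x a)"
  define q where "q = (\<lambda>j. ?E (Suc j) * inverse (?E j))"
  have E0: "fps_nth (?E j) 0 = esym j I x" for j by (rule esym_jet_0[OF assms(1)])
  have E0p: "fps_nth (?E j) 0 > 0" if "j \<le> k" for j
    unfolding E0 by (rule gamma_cone_esym_pos[OF assms(2) that])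
  have pE: "(\<Prod>j<m. q j) = ?E m" if "m \<le> k" for m
    using that
  proof (induction m)
    case (Suc m)
    have "inverse (?E m) * ?E m = 1" using E0p[of m] Suc.prems by (intro inverse_mult_eq_1) auto
    then show ?case using Suc by (simp add: q_def mult.commute mult.left_commute)
  qed simp
  have q0: "fps_nth (q j) 0 > 0" if "j < k" for j
    using E0p[of j] E0p[of "Suc j"] that by (simp add: q_def)
  have q2: "fps_nth (q j) 2 \<le> 0" if "j < k" for j
    unfolding q_def using esym_quotient_concave[OF assms(1) gamma_cone_mono[OF assms(2)], of j a] that by simp
  define l where "l = (\<lambda>j. fps_nth (q j) 1 / fps_nth (q j) 0)"
  let ?S = "\<Sum>j<k. l j" let ?Q = "\<Sum>j<k. (l j)\<^sup>2"
  define e where "e = fps_nth (?E k) 0"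
  have r: "e > 0" "fps_nth (?E k) 1 = e * ?S" "2 * fps_nth (?E k) 2 \<le> e * (?S\<^sup>2 - ?Q)"
    using prod_concave_jets[of k q, OF q0 q2] pE[of k] by (auto simp: l_def e_def)
  have cs: "?S\<^sup>2 \<le> real k * ?Q"
    using Cauchy_Schwarz_ineq_sum[of "\<lambda>_. 1" l "{..<k}"] by simp
  have "2 * real k * fps_nth (?E k) 2 * e = (2 * fps_nth (?E k) 2) * (real k * e)" by simp
  also have "\<dots> \<le> (e * (?S\<^sup>2 - ?Q)) * (real k * e)" using r by (intro mult_right_mono) auto
  also have "\<dots> = e\<^sup>2 * (real k * ?S\<^sup>2 - real k * ?Q)" by (simp add: power2_eq_square algebra_simps)
  also have "\<dots> \<le> e\<^sup>2 * (real k * ?S\<^sup>2 - ?S\<^sup>2)" using cs by (intro mult_left_mono) auto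
  also have "\<dots> = (real k - 1) * (fps_nth (?E k) 1)\<^sup>2" unfolding r(2) by (simp add: power_mult_distrib algebra_simps)
  finally show ?thesis by (simp add: e_def E0)
qed

section \<open>Coefficients of polarized determinants\<close>

lemma poly2_unique:
  fixes x y :: "nat \<Rightarrow> nat \<Rightarrow> real"
  assumes "\<And>s t. (\<Sum>a\<le>M. \<Sum>b\<le>N. x a b * s ^ a * t ^ b) = (\<Sum>a\<le>M. \<Sum>b\<le>N. y a b * s ^ a * t ^ b)"
    and "a \<le> M" "b \<le> N"
  shows "x a b = y a b"
proof -
  have "(\<Sum>b\<le>N. x a b * t ^ b) = (\<Sum>b\<le>N. y a b * t ^ b)" for t
  proof -
    have "(\<Sum>a\<le>M. (\<Sum>b\<le>N. x a b * t ^ b) * s ^ a) = (\<Sum>a\<le>M. (\<Sum>b\<le>N. y a b * t ^ b) * s ^ a)" for s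
      using assms(1)[of s t] by (simp add: sum_distrib_left sum_distrib_right mult_ac)
    then show ?thesis using polyfun_eq_coeffs[where n = M and c = "\<lambda>a. \<Sum>b\<le>N. x a b * t ^ b" and d = "\<lambda>a. \<Sum>b\<le>N. y a b * t ^ b"] assms(2) by blast
  qed
  then show ?thesis using polyfun_eq_coeffs[where n = N and c = "x a" and d = "y a"] assms(3) by blast
qed

lemma poly3_unique:
  fixes x y :: "nat \<Rightarrow> nat \<Rightarrow> nat \<Rightarrow> real"
  assumes "\<And>s t r. (\<Sum>a\<le>M. \<Sum>b\<le>N. \<Sum>c\<le>P. x a b c * s ^ a * t ^ b * r ^ c) =
      (\<Sum>a\<le>M. \<Sum>b\<le>N. \<Sum>c\<le>P. y a b c * s ^ a * t ^ b * r ^ c)"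
    and "a \<le> M" "b \<le> N" "c \<le> P"
  shows "x a b c = y a b c"
proof -
  have "(\<Sum>c\<le>P. x a b c * r ^ c) = (\<Sum>c\<le>P. y a b c * r ^ c)" for r
  proof (rule poly2_unique[where x = "\<lambda>a b. \<Sum>c\<le>P. x a b c * r ^ c" and y = "\<lambda>a b. \<Sum>c\<le>P. y a b c * r ^ c"])
    show "(\<Sum>a\<le>M. \<Sum>b\<le>N. (\<Sum>c\<le>P. x a b c * r ^ c) * s ^ a * t ^ b) =
      (\<Sum>a\<le>M. \<Sum>b\<le>N. (\<Sum>c\<le>P. y a b c * r ^ c) * s ^ a * t ^ b)" for s t
      using assms(1)[of s t r] by (simp add: sum_distrib_left sum_distrib_right mult_ac)
  qed (use assms in auto)
  then show ?thesis using polyfun_eq_coeffs[where n = P and c = "x a b" and d = "y a b"] assms(4) by blast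
qed

definition pick4 :: "'a \<Rightarrow> 'a \<Rightarrow> 'a \<Rightarrow> 'a \<Rightarrow> nat \<Rightarrow> 'a"
  where "pick4 e u v w m = (if m = 0 then e else if m = 1 then u else if m = 2 then v else w)"

text \<open>Bookkeeping for the expansion of a determinant by rows: \<open>f i\<close> names the
  matrix that supplies row i, in the numbering of \<open>pick4\<close>, and the sizes of the classes
  1, 2, 3 become the exponents.\<close>

definition colorings :: "nat \<Rightarrow> nat \<Rightarrow> nat \<Rightarrow> ('n::finite \<Rightarrow> nat) set"
  where "colorings a b c = {f. (\<forall>i. f i \<in> {..3}) \<and> card {i. f i = 1} = a \<and> card {i. f i = 2} = b \<and> card {i. f i = 3} = c}"

text \<open>The coefficient of \<open>s\<^sup>a t\<^sup>b r\<^sup>c\<close> in \<open>det (1 + s W + t A + r K)\<close>.\<close>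

definition dco :: "real ^ 'n ^ 'n \<Rightarrow> real ^ 'n ^ 'n \<Rightarrow> real ^ 'n ^ 'n \<Rightarrow> nat \<Rightarrow> nat \<Rightarrow> nat \<Rightarrow> real"
  where "dco W A K a b c = (\<Sum>f\<in>colorings a b c. det (\<chi> i. pick4 (mat 1) W A K (f i) $ i))"

lemma finite_colorings_all: "finite {f::'n::finite \<Rightarrow> nat. \<forall>i. f i \<in> {..3}}"
  using finite_PiE[of "UNIV::'n set" "\<lambda>_. {..3::nat}"] by (simp add: PiE_def Pi_def)

lemma prod_indicator_power: "(\<Prod>i\<in>(UNIV::'n::finite set). if P i then (s::real) else 1) = s ^ card {i. P i}"
  by (subst prod.If_cases) auto

lemma det_sum_rows:
  fixes a :: "'n::finite \<Rightarrow> 'm \<Rightarrow> real ^ 'n"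
  assumes "finite S"
  shows "det (\<chi> i. \<Sum>m\<in>S. a i m) = (\<Sum>f | \<forall>i. f i \<in> S. det (\<chi> i. a i (f i)))"
proof -
  have "{f. \<forall>i::'n. f i \<in> S} = PiE UNIV (\<lambda>_. S)" by (auto simp: PiE_def)
  then show ?thesis
    using assms by (simp add: det_def prod_sum_PiE sum_distrib_left sum.swap[of _ "PiE UNIV (\<lambda>_. S)"])
qed

lemma det_expand:
  fixes W A K :: "real ^ 'n ^ 'n"
  shows "det (mat 1 + s *\<^sub>R W + t *\<^sub>R A + r *\<^sub>R K) =
    (\<Sum>a\<le>CARD('n). \<Sum>b\<le>CARD('n). \<Sum>c\<le>CARD('n). dco W A K a b c * s ^ a * t ^ b * r ^ c)"
proof -
  let ?N = "CARD('n)"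
  let ?w = "pick4 1 s t r"
  let ?M = "pick4 (mat 1) W A K"
  let ?F = "{f::'n \<Rightarrow> nat. \<forall>i. f i \<in> {..3}}"
  let ?g = "\<lambda>f::'n \<Rightarrow> nat. (card {i. f i = 1}, card {i. f i = 2}, card {i. f i = 3})"
  let ?d = "\<lambda>f::'n \<Rightarrow> nat. det (\<chi> i. ?M (f i) $ i)"
  let ?T = "{..?N} \<times> {..?N} \<times> {..?N}"
  have eq: "mat 1 + s *\<^sub>R W + t *\<^sub>R A + r *\<^sub>R K = (\<chi> i. \<Sum>m\<le>3. ?w m *s ?M m $ i)"
    by (simp add: vec_eq_iff numeral_3_eq_3 pick4_def)
  have w: "(\<Prod>i\<in>UNIV. ?w (f i)) = s ^ card {i. f i = 1} * t ^ card {i. f i = 2} * r ^ card {i. f i = 3}"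
    if "f \<in> ?F" for f :: "'n \<Rightarrow> nat"
  proof -
    have "?w (f i) = (if f i = 1 then s else 1) * (if f i = 2 then t else 1) * (if f i = 3 then r else 1)" for i
    proof -
      have "f i \<le> 3" using that by auto
      then consider "f i = 0" | "f i = 1" | "f i = 2" | "f i = 3" by linarith
      then show ?thesis by cases (auto simp: pick4_def)
    qed
    then show ?thesis by (simp add: prod.distrib prod_indicator_power)
  qed
  have "det (mat 1 + s *\<^sub>R W + t *\<^sub>R A + r *\<^sub>R K) = (\<Sum>f\<in>?F. (\<Prod>i\<in>UNIV. ?w (f i)) * ?d f)"
    unfolding eq using det_sum_rows[of "{..3::nat}" "\<lambda>i m. ?w m *s ?M m $ i"]
    by (simp only: finite_atMost det_rows_mul)
  also have "\<dots> = (\<Sum>f\<in>?F. s ^ card {i. f i = 1} * t ^ card {i. f i = 2} * r ^ card {i. f i = 3} * ?d f)"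
    by (intro sum.cong refl) (simp only: w)
  \<comment> \<open>The monomial depends on f only through the three class sizes, so the functions
    are grouped by these.\<close>
  also have "\<dots> = (\<Sum>y\<in>?T. \<Sum>f\<in>{f. f \<in> ?F \<and> ?g f = y}. s ^ card {i. f i = 1} * t ^ card {i. f i = 2} * r ^ card {i. f i = 3} * ?d f)"
    by (rule sum.group[symmetric]) (auto simp: finite_colorings_all[simplified] intro: card_mono)
  also have "\<dots> = (\<Sum>(a, b, c)\<in>?T. dco W A K a b c * s ^ a * t ^ b * r ^ c)"
  proof (intro sum.cong refl, clarify)
    fix a b c
    have "{f. f \<in> ?F \<and> ?g f = (a, b, c)} = colorings a b c" by (auto simp: colorings_def)
    then show "(\<Sum>f\<in>{f. f \<in> ?F \<and> ?g f = (a, b, c)}. s ^ card {i. f i = 1} * t ^ card {i. f i = 2} * r ^ card {i. f i = 3} * ?d f)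
      = dco W A K a b c * s ^ a * t ^ b * r ^ c"
      by (simp add: dco_def sum_distrib_left sum_distrib_right colorings_def mult_ac)
  qed
  also have "\<dots> = (\<Sum>a\<le>?N. \<Sum>b\<le>?N. \<Sum>c\<le>?N. dco W A K a b c * s ^ a * t ^ b * r ^ c)"
    by (simp add: sum.cartesian_product)
  finally show ?thesis .
qed

lemma dco_eq_0:
  fixes W A K :: "real ^ 'n ^ 'n"
  assumes "a > CARD('n) \<or> b > CARD('n) \<or> c > CARD('n)"
  shows "dco W A K a b c = 0"
proof -
  have "card S \<le> CARD('n)" for S :: "'n set" by (intro card_mono) auto
  then have "colorings a b c = ({} :: ('n \<Rightarrow> nat) set)"
    unfolding colorings_def using assms by (auto simp: not_le[symmetric])
  then show ?thesis by (simp add: dco_def)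
qed

text \<open>Coefficients are determined by the polynomial function. Invariance under transposition
  and conjugation can thus be checked on determinants, without looking at colorings.\<close>

lemma dco_cong_det:
  fixes W A K W' A' K' :: "real ^ 'n ^ 'n"
  assumes "\<And>s t r. det (mat 1 + s *\<^sub>R W + t *\<^sub>R A + r *\<^sub>R K) = det (mat 1 + s *\<^sub>R W' + t *\<^sub>R A' + r *\<^sub>R K')"
  shows "dco W A K a b c = dco W' A' K' a b c"
proof (cases "a \<le> CARD('n) \<and> b \<le> CARD('n) \<and> c \<le> CARD('n)")
  case True
  then show ?thesis
    using poly3_unique[of "dco W A K" "CARD('n)" "CARD('n)" "CARD('n)" "dco W' A' K'" a b c]
      assms unfolding det_expand by blast
next
  case False
  then show ?thesis by (simp add: dco_eq_0 not_le)
qed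

lemma dco_transpose: "dco (transpose W) (transpose A) (transpose K) a b c = dco W A K a b c"
proof (rule dco_cong_det)
  fix s t r
  have "mat 1 + s *\<^sub>R transpose W + t *\<^sub>R transpose A + r *\<^sub>R transpose K =
      transpose (mat 1 + s *\<^sub>R W + t *\<^sub>R A + r *\<^sub>R K)"
    by (simp add: vec_eq_iff transpose_def mat_def)
  then show "det (mat 1 + s *\<^sub>R transpose W + t *\<^sub>R transpose A + r *\<^sub>R transpose K) =
      det (mat 1 + s *\<^sub>R W + t *\<^sub>R A + r *\<^sub>R K)"
    by simp
qed

lemma matrix_add_rdistrib: "(B + C) ** A = B ** A + C ** (A :: real ^ 'n ^ 'm)"
  by (simp add: vec_eq_iff matrix_matrix_mult_def distrib_right sum.distrib)

lemma dco_conj: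
  fixes Q :: "real ^ 'n ^ 'n"
  assumes "orthogonal_matrix Q"
  shows "dco (Q ** W ** transpose Q) (Q ** A ** transpose Q) (Q ** K ** transpose Q) a b c = dco W A K a b c"
proof (rule dco_cong_det)
  fix s t r
  have "mat 1 + s *\<^sub>R (Q ** W ** transpose Q) + t *\<^sub>R (Q ** A ** transpose Q) + r *\<^sub>R (Q ** K ** transpose Q)
     = Q ** (mat 1 + s *\<^sub>R W + t *\<^sub>R A + r *\<^sub>R K) ** transpose Q"
    using assms by (simp add: orthogonal_matrix_def matrix_add_ldistrib matrix_add_rdistrib
      scalar_matrix_assoc matrix_scalar_ac)
  moreover have "det Q * det Q = 1" using det_orthogonal_matrix[OF assms] by auto
  ultimately show "det (mat 1 + s *\<^sub>R (Q ** W ** transpose Q) + t *\<^sub>R (Q ** A ** transpose Q) + r *\<^sub>R (Q ** K ** transpose Q))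
     = det (mat 1 + s *\<^sub>R W + t *\<^sub>R A + r *\<^sub>R K)"
    by (simp add: det_mul mult_ac)
qed

lemma dco_swap:
  fixes W A K :: "real ^ 'n ^ 'n"
  shows "dco W A K a b c = dco W K A a c b"
proof (cases "a \<le> CARD('n) \<and> b \<le> CARD('n) \<and> c \<le> CARD('n)")
  case True
  let ?N = "CARD('n)"
  show ?thesis
  proof (rule poly3_unique[of "dco W A K" ?N ?N ?N "\<lambda>a b c. dco W K A a c b"])
    fix s t r
    have "(\<Sum>a\<le>?N. \<Sum>b\<le>?N. \<Sum>c\<le>?N. dco W A K a b c * s ^ a * t ^ b * r ^ c) =
       det (mat 1 + s *\<^sub>R W + r *\<^sub>R K + t *\<^sub>R A)"
      unfolding det_expand[symmetric] by (simp add: add_ac)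
    also have "\<dots> = (\<Sum>a\<le>?N. \<Sum>c\<le>?N. \<Sum>b\<le>?N. dco W K A a c b * s ^ a * r ^ c * t ^ b)"
      unfolding det_expand ..
    also have "\<dots> = (\<Sum>a\<le>?N. \<Sum>b\<le>?N. \<Sum>c\<le>?N. dco W K A a c b * s ^ a * r ^ c * t ^ b)"
      by (intro sum.cong refl sum.swap)
    also have "\<dots> = (\<Sum>a\<le>?N. \<Sum>b\<le>?N. \<Sum>c\<le>?N. dco W K A a c b * s ^ a * t ^ b * r ^ c)"
      by (simp add: mult_ac)
    finally show "(\<Sum>a\<le>?N. \<Sum>b\<le>?N. \<Sum>c\<le>?N. dco W A K a b c * s ^ a * t ^ b * r ^ c) = \<dots>" .
  qed (use True in auto)
next
  case False
  then show ?thesis by (auto simp: dco_eq_0 not_le)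
qed

text \<open>With exponent one in the last slot the third matrix supplies exactly one row; linearity
  of \<open>dco W A K a b 1\<close> in K is then linearity of the determinant in that row.\<close>

lemma coloring_single:
  assumes "f \<in> colorings a b 1"
  obtains i G where "\<And>l K. pick4 E W A K (f l) $ l = (if l = i then K $ l else G l)"
proof -
  have "card {i. f i = 3} = 1" using assms by (simp add: colorings_def)
  then obtain i where i: "{i. f i = 3} = {i}" by (auto simp: card_1_singleton_iff)
  have "pick4 E W A K (f l) $ l = (if l = i then K $ l else pick4 E W A E (f l) $ l)" for l K
  proof -
    have "f l \<le> 3" using assms by (simp add: colorings_def)
    moreover have "f l = 3 \<longleftrightarrow> l = i" using i by blast
    ultimately show ?thesis by (auto simp: pick4_def)
  qed
  then show ?thesis by (rule that)
qed

lemma dco_add: 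
  fixes W A K L :: "real ^ 'n ^ 'n"
  shows "dco W A (K + L) a b 1 = dco W A K a b 1 + dco W A L a b 1"
  unfolding dco_def sum.distrib[symmetric]
proof (rule sum.cong[OF refl])
  fix f :: "'n \<Rightarrow> nat" assume "f \<in> colorings a b 1"
  then obtain i G where i: "\<And>l K. pick4 (mat 1) W A K (f l) $ l = (if l = i then K $ l else G l)"
    by (rule coloring_single[where E = "mat 1" and W = W and A = A]) blast
  show "det (\<chi> l. pick4 (mat 1) W A (K + L) (f l) $ l) =
      det (\<chi> l. pick4 (mat 1) W A K (f l) $ l) + det (\<chi> l. pick4 (mat 1) W A L (f l) $ l)"
    unfolding i vector_add_component by (rule det_row_add)
qed

lemma dco_scaleR: 
  fixes W A K L :: "real ^ 'n ^ 'n"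
  shows "dco W A (x *\<^sub>R K) a b 1 = x * dco W A K a b 1"
  unfolding dco_def sum_distrib_left
proof (rule sum.cong[OF refl])
  fix f :: "'n \<Rightarrow> nat" assume "f \<in> colorings a b 1"
  then obtain i G where i: "\<And>l K. pick4 (mat 1) W A K (f l) $ l = (if l = i then K $ l else G l)"
    by (rule coloring_single[where E = "mat 1" and W = W and A = A]) blast
  show "det (\<chi> l. pick4 (mat 1) W A (x *\<^sub>R K) (f l) $ l) = x * det (\<chi> l. pick4 (mat 1) W A K (f l) $ l)"
    unfolding i vector_scaleR_component scalar_mult_eq_scaleR[symmetric] by (rule det_row_mul)
qed

lemma linear_dco: "linear (\<lambda>K. dco W A K a b 1)"
  by (intro linearI) (simp_all only: dco_add dco_scaleR real_scaleR_def)

lemma continuous_on_det [continuous_intros]: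
  fixes F :: "'a::topological_space \<Rightarrow> real ^ 'n ^ 'n"
  assumes "continuous_on S F"
  shows "continuous_on S (\<lambda>x. det (F x))"
  unfolding det_def using assms by (intro continuous_intros)

lemma continuous_on_matrix:
  fixes F :: "'a::topological_space \<Rightarrow> real ^ 'n ^ 'm"
  assumes "\<And>i j. continuous_on S (\<lambda>x. F x $ i $ j)"
  shows "continuous_on S F"
proof -
  have "continuous_on S (\<lambda>x. \<chi> i j. F x $ i $ j)" by (intro continuous_on_vec_lambda assms)
  then show ?thesis by simp
qed

lemma continuous_on_dco [continuous_intros]:
  fixes W A K :: "'a::topological_space \<Rightarrow> real ^ 'n ^ 'n"
  assumes "continuous_on S W" "continuous_on S A" "continuous_on S K"
  shows "continuous_on S (\<lambda>x. dco (W x) (A x) (K x) a b c)"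
  unfolding dco_def
proof (intro continuous_on_sum continuous_on_det)
  fix f :: "'n \<Rightarrow> nat"
  have "continuous_on S (\<lambda>x. pick4 (mat 1) (W x) (A x) (K x) m)" for m
    using assms by (cases "m = 0 \<or> m = 1 \<or> m = 2") (auto simp: pick4_def)
  then show "continuous_on S (\<lambda>x. \<chi> i. pick4 (mat 1) (W x) (A x) (K x) (f i) $ i)"
    by (intro continuous_on_vec_lambda continuous_intros)
qed

lemma dco_independent: 
  fixes W A K L :: "real ^ 'n ^ 'n"
  shows "dco W A K a b 0 = dco W A L a b 0"
  unfolding dco_def
proof (rule sum.cong[OF refl])
  fix f :: "'n \<Rightarrow> nat" assume f: "f \<in> colorings a b 0"
  have "pick4 (mat 1) W A K (f i) = pick4 (mat 1) W A L (f i)" for i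
  proof -
    have "f i \<noteq> 3" "f i \<le> 3" using f by (auto simp: colorings_def)
    then have "f i = 0 \<or> f i = 1 \<or> f i = 2" by linarith
    then show ?thesis by (auto simp: pick4_def)
  qed
  then show "det (\<chi> i. pick4 (mat 1) W A K (f i) $ i) = det (\<chi> i. pick4 (mat 1) W A L (f i) $ i)" by simp
qed

lemma sum_power_0:
  fixes f :: "nat \<Rightarrow> real"
  shows "(\<Sum>i\<le>N. f i * 0 ^ i) = f 0"
proof -
  have "(\<Sum>i\<le>N. f i * 0 ^ i) = (\<Sum>i\<in>{0}. f i * 0 ^ i)" by (rule sum.mono_neutral_right) auto
  then show ?thesis by simp
qed

lemma det_expand2:
  fixes W K :: "real ^ 'n ^ 'n"
  shows "det (mat 1 + s *\<^sub>R W + r *\<^sub>R K) = (\<Sum>a\<le>CARD('n). \<Sum>c\<le>CARD('n). dco W 0 K a 0 c * s ^ a * r ^ c)"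
proof -
  have "(\<Sum>b\<le>CARD('n). \<Sum>c\<le>CARD('n). dco W 0 K a b c * s ^ a * 0 ^ b * r ^ c) = (\<Sum>c\<le>CARD('n). dco W 0 K a 0 c * s ^ a * r ^ c)" for a
    using sum_power_0[of "\<lambda>b. \<Sum>c\<le>CARD('n). dco W 0 K a b c * s ^ a * r ^ c" "CARD('n)"]
    by (simp add: sum_distrib_left sum_distrib_right mult_ac)
  then show ?thesis using det_expand[of s W 0 "0::real^'n^'n" r K] by simp
qed

text \<open>The k-th elementary symmetric function of the eigenvalues of B, obtained without
  eigenvalues and therefore visibly polynomial in the entries.\<close>

definition msym :: "nat \<Rightarrow> real ^ 'n ^ 'n \<Rightarrow> real"
  where "msym k B = dco B 0 0 k 0 0"

lemma det_msym:
  fixes B :: "real ^ 'n ^ 'n"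
  shows "det (mat 1 + s *\<^sub>R B) = (\<Sum>k\<le>CARD('n). msym k B * s ^ k)"
proof -
  have e: "(\<Sum>c\<le>CARD('n). dco B 0 0 a 0 c * s ^ a * 0 ^ c) = msym a B * s ^ a" for a
    using sum_power_0[of "\<lambda>c. dco B 0 0 a 0 c * s ^ a" "CARD('n)"] by (simp add: msym_def)
  have "det (mat 1 + s *\<^sub>R B) = det (mat 1 + s *\<^sub>R B + 0 *\<^sub>R 0)" by simp
  also have "\<dots> = (\<Sum>k\<le>CARD('n). msym k B * s ^ k)" unfolding det_expand2 e ..
  finally show ?thesis .
qed

lemma msym_eq_0: "k > CARD('n) \<Longrightarrow> msym k (B :: real ^ 'n ^ 'n) = 0"
  by (simp add: msym_def dco_eq_0)

text \<open>In det (1 + s W + (s r) K) the power of s is the total degree in W and K, so the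
  coefficient of s^k collects the pairs of exponents k - c and c.\<close>

lemma msym_line:
  fixes W K :: "real ^ 'n ^ 'n"
  shows "msym k (W + r *\<^sub>R K) = (\<Sum>c\<le>k. dco W 0 K (k - c) 0 c * r ^ c)"
proof -
  let ?N = "CARD('n)"
  define g where "g = (\<lambda>c a. dco W 0 K a 0 c * r ^ c)"
  have "(\<Sum>k\<le>2 * ?N. msym k (W + r *\<^sub>R K) * s ^ k) = (\<Sum>k\<le>2 * ?N. (\<Sum>c\<le>k. g c (k - c)) * s ^ k)" for s
  proof -
    have "(\<Sum>k\<le>2 * ?N. msym k (W + r *\<^sub>R K) * s ^ k) = (\<Sum>k\<le>?N. msym k (W + r *\<^sub>R K) * s ^ k)"
      by (rule sum.mono_neutral_right) (auto simp: msym_eq_0)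
    also have "\<dots> = det (mat 1 + s *\<^sub>R W + (s * r) *\<^sub>R K)"
      by (simp add: det_msym[symmetric] scaleR_add_right add.assoc)
    also have "\<dots> = (\<Sum>a\<le>?N. \<Sum>c\<le>?N. dco W 0 K a 0 c * s ^ a * (s * r) ^ c)" by (rule det_expand2)
    also have "\<dots> = (\<Sum>c\<le>?N. \<Sum>a\<le>?N. g c a * s ^ (c + a))"
      by (subst sum.swap) (simp add: g_def power_mult_distrib power_add mult_ac)
    also have "\<dots> = (\<Sum>(c, a)\<in>{..?N} \<times> {..?N}. g c a * s ^ (c + a))" by (simp add: sum.cartesian_product)
    \<comment> \<open>The square of side N lies in the triangle c + a \<le> 2 N, and the
      coefficients outside the square vanish; the triangle can then be summed along its
      diagonals.\<close>
    also have "\<dots> = (\<Sum>(c, a)\<in>{(c, a). c + a \<le> 2 * ?N}. g c a * s ^ (c + a))"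
    proof (rule sum.mono_neutral_left, goal_cases)
      case 1
      show ?case
        by (rule finite_subset[of _ "{..2 * ?N} \<times> {..2 * ?N}"]) auto
    next
      case 3
      show ?case
      proof
        fix x assume x: "x \<in> {(c, a). c + a \<le> 2 * ?N} - {..?N} \<times> {..?N}"
        obtain c a where xe: "x = (c, a)" by (cases x)
        then have "c > ?N \<or> a > ?N" using x by auto
        then have "g c a = 0" by (auto simp: g_def dco_eq_0)
        then show "(case x of (c, a) \<Rightarrow> g c a * s ^ (c + a)) = 0" by (simp add: xe)
      qed
    qed auto
    also have "\<dots> = (\<Sum>k\<le>2 * ?N. \<Sum>c\<le>k. g c (k - c) * s ^ (c + (k - c)))"
      by (rule sum.triangle_reindex_eq)
    also have "\<dots> = (\<Sum>k\<le>2 * ?N. (\<Sum>c\<le>k. g c (k - c)) * s ^ k)"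
      by (simp add: sum_distrib_right)
    finally show ?thesis .
  qed
  then have "msym k (W + r *\<^sub>R K) = (\<Sum>c\<le>k. g c (k - c))" if "k \<le> 2 * ?N"
    using that polyfun_eq_coeffs[where n = "2 * ?N" and c = "\<lambda>k. msym k (W + r *\<^sub>R K)" and d = "\<lambda>k. \<Sum>c\<le>k. g c (k - c)"] by blast
  moreover have "(\<Sum>c\<le>k. g c (k - c)) = 0" if k: "k > 2 * ?N"
  proof (rule sum.neutral, clarify)
    fix c assume "c \<le> k"
    then show "g c (k - c) = 0" using k by (cases "c > ?N") (auto simp: g_def dco_eq_0)
  qed
  ultimately show ?thesis by (cases "k \<le> 2 * ?N") (auto simp: msym_eq_0 g_def)
qed

lemma DERIV_msym_line:
  fixes W K :: "real ^ 'n ^ 'n"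
  assumes "k > 0"
  shows "((\<lambda>r. msym k (W + r *\<^sub>R K)) has_real_derivative dco W 0 K (k - 1) 0 1) (at 0)"
proof -
  have "((\<lambda>r. \<Sum>c\<le>k. dco W 0 K (k - c) 0 c * r ^ c) has_real_derivative
      (\<Sum>c\<le>k. dco W 0 K (k - c) 0 c * (of_nat c * 0 ^ (c - 1)))) (at 0)"
    by (auto intro!: derivative_eq_intros simp: mult_ac)
  moreover have "(\<Sum>c\<le>k. dco W 0 K (k - c) 0 c * (of_nat c * 0 ^ (c - 1))) =
     (\<Sum>c\<in>{1}. dco W 0 K (k - c) 0 c * (of_nat c * 0 ^ (c - 1)))"
    using assms by (intro sum.mono_neutral_right) auto
  ultimately show ?thesis by (simp add: msym_line)
qed

text \<open>Both sides are the coefficient of \<open>r\<close> in \<open>det (1 + s W + (t + r) A)\<close>.\<close>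

lemma dco_double:
  fixes W A :: "real ^ 'n ^ 'n"
  shows "dco W A A a b 1 = real (b + 1) * dco W A 0 a (b + 1) 0"
proof (cases "a \<le> CARD('n) \<and> b \<le> CARD('n)")
  case True
  let ?N = "CARD('n)"
  have "(\<Sum>a\<le>?N. \<Sum>b\<le>?N. dco W A A a b 1 * s ^ a * t ^ b) =
      (\<Sum>a\<le>?N. \<Sum>b\<le>?N. real (b + 1) * dco W A 0 a (b + 1) 0 * s ^ a * t ^ b)" for s t
  proof -
    let ?F = "\<lambda>r. det (mat 1 + s *\<^sub>R W + t *\<^sub>R A + r *\<^sub>R A)"
    have "?F = (\<lambda>r. \<Sum>a\<le>?N. \<Sum>b\<le>?N. \<Sum>c\<le>?N. dco W A A a b c * s ^ a * t ^ b * r ^ c)"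
      unfolding det_expand ..
    then have 1: "(?F has_real_derivative (\<Sum>a\<le>?N. \<Sum>b\<le>?N. \<Sum>c\<le>?N. dco W A A a b c * s ^ a * t ^ b * (of_nat c * 0 ^ (c - 1)))) (at 0)"
      by (auto intro!: derivative_eq_intros simp: mult_ac)
    have e1: "(\<Sum>c\<le>?N. dco W A A a b c * s ^ a * t ^ b * (of_nat c * 0 ^ (c - 1))) = dco W A A a b 1 * s ^ a * t ^ b" for a b
    proof -
      have "(\<Sum>c\<le>?N. dco W A A a b c * s ^ a * t ^ b * (of_nat c * 0 ^ (c - 1))) =
          (\<Sum>c\<in>{1}. dco W A A a b c * s ^ a * t ^ b * (of_nat c * 0 ^ (c - 1)))"
        by (intro sum.mono_neutral_right) (auto simp: Suc_le_eq)
      then show ?thesis by simp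
    qed
    have "?F = (\<lambda>r. \<Sum>a\<le>?N. \<Sum>b\<le>?N. dco W A 0 a b 0 * s ^ a * (t + r) ^ b)"
    proof
      fix r
      have "?F r = det (mat 1 + s *\<^sub>R W + (t + r) *\<^sub>R A)" by (simp add: scaleR_add_left add.assoc)
      also have "\<dots> = (\<Sum>a\<le>?N. \<Sum>b\<le>?N. dco W 0 A a 0 b * s ^ a * (t + r) ^ b)" by (rule det_expand2)
      finally show "?F r = (\<Sum>a\<le>?N. \<Sum>b\<le>?N. dco W A 0 a b 0 * s ^ a * (t + r) ^ b)"
        by (subst dco_swap)
    qed
    then have 2: "(?F has_real_derivative (\<Sum>a\<le>?N. \<Sum>b\<le>?N. dco W A 0 a b 0 * s ^ a * (of_nat b * t ^ (b - 1)))) (at 0)"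
      by (auto intro!: derivative_eq_intros simp: mult_ac)
    have e2: "(\<Sum>b\<le>?N. dco W A 0 a b 0 * s ^ a * (of_nat b * t ^ (b - 1))) =
        (\<Sum>b\<le>?N. real (b + 1) * dco W A 0 a (b + 1) 0 * s ^ a * t ^ b)" for a
    proof -
      obtain N' where N: "?N = Suc N'" by (metis One_nat_def Suc_le_D one_le_card_finite)
      show ?thesis
        unfolding N by (subst sum.atMost_Suc_shift) (simp add: mult_ac dco_eq_0 N)
    qed
    show ?thesis using DERIV_unique[OF 1 2] by (simp only: e1 e2)
  qed
  then show ?thesis
    using poly2_unique[of "\<lambda>a b. dco W A A a b 1" ?N ?N "\<lambda>a b. real (b + 1) * dco W A 0 a (b + 1) 0" a b] True
    by blast
next
  case False
  then show ?thesis by (auto simp: dco_eq_0 not_le)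
qed

section \<open>Garding's inequality for symmetric matrices\<close>

lemma quadratic_nonpos_imp_linear_zero:
  fixes a b :: real
  assumes "\<And>t. 2 * t * a + t\<^sup>2 * b \<le> 0"
  shows "a = 0"
proof (rule ccontr)
  assume a: "a \<noteq> 0"
  \<comment> \<open>At t = a / d the expression equals a^2 (2 d + b) / d^2, and this choice of d
    makes 2 d + b positive.\<close>
  define d where "d = \<bar>b\<bar> + 1"
  have d: "d > 0" "2 * d + b > 0" unfolding d_def by (auto simp: abs_if)
  have "2 * (a / d) * a + (a / d)\<^sup>2 * b = a\<^sup>2 * (2 * d + b) / d\<^sup>2"
    using d by (simp add: field_simps power2_eq_square)
  also have "\<dots> > 0" using a d by simp
  finally show False using assms[of "a / d"] by simp
qed

text \<open>Induction on the dimension: a maximizer u of the Rayleigh quotient on the unit sphere of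
  T is an eigenvector, and its orthogonal complement within T is again invariant. Self-adjointness
  is asked for on T only, so the tangent hyperplane can be treated directly.\<close>

lemma spectral_subspace:
  fixes L :: "'a::euclidean_space \<Rightarrow> 'a"
  assumes "subspace T" "linear L" "\<And>x. x \<in> T \<Longrightarrow> L x \<in> T"
    and "\<And>x y. x \<in> T \<Longrightarrow> y \<in> T \<Longrightarrow> L x \<bullet> y = x \<bullet> L y"
  shows "\<exists>B. B \<subseteq> T \<and> pairwise orthogonal B \<and> (\<forall>b\<in>B. norm b = 1) \<and> span B = T \<and> (\<forall>b\<in>B. \<exists>c. L b = c *\<^sub>R b)"
  using assms
proof (induction "dim T" arbitrary: T rule: less_induct)
  case less
  note T = less.prems(1) and L = less.prems(2) and LT = less.prems(3) and sym = less.prems(4)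
  show ?case
  proof (cases "T = {0}")
    case True
    then show ?thesis by (intro exI[of _ "{}"]) auto
  next
    case False
    then obtain x0 where x0: "x0 \<in> T" "x0 \<noteq> 0" using T subspace_0 by blast
    define S where "S = T \<inter> sphere 0 1"
    have "compact S" unfolding S_def using closed_subspace[OF T] by (intro closed_Int_compact) auto
    moreover have "x0 /\<^sub>R norm x0 \<in> S" using x0 T by (auto simp: S_def subspace_scale)
    moreover have "continuous_on S (\<lambda>x. x \<bullet> L x)"
      using L by (intro continuous_intros linear_continuous_on) (simp add: linear_conv_bounded_linear)
    ultimately obtain u where u: "u \<in> S" "\<And>y. y \<in> S \<Longrightarrow> y \<bullet> L y \<le> u \<bullet> L u"
      using continuous_attains_sup[of S "\<lambda>x. x \<bullet> L x"] by blast
    have uT: "u \<in> T" "u \<bullet> u = 1" using u by (auto simp: S_def dot_square_norm)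
    define m where "m = u \<bullet> L u"
    have key: "x \<bullet> L x \<le> m * (x \<bullet> x)" if "x \<in> T" for x
    proof (cases "x = 0")
      case False
      have "x /\<^sub>R norm x \<in> S" using that False T by (auto simp: S_def subspace_scale)
      then have "(x /\<^sub>R norm x) \<bullet> L (x /\<^sub>R norm x) \<le> m" unfolding m_def by (rule u(2))
      then show ?thesis using False
        by (simp add: linear_cmul[OF L] dot_square_norm field_simps power2_eq_square)
    qed simp
    \<comment> \<open>First order condition at the maximizer u in the directions orthogonal to it.
      It makes L u a multiple of u, since L u stays in T.\<close>
    have orth: "v \<bullet> L u = 0" if v: "v \<in> T" "v \<bullet> u = 0" for v
    proof (rule quadratic_nonpos_imp_linear_zero[where b = "v \<bullet> L v - m * (v \<bullet> v)"])
      fix t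
      have "(u + t *\<^sub>R v) \<bullet> L (u + t *\<^sub>R v) \<le> m * ((u + t *\<^sub>R v) \<bullet> (u + t *\<^sub>R v))"
        using key v uT T by (simp add: subspace_add subspace_scale)
      moreover have "(u + t *\<^sub>R v) \<bullet> L (u + t *\<^sub>R v) = m + 2 * t * (v \<bullet> L u) + t\<^sup>2 * (v \<bullet> L v)"
        using sym[OF uT(1) v(1)]
        by (simp add: linear_add[OF L] linear_cmul[OF L] inner_add_left inner_add_right m_def
            power2_eq_square inner_commute[of "L u" v] algebra_simps)
      moreover have "(u + t *\<^sub>R v) \<bullet> (u + t *\<^sub>R v) = 1 + t\<^sup>2 * (v \<bullet> v)"
        using v uT by (simp add: inner_add_left inner_add_right power2_eq_square inner_commute)
      ultimately have "m + 2 * t * (v \<bullet> L u) + t\<^sup>2 * (v \<bullet> L v) \<le> m * (1 + t\<^sup>2 * (v \<bullet> v))"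
        by (simp only:)
      then show "2 * t * (v \<bullet> L u) + t\<^sup>2 * (v \<bullet> L v - m * (v \<bullet> v)) \<le> 0"
        by (simp add: algebra_simps)
    qed
    have Lu: "L u = m *\<^sub>R u"
    proof -
      define w where "w = L u - m *\<^sub>R u"
      have "w \<in> T" unfolding w_def using uT LT T by (simp add: subspace_diff subspace_scale)
      moreover have wu: "w \<bullet> u = 0" unfolding w_def using uT by (simp add: inner_diff_left inner_diff_right m_def inner_commute)
      ultimately have "w \<bullet> L u = 0" by (rule orth)
      then have "w \<bullet> w = 0" using wu by (subst (2) w_def) (simp add: inner_diff_right)
      then show ?thesis by (simp add: w_def)
    qed
    define T' where "T' = {x \<in> T. x \<bullet> u = 0}"
    have sT': "subspace T'" unfolding T'_def subspace_def
      using T by (auto simp: subspace_0 subspace_add subspace_scale inner_add_left)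
    have "u \<notin> T'" using uT by (simp add: T'_def)
    moreover have "T' \<subseteq> T" by (auto simp: T'_def)
    ultimately have "T' \<subset> T" using uT by blast
    then have "dim T' < dim T" using sT' T by (intro dim_psubset) (metis span_eq_iff)
    moreover have "L x \<in> T'" if "x \<in> T'" for x
      using that LT sym[OF _ uT(1), of x] Lu by (auto simp: T'_def)
    ultimately obtain B where B: "B \<subseteq> T'" "pairwise orthogonal B" "\<forall>b\<in>B. norm b = 1" "span B = T'"
        "\<forall>b\<in>B. \<exists>c. L b = c *\<^sub>R b"
      using less.hyps[of T', OF _ sT' L] sym by (auto simp: T'_def)
    have "span (insert u B) = T"
    proof
      show "span (insert u B) \<subseteq> T" using uT B(1) T by (intro span_minimal) (auto simp: T'_def)
      show "T \<subseteq> span (insert u B)"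
      proof
        fix x assume x: "x \<in> T"
        have "x - (x \<bullet> u) *\<^sub>R u \<in> span B"
          unfolding B(4) T'_def using x uT T by (simp add: subspace_diff subspace_scale inner_diff_left)
        then show "x \<in> span (insert u B)" using span_breakdown_eq by blast
      qed
    qed
    moreover have "pairwise orthogonal (insert u B)"
      using B(1,2) by (auto simp: pairwise_insert orthogonal_def T'_def inner_commute)
    ultimately show ?thesis
      using B uT Lu by (intro exI[of _ "insert u B"]) (auto simp: T'_def norm_eq_1)
  qed
qed

lemma orthonormal_basis_indexing:
  fixes B :: "(real ^ 'n) set"
  assumes "pairwise orthogonal B" "\<forall>b\<in>B. norm b = 1" "span B = UNIV"
  obtains q :: "'n \<Rightarrow> real ^ 'n" where "bij_betw q UNIV B" "orthogonal_matrix (\<chi> i. q i)"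
proof -
  have ind: "independent B" using assms pairwise_orthogonal_independent by force
  have "card B = dim (UNIV :: (real ^ 'n) set)"
    using assms(3) ind by (intro basis_card_eq_dim) auto
  then have "card B = CARD('n)" by simp
  moreover have "finite B" using ind by (rule finiteI_independent)
  ultimately obtain q :: "'n \<Rightarrow> real ^ 'n" where q: "bij_betw q UNIV B"
    using finite_same_card_bij[of "UNIV::'n set" B] by auto
  have "orthogonal_matrix (\<chi> i. q i)"
    unfolding orthogonal_matrix_orthonormal_rows
  proof (intro conjI allI impI)
    fix i j :: 'n
    show "norm (row i (\<chi> i. q i)) = 1" using q assms(2) by (auto simp: row_def bij_betw_def)
    assume "i \<noteq> j"
    then have "q i \<noteq> q j" "q i \<in> B" "q j \<in> B" using q by (auto simp: bij_betw_def inj_on_def)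
    then show "orthogonal (row i (\<chi> i. q i)) (row j (\<chi> i. q i))"
      using assms(1) by (auto simp: row_def pairwise_def)
  qed
  with q that show ?thesis by blast
qed

definition diag_matrix :: "('n \<Rightarrow> real) \<Rightarrow> real ^ 'n ^ 'n"
  where "diag_matrix d = (\<chi> i j. if i = j then d i else 0)"

lemma matrix_conj_nth:
  fixes Q M :: "real ^ 'n ^ 'n"
  shows "(Q ** M ** transpose Q) $ i $ j = Q $ i \<bullet> (M *v Q $ j)"
  by (simp add: matrix_matrix_mult_def transpose_def inner_vec_def matrix_vector_mult_def
      sum_distrib_left sum_distrib_right mult.assoc)
     (rule sum.swap)

lemma conj_eigenbasis:
  fixes M :: "real ^ 'n ^ 'n"
  assumes "orthogonal_matrix (\<chi> i. q i)" "\<And>i. M *v q i = d i *\<^sub>R q i"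
  shows "(\<chi> i. q i) ** M ** transpose (\<chi> i. q i) = diag_matrix d"
proof -
  let ?Q = "(\<chi> i. q i) :: real ^ 'n ^ 'n"
  have "?Q ** mat 1 ** transpose ?Q = mat 1" using assms(1) by (simp add: orthogonal_matrix_def)
  then have "(?Q ** mat 1 ** transpose ?Q) $ i $ j = (mat 1 :: real ^ 'n ^ 'n) $ i $ j" for i j by simp
  then have "q i \<bullet> q j = (mat 1 :: real ^ 'n ^ 'n) $ i $ j" for i j
    unfolding matrix_conj_nth by (simp only: matrix_vector_mul_lid vec_lambda_beta)
  then have "q i \<bullet> q j = (if i = j then 1 else 0)" for i j by (simp add: mat_def)
  then show ?thesis by (simp add: vec_eq_iff matrix_conj_nth assms(2) diag_matrix_def)
qed

lemma diagonalization:
  fixes M :: "real ^ 'n ^ 'n"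
  assumes "transpose M = M"
  obtains Q d where "orthogonal_matrix Q" "Q ** M ** transpose Q = diag_matrix d"
proof -
  have "(M *v x) \<bullet> y = x \<bullet> (M *v y)" for x y
    using assms by (metis dot_lmul_matrix transpose_matrix_vector inner_commute)
  then obtain B where B: "pairwise orthogonal B" "\<forall>b\<in>B. norm b = 1" "span B = UNIV"
      "\<forall>b\<in>B. \<exists>c. M *v b = c *\<^sub>R b"
    using spectral_subspace[of UNIV "(*v) M"] by auto
  then obtain q :: "'n \<Rightarrow> real ^ 'n" where q: "bij_betw q UNIV B" "orthogonal_matrix (\<chi> i. q i)"
    using orthonormal_basis_indexing by metis
  have "\<exists>c. M *v q i = c *\<^sub>R q i" for i using B(4) q(1) by (auto simp: bij_betw_def)
  then obtain d where "\<And>i. M *v q i = d i *\<^sub>R q i" by metis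
  then show ?thesis using that q(2) conj_eigenbasis by blast
qed

section \<open>Determinant coefficients at a diagonal matrix\<close>

lemma prod_eq_sum_esym:
  fixes x :: "'i \<Rightarrow> real"
  assumes "finite I" "card I \<le> M"
  shows "(\<Prod>i\<in>I. 1 + s * x i) = (\<Sum>k\<le>M. esym k I x * s ^ k)"
proof -
  let ?p = "\<Prod>i\<in>I. [:1, x i:]"
  have "(\<Prod>i\<in>I. 1 + s * x i) = poly ?p s" by (simp add: poly_prod)
  also have "\<dots> = (\<Sum>k\<le>degree ?p. coeff ?p k * s ^ k)" by (rule poly_altdef)
  also have "\<dots> = (\<Sum>k\<le>max M (degree ?p). coeff ?p k * s ^ k)"
    by (rule sum.mono_neutral_left) (auto simp: coeff_eq_0)
  also have "\<dots> = (\<Sum>k\<le>M. coeff ?p k * s ^ k)"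
    using esym_eq_0[OF assms(1), of _ x] assms(2)
    by (intro sum.mono_neutral_right) (auto simp: esym_def not_le)
  finally show ?thesis by (simp add: esym_def)
qed

lemma msym_unique:
  fixes B :: "real ^ 'n ^ 'n"
  assumes "\<And>s. det (mat 1 + s *\<^sub>R B) = (\<Sum>k\<le>CARD('n). c k * s ^ k)" "k \<le> CARD('n)"
  shows "msym k B = c k"
  using polyfun_eq_coeffs[where n = "CARD('n)" and c = "\<lambda>k. msym k B" and d = c] assms
  by (simp add: det_msym)

lemma det_diag_matrix: "det (diag_matrix d) = (\<Prod>i\<in>UNIV. d i)"
  by (simp add: det_diagonal diag_matrix_def)

lemma msym_diag:
  fixes d :: "'n::finite \<Rightarrow> real"
  shows "msym k (diag_matrix d) = esym k UNIV d"
proof (cases "k \<le> CARD('n)")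
  case True
  show ?thesis
  proof (rule msym_unique[OF _ True])
    fix s
    have "mat 1 + s *\<^sub>R diag_matrix d = diag_matrix (\<lambda>i. 1 + s * d i)"
      by (simp add: vec_eq_iff diag_matrix_def mat_def)
    then show "det (mat 1 + s *\<^sub>R diag_matrix d) = (\<Sum>k\<le>CARD('n). esym k UNIV d * s ^ k)"
      by (simp add: det_diag_matrix prod_eq_sum_esym[symmetric])
  qed
next
  case False
  then show ?thesis by (simp add: msym_eq_0 esym_eq_0)
qed

lemma msym_conj:
  assumes "orthogonal_matrix Q"
  shows "msym k (Q ** M ** transpose Q) = msym k M"
proof -
  have "Q ** 0 ** transpose Q = 0" by (simp add: vec_eq_iff matrix_matrix_mult_def)
  then show ?thesis using dco_conj[OF assms, of M 0 0 k 0 0] by (simp add: msym_def)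
qed

text \<open>Rows outside R are multiples of unit vectors, so only permutations fixing the complement
  of R contribute. What remains besides the diagonal factors is the principal minor of A on
  R.\<close>

lemma det_rows_diag:
  fixes A :: "real ^ 'n ^ 'n"
  shows "det (\<chi> l. if l \<in> R then A $ l else axis l (e l)) =
    (\<Prod>l\<in>-R. e l) * (\<Sum>p | p permutes R. of_int (sign p) * (\<Prod>l\<in>R. A $ l $ p l))"
proof -
  let ?M = "\<chi> l. if l \<in> R then A $ l else axis l (e l)"
  have "det ?M = (\<Sum>p | p permutes R. of_int (sign p) * (\<Prod>l\<in>UNIV. ?M $ l $ p l))"
    unfolding det_def
  proof (rule sum.mono_neutral_right)
    show "\<forall>p\<in>{p. p permutes UNIV} - {p. p permutes R}. of_int (sign p) * (\<Prod>l\<in>UNIV. ?M $ l $ p l) = 0"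
    proof
      fix p assume p: "p \<in> {p. p permutes (UNIV::'n set)} - {p. p permutes R}"
      then obtain l where "l \<notin> R" "p l \<noteq> l" by (auto simp: permutes_def)
      then have "?M $ l $ p l = 0" by (simp add: axis_def)
      then have "(\<Prod>l\<in>UNIV. ?M $ l $ p l) = 0" by (metis (no_types, lifting) UNIV_I finite prod_zero)
      then show "of_int (sign p) * (\<Prod>l\<in>UNIV. ?M $ l $ p l) = 0" by simp
    qed
    show "{p. p permutes R} \<subseteq> {p. p permutes UNIV}" using permutes_subset by blast
  qed simp
  also have "\<dots> = (\<Sum>p | p permutes R. of_int (sign p) * ((\<Prod>l\<in>R. A $ l $ p l) * (\<Prod>l\<in>-R. e l)))"
  proof (rule sum.cong[OF refl])
    fix p assume "p \<in> {p. p permutes R}"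
    then have p: "p l = l" if "l \<notin> R" for l using that by (simp add: permutes_def)
    have "(\<Prod>l\<in>UNIV. ?M $ l $ p l) = (\<Prod>l\<in>R. ?M $ l $ p l) * (\<Prod>l\<in>-R. ?M $ l $ p l)"
      by (subst prod.union_disjoint[symmetric]) auto
    then show "of_int (sign p) * (\<Prod>l\<in>UNIV. ?M $ l $ p l) =
        of_int (sign p) * ((\<Prod>l\<in>R. A $ l $ p l) * (\<Prod>l\<in>-R. e l))"
      using p by simp
  qed
  finally show ?thesis by (simp add: sum_distrib_left mult_ac)
qed

lemma det_add_rows:
  fixes E A :: "real ^ 'n ^ 'n"
  shows "det (E + r *\<^sub>R A) = (\<Sum>R\<in>UNIV. r ^ card R * det (\<chi> l. if l \<in> R then A $ l else E $ l))"
proof -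
  let ?a = "\<lambda>i m. (if m then r else 1) *s (if m then A $ i else E $ i)"
  have eq: "E + r *\<^sub>R A = (\<chi> i. \<Sum>m\<in>UNIV. ?a i m)" by (simp add: vec_eq_iff UNIV_bool)
  have "det (E + r *\<^sub>R A) = (\<Sum>f | \<forall>i. f i \<in> UNIV. (\<Prod>i\<in>UNIV. if f i then r else 1) * det (\<chi> i. if f i then A $ i else E $ i))"
    unfolding eq by (subst det_sum_rows) (simp_all only: finite det_rows_mul)
  also have "\<dots> = (\<Sum>R\<in>UNIV. r ^ card R * det (\<chi> l. if l \<in> R then A $ l else E $ l))"
    by (rule sum.reindex_bij_witness[of _ "\<lambda>R i. i \<in> R" Collect]) (simp_all add: prod_indicator_power)
  finally show ?thesis .
qed

text \<open>Expanding by rows with s held fixed, the coefficient of r^c consists of the determinants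
  with exactly c rows taken from A.\<close>

lemma dco_rows:
  fixes W A :: "real ^ 'n ^ 'n"
  assumes "c \<le> CARD('n)"
  shows "(\<Sum>a\<le>CARD('n). dco W 0 A a 0 c * s ^ a) =
    (\<Sum>R | card R = c. det (\<chi> l. if l \<in> R then A $ l else (mat 1 + s *\<^sub>R W) $ l))"
proof -
  let ?N = "CARD('n)"
  let ?E = "mat 1 + s *\<^sub>R W"
  let ?g = "\<lambda>R. det (\<chi> l. if l \<in> R then A $ l else ?E $ l)"
  have "(\<Sum>c\<le>?N. (\<Sum>a\<le>?N. dco W 0 A a 0 c * s ^ a) * r ^ c) = (\<Sum>c\<le>?N. (\<Sum>R | card R = c. ?g R) * r ^ c)" for r
  proof -
    have "(\<Sum>c\<le>?N. (\<Sum>a\<le>?N. dco W 0 A a 0 c * s ^ a) * r ^ c) = det (?E + r *\<^sub>R A)"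
      unfolding det_expand2 by (subst sum.swap) (simp add: sum_distrib_right)
    also have "\<dots> = (\<Sum>R\<in>UNIV. r ^ card R * ?g R)" by (rule det_add_rows)
    also have "\<dots> = (\<Sum>c\<le>?N. \<Sum>R | R \<in> UNIV \<and> card R = c. r ^ card R * ?g R)"
      by (rule sum.group[symmetric]) (auto intro: card_mono)
    finally show ?thesis by (simp add: sum_distrib_left sum_distrib_right mult.commute)
  qed
  then show ?thesis
    using polyfun_eq_coeffs[where n = ?N and c = "\<lambda>c. \<Sum>a\<le>?N. dco W 0 A a 0 c * s ^ a" and d = "\<lambda>c. \<Sum>R | card R = c. ?g R"] assms
    by blast
qed

lemma diag_row: "(mat 1 + s *\<^sub>R diag_matrix d) $ l = axis l (1 + s * d l)"
  by (simp add: vec_eq_iff mat_def diag_matrix_def axis_def)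

lemma dco_diag_1:
  fixes A :: "real ^ 'n ^ 'n"
  shows "dco (diag_matrix d) 0 A m 0 1 = (\<Sum>i\<in>UNIV. A $ i $ i * esym m (UNIV - {i}) d)"
proof (cases "m \<le> CARD('n)")
  case True
  let ?N = "CARD('n)"
  have "(\<Sum>a\<le>?N. dco (diag_matrix d) 0 A a 0 1 * s ^ a) =
      (\<Sum>a\<le>?N. (\<Sum>i\<in>UNIV. A $ i $ i * esym a (UNIV - {i}) d) * s ^ a)" for s
  proof -
    let ?g = "\<lambda>R. det (\<chi> l. if l \<in> R then A $ l else axis l (1 + s * d l))"
    have "{R :: 'n set. card R = 1} = (\<lambda>i. {i}) ` UNIV" by (auto simp: card_1_singleton_iff)
    then have "(\<Sum>R | card R = 1. ?g R) = (\<Sum>i\<in>UNIV. ?g {i})" by (simp add: sum.reindex del: One_nat_def)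
    also have "\<dots> = (\<Sum>i\<in>UNIV. A $ i $ i * (\<Sum>a\<le>?N. esym a (UNIV - {i}) d * s ^ a))"
    proof (rule sum.cong[OF refl])
      fix i :: 'n
      have "(\<Prod>l\<in>-{i}. 1 + s * d l) = (\<Sum>a\<le>?N. esym a (UNIV - {i}) d * s ^ a)"
        unfolding Compl_eq_Diff_UNIV by (intro prod_eq_sum_esym card_mono) auto
      then show "?g {i} = A $ i $ i * (\<Sum>a\<le>?N. esym a (UNIV - {i}) d * s ^ a)"
        by (subst det_rows_diag) simp
    qed
    also have "\<dots> = (\<Sum>i\<in>UNIV. \<Sum>a\<le>?N. A $ i $ i * esym a (UNIV - {i}) d * s ^ a)"
      by (simp add: sum_distrib_left mult.assoc)
    also have "\<dots> = (\<Sum>a\<le>?N. (\<Sum>i\<in>UNIV. A $ i $ i * esym a (UNIV - {i}) d) * s ^ a)"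
      by (subst sum.swap) (simp add: sum_distrib_right)
    finally show ?thesis using dco_rows[of 1 "diag_matrix d" A s] unfolding diag_row by (simp add: Suc_le_eq)
  qed
  then show ?thesis
    using polyfun_eq_coeffs[where n = ?N and c = "\<lambda>a. dco (diag_matrix d) 0 A a 0 1"
      and d = "\<lambda>a. \<Sum>i\<in>UNIV. A $ i $ i * esym a (UNIV - {i}) d"] True
    by blast
next
  case False
  have "esym m (UNIV - {i}) d = 0" for i :: 'n
    using False card_mono[of UNIV "UNIV - {i}"] by (intro esym_eq_0) auto
  with False show ?thesis by (simp add: dco_eq_0)
qed

lemma sum_pairs:
  fixes g :: "'n::finite set \<Rightarrow> real"
  shows "(\<Sum>i\<in>UNIV. \<Sum>j\<in>UNIV - {i}. g {i, j}) = 2 * (\<Sum>R | card R = 2. g R)"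
proof -
  let ?P = "Sigma UNIV (\<lambda>i::'n. UNIV - {i})"
  let ?h = "\<lambda>(i::'n, j). {i, j}"
  have "(\<Sum>i\<in>UNIV. \<Sum>j\<in>UNIV - {i}. g {i, j}) = (\<Sum>x\<in>?P. g (?h x))"
    by (subst sum.Sigma) (auto simp: case_prod_unfold)
  also have "\<dots> = (\<Sum>R | card R = 2. \<Sum>x | x \<in> ?P \<and> ?h x = R. g (?h x))"
    by (rule sum.group[symmetric]) (auto, metis card_2_iff)
  also have "\<dots> = (\<Sum>R | card R = 2. 2 * g R)"
  proof (rule sum.cong[OF refl])
    fix R :: "'n set" assume "R \<in> {R. card R = 2}"
    then obtain a b where R: "R = {a, b}" "a \<noteq> b" by (auto simp: card_2_iff)
    have "{x. x \<in> ?P \<and> ?h x = R} = {(a, b), (b, a)}" using R by (auto simp: doubleton_eq_iff)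
    then show "(\<Sum>x | x \<in> ?P \<and> ?h x = R. g (?h x)) = 2 * g R" using R by (simp add: insert_commute)
  qed
  finally show ?thesis by (simp add: sum_distrib_left)
qed

text \<open>The 2 x 2 principal minors of A appear, each twice because pairs are ordered. The
  product of the two off-diagonal entries is the only difference from the second-order jet of
  e_{m+2} along the diagonal of A.\<close>

lemma dco_diag_2:
  fixes A :: "real ^ 'n ^ 'n"
  assumes "2 \<le> CARD('n)"
  shows "2 * dco (diag_matrix d) 0 A m 0 2 =
    (\<Sum>i\<in>UNIV. \<Sum>j\<in>UNIV - {i}. (A $ i $ i * A $ j $ j - A $ i $ j * A $ j $ i) * esym m (UNIV - {i} - {j}) d)"
proof (cases "m \<le> CARD('n)")
  case True
  let ?N = "CARD('n)"
  let ?x = "\<lambda>i j. A $ i $ i * A $ j $ j - A $ i $ j * A $ j $ i"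
  have "(\<Sum>a\<le>?N. (2 * dco (diag_matrix d) 0 A a 0 2) * s ^ a) =
      (\<Sum>a\<le>?N. (\<Sum>i\<in>UNIV. \<Sum>j\<in>UNIV - {i}. ?x i j * esym a (UNIV - {i} - {j}) d) * s ^ a)" for s
  proof -
    let ?g = "\<lambda>R. det (\<chi> l. if l \<in> R then A $ l else axis l (1 + s * d l))"
    have g: "?g {i, j} = (\<Sum>a\<le>?N. ?x i j * esym a (UNIV - {i} - {j}) d * s ^ a)" if "i \<noteq> j" for i j
    proof -
      have "- {i, j} = UNIV - {i} - {j}" by auto
      then have "(\<Prod>l\<in>-{i, j}. 1 + s * d l) = (\<Sum>a\<le>?N. esym a (UNIV - {i} - {j}) d * s ^ a)"
        using prod_eq_sum_esym[of "UNIV - {i} - {j}" ?N s d] card_mono[of UNIV "UNIV - {i} - {j}"] by simp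
      moreover have "{p. p permutes {i, j}} = {id, Transposition.transpose i j}"
        by (auto simp: permutes_doubleton_iff)
      moreover have "id \<noteq> Transposition.transpose i j" using that by (metis id_apply transpose_apply_first)
      ultimately show ?thesis
        using that by (subst det_rows_diag) (simp add: permutes_doubleton_iff sign_swap_id sum_distrib_left sum_distrib_right mult_ac)
    qed
    have "(\<Sum>a\<le>?N. (2 * dco (diag_matrix d) 0 A a 0 2) * s ^ a) = 2 * (\<Sum>R | card R = 2. ?g R)"
      using dco_rows[of 2 "diag_matrix d" A s] assms unfolding diag_row
      by (simp add: mult.assoc flip: sum_distrib_left)
    also have "\<dots> = (\<Sum>i\<in>UNIV. \<Sum>j\<in>UNIV - {i}. ?g {i, j})" by (rule sum_pairs[symmetric])
    also have "\<dots> = (\<Sum>i\<in>UNIV. \<Sum>j\<in>UNIV - {i}. \<Sum>a\<le>?N. ?x i j * esym a (UNIV - {i} - {j}) d * s ^ a)"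
      using g by (intro sum.cong refl) auto
    also have "\<dots> = (\<Sum>i\<in>UNIV. \<Sum>a\<le>?N. \<Sum>j\<in>UNIV - {i}. ?x i j * esym a (UNIV - {i} - {j}) d * s ^ a)"
      by (intro sum.cong refl sum.swap)
    also have "\<dots> = (\<Sum>a\<le>?N. (\<Sum>i\<in>UNIV. \<Sum>j\<in>UNIV - {i}. ?x i j * esym a (UNIV - {i} - {j}) d) * s ^ a)"
      by (subst sum.swap) (simp add: sum_distrib_right)
    finally show ?thesis .
  qed
  then show ?thesis
    using polyfun_eq_coeffs[where n = ?N and c = "\<lambda>a. 2 * dco (diag_matrix d) 0 A a 0 2"
      and d = "\<lambda>a. \<Sum>i\<in>UNIV. \<Sum>j\<in>UNIV - {i}. ?x i j * esym a (UNIV - {i} - {j}) d"] True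
    by blast
next
  case False
  have "esym m (UNIV - {i} - {j}) d = 0" for i j :: 'n
    using False card_mono[of UNIV "UNIV - {i} - {j}"] by (intro esym_eq_0) auto
  with False show ?thesis by (simp add: dco_eq_0)
qed

text \<open>In an eigenbasis of W the off-diagonal entries of A enter the second-order coefficient
  only through - B_ij^2 e_{k-2}, and e_{k-2} stays positive after removal of two indices. Dropping
  these terms leaves the inequality for the diagonal jet. Exponent 2 is half a second derivative,
  whence the 2.\<close>

theorem garding_matrix:
  fixes W A :: "real ^ 'n ^ 'n"
  assumes W: "transpose W = W" and A: "transpose A = A"
    and k: "2 \<le> k" "k \<le> CARD('n)" and pos: "\<And>j. j \<in> {1..k} \<Longrightarrow> msym j W > 0"
  shows "2 * real k * dco W 0 A (k - 2) 0 2 * msym k W \<le> (real k - 1) * (dco W 0 A (k - 1) 0 1)\<^sup>2"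
proof -
  obtain Q d where Q: "orthogonal_matrix Q" and d: "Q ** W ** transpose Q = diag_matrix d"
    using diagonalization[OF W] by metis
  define B where "B = Q ** A ** transpose Q"
  have "transpose B = B" unfolding B_def
    using A by (simp add: matrix_transpose_mul matrix_mul_assoc)
  moreover have "transpose B $ i $ j = B $ j $ i" for i j by (simp add: transpose_def)
  ultimately have Bs: "B $ i $ j = B $ j $ i" for i j by simp
  have "Q ** 0 ** transpose Q = 0" by (simp add: vec_eq_iff matrix_matrix_mult_def)
  then have dco: "dco W 0 A a b c = dco (diag_matrix d) 0 B a b c" for a b c
    using dco_conj[OF Q, of W 0 A a b c] by (simp add: d B_def)
  have ms: "msym j W = esym j UNIV d" for j
    using msym_conj[OF Q, of j W] by (simp add: d msym_diag)
  have cone: "gamma_cone k UNIV d" using pos by (simp add: gamma_cone_def ms)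
  let ?a = "\<lambda>i. B $ i $ i"
  let ?E = "esym k UNIV (jet d ?a)"
  have k': "Suc (k - 1) = k" "Suc (Suc (k - 2)) = k" using k by auto
  have 1: "dco W 0 A (k - 1) 0 1 = fps_nth ?E 1"
    using esym_jet_1[of UNIV "k - 1" d ?a] unfolding k' dco dco_diag_1 by simp
  have "2 * dco W 0 A (k - 2) 0 2 \<le> 2 * fps_nth ?E 2"
  proof -
    have "2 * dco W 0 A (k - 2) 0 2 =
      (\<Sum>i\<in>UNIV. \<Sum>j\<in>UNIV - {i}. (?a i * ?a j - (B $ i $ j)\<^sup>2) * esym (k - 2) (UNIV - {i} - {j}) d)"
      unfolding dco using k by (subst dco_diag_2) (auto simp: Bs power2_eq_square)
    also have "\<dots> \<le> (\<Sum>i\<in>UNIV. \<Sum>j\<in>UNIV - {i}. ?a i * ?a j * esym (k - 2) (UNIV - {i} - {j}) d)"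
    proof (intro sum_mono mult_right_mono)
      fix i j :: 'n assume j: "j \<in> UNIV - {i}"
      have "gamma_cone (Suc (k - 2)) (UNIV - {i}) d"
        using gamma_cone_remove[of UNIV "Suc (k - 2)" d i] cone k' by simp
      then have "gamma_cone (k - 2) (UNIV - {i} - {j}) d"
        using gamma_cone_remove[of "UNIV - {i}" "k - 2" d j] j by simp
      then show "0 \<le> esym (k - 2) (UNIV - {i} - {j}) d" using gamma_cone_esym_pos by (metis less_imp_le order_refl)
    qed simp
    also have "\<dots> = 2 * fps_nth ?E 2"
      using esym_jet_2[of UNIV "k - 2" d ?a] unfolding k' by simp
    finally show ?thesis .
  qed
  moreover have "msym k W > 0" using pos k by auto
  ultimately have "(2 * dco W 0 A (k - 2) 0 2) * (real k * msym k W) \<le> (2 * fps_nth ?E 2) * (real k * msym k W)"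
    by (intro mult_right_mono) auto
  also have "\<dots> = 2 * real k * fps_nth ?E 2 * esym k UNIV d" by (simp add: ms)
  also have "\<dots> \<le> (real k - 1) * (fps_nth ?E 1)\<^sup>2" by (rule garding_esym[OF _ cone]) simp
  finally show ?thesis unfolding 1 by (simp add: mult_ac)
qed

section \<open>The Jacobian determinant as a null Lagrangian\<close>

text \<open>
  The change of variables theorems of the library require a well-ordered index type, so we make a
  well-ordered copy of an arbitrary finite type.
\<close>

typedef 'a fin_idx = "{..<CARD('a::finite)}"
  by (rule exI[of _ 0]) simp

instantiation fin_idx :: (finite) wellorder
begin

definition "x \<le> y \<longleftrightarrow> Rep_fin_idx x \<le> Rep_fin_idx y"
definition "x < y \<longleftrightarrow> Rep_fin_idx x < Rep_fin_idx y"

instance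
proof
  fix P :: "'a fin_idx \<Rightarrow> bool" and a
  assume step: "\<And>x. (\<And>y. y < x \<Longrightarrow> P y) \<Longrightarrow> P x"
  show "P a"
    by (induction a rule: measure_induct_rule[of Rep_fin_idx]) (auto intro: step simp: less_fin_idx_def)
qed (auto simp: less_eq_fin_idx_def less_fin_idx_def Rep_fin_idx_inject)

end

instance fin_idx :: (finite) finite
proof
  have "finite (Abs_fin_idx ` {..<CARD('a)} :: 'a fin_idx set)" by simp
  then show "finite (UNIV :: 'a fin_idx set)"
    using type_definition.univ[OF type_definition_fin_idx] by metis
qed

lemma card_fin_idx: "CARD('a fin_idx) = CARD('a::finite)"
  using type_definition.card[OF type_definition_fin_idx] by simp

lemma bij_fin_idx: "\<exists>f :: 'a fin_idx \<Rightarrow> 'a::finite. bij f"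
  using finite_same_card_bij[of "UNIV :: 'a fin_idx set" "UNIV :: 'a set"] card_fin_idx by auto

lemma det_reindex:
  fixes A :: "real ^ 'n ^ 'n" and f :: "'m::finite \<Rightarrow> 'n"
  assumes "bij f"
  shows "det (\<chi> i j. A $ f i $ f j) = det A"
proof -
  have inj: "inj f" using assms by (rule bij_is_inj)
  have bb: "bij_betw f UNIV UNIV" using assms by simp
  have bbi: "bij_betw (inv f) UNIV UNIV" using assms by (rule bij_imp_bij_inv)
  let ?m = "map_permutation UNIV f"
  have "bij_betw ?m {p. p permutes UNIV} {p. p permutes UNIV}"
  proof (rule bij_betwI[where g = "map_permutation UNIV (inv f)"])
    show "?m \<in> {p. p permutes UNIV} \<rightarrow> {p. p permutes UNIV}"
      using map_permutation_permutes[OF bb] by auto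
    show "map_permutation UNIV (inv f) \<in> {p. p permutes UNIV} \<rightarrow> {p. p permutes UNIV}"
      using map_permutation_permutes[of "inv f" UNIV UNIV] assms bij_imp_bij_inv by auto
    show "map_permutation UNIV (inv f) (?m p) = p" if "p \<in> {p. p permutes UNIV}" for p
      using map_permutation_compose_inv[OF bb, of p "inv f"] that inj by simp
    show "?m (map_permutation UNIV (inv f) p) = p" if "p \<in> {p. p permutes UNIV}" for p
      using map_permutation_compose_inv[OF bbi, of p f] that assms
      by (simp add: bij_is_surj surj_f_inv_f)
  qed
  then have "det A = (\<Sum>p | p permutes UNIV. of_int (sign (?m p)) * (\<Prod>i\<in>UNIV. A $ i $ (?m p) i))"
    unfolding det_def by (subst sum.reindex_bij_betw[symmetric]) auto
  also have "\<dots> = (\<Sum>p | p permutes UNIV. of_int (sign p) * (\<Prod>i\<in>UNIV. A $ f i $ f (p i)))"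
  proof (rule sum.cong[OF refl])
    fix p :: "'m \<Rightarrow> 'm" assume "p \<in> {p. p permutes UNIV}"
    then have "sign (?m p) = sign p" using sign_map_permutation[OF inj, of p] by simp
    moreover have "(\<Prod>i\<in>UNIV. A $ i $ (?m p) i) = (\<Prod>i\<in>UNIV. A $ f i $ (?m p) (f i))"
      by (rule prod.reindex_bij_betw[OF bb, symmetric])
    moreover have "(?m p) (f i) = f (p i)" for i by (rule map_permutation_apply[OF inj]) simp
    ultimately show "of_int (sign (?m p)) * (\<Prod>i\<in>UNIV. A $ i $ (?m p) i) =
        of_int (sign p) * (\<Prod>i\<in>UNIV. A $ f i $ f (p i))" by simp
  qed
  also have "\<dots> = det (\<chi> i j. A $ f i $ f j)" by (simp add: det_def)
  finally show ?thesis by simp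
qed

lemma msym_top: "msym CARD('n) M = det (M :: real ^ 'n ^ 'n)"
proof -
  have "colorings CARD('n) 0 0 = {\<lambda>_::'n. 1}"
  proof
    show "colorings CARD('n) 0 0 \<subseteq> {\<lambda>_::'n. 1}"
    proof
      fix f :: "'n \<Rightarrow> nat" assume "f \<in> colorings CARD('n) 0 0"
      then have "card {i. f i = 1} = CARD('n)" by (simp add: colorings_def)
      then have "{i. f i = 1} = UNIV" by (intro card_subset_eq) auto
      then have "f i = 1" for i by blast
      then show "f \<in> {\<lambda>_. 1}" by auto
    qed
    show "{\<lambda>_::'n. 1} \<subseteq> colorings CARD('n) 0 0" by (auto simp: colorings_def)
  qed
  then show ?thesis by (simp add: msym_def dco_def pick4_def)
qed

lemma continuous_on_msym: "continuous_on S F \<Longrightarrow> continuous_on S (\<lambda>x. msym k (F x))"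
  unfolding msym_def by (intro continuous_intros)

lemma matrix_diff_bound:
  fixes A :: "real ^ 'n ^ 'm"
  shows "onorm ((*v) A) \<le> real CARD('m) * real CARD('n) * norm A"
proof (rule onorm_le_matrix_component)
  show "\<bar>A $ i $ j\<bar> \<le> norm A" for i j
    by (rule order_trans[OF component_le_norm_cart Finite_Cartesian_Product.norm_nth_le])
qed

lemma set_integrable_compact:
  fixes f :: "'a::euclidean_space \<Rightarrow> real"
  assumes "compact S" "continuous_on S f"
  shows "set_integrable lborel S f"
  unfolding set_integrable_def using assms by (rule borel_integrable_compact)

lemma derivative_outside_ball:
  fixes w :: "'a::real_normed_vector \<Rightarrow> 'b::real_normed_vector"
  assumes "\<And>x. R < norm x \<Longrightarrow> w x = 0" "(w has_derivative w') (at x)" "R < norm x"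
  shows "w' = (\<lambda>_. 0)"
proof -
  have "open {x :: 'a. R < norm x}" by (intro open_Collect_less continuous_intros)
  then have "((\<lambda>_. 0) has_derivative w') (at x)"
    by (rule has_derivative_transform_within_open[OF assms(2)]) (use assms in auto)
  then show ?thesis by (rule has_derivative_unique) simp
qed

text \<open>For small e the map x + e w(x) is a contraction perturbation of the identity; it is
  bijective and preserves the ball. By change of variables the integral of det (1 + e Dw) is the
  volume of the ball for all such e. It is a polynomial in e, and its top coefficient, the integral
  of det Dw, must vanish. Only first derivatives of w are involved.\<close>

lemma null_lagrangian_wellorder:
  fixes w :: "real ^ 'm::{finite,wellorder} \<Rightarrow> real ^ 'm::_"
  assumes D: "\<And>x. (w has_derivative w' x) (at x)"
    and C: "continuous_on UNIV (\<lambda>x. matrix (w' x))"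
    and supp: "\<And>x. R < norm x \<Longrightarrow> w x = 0"
  shows "integral (cball 0 R) (\<lambda>x. det (matrix (w' x))) = 0"
proof -
  let ?B = "cball (0 :: real ^ 'm::_) R"
  let ?M = "\<lambda>x. matrix (w' x)"
  have w': "w' x = (*v) (?M x)" for x
    using has_derivative_linear[OF D] by (simp add: matrix_works fun_eq_iff)
  have zero: "w' x = (\<lambda>_. 0)" if "R < norm x" for x
    by (rule derivative_outside_ball[OF supp D that])
  have "compact (?M ` ?B)" by (intro compact_continuous_image continuous_on_subset[OF C]) auto
  then obtain K where K: "\<And>x. x \<in> ?B \<Longrightarrow> norm (?M x) \<le> K"
    using compact_imp_bounded bounded_iff by (metis image_eqI)
  define L where "L = \<bar>real CARD('m) * real CARD('m) * K\<bar> + 1"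
  have L: "L > 0" by (simp add: L_def)
  have on: "onorm (w' x) \<le> L" for x
  proof (cases "x \<in> ?B")
    case True
    have "onorm (w' x) \<le> real CARD('m) * real CARD('m) * norm (?M x)"
      using w'[of x] matrix_diff_bound[of "?M x"] by simp
    also have "\<dots> \<le> real CARD('m) * real CARD('m) * K" using K[OF True] by (intro mult_left_mono) auto
    finally show ?thesis by (simp add: L_def)
  next
    case False
    then have "onorm (w' x) = 0" using zero[of x] by (simp add: onorm_zero)
    then show ?thesis using L by simp
  qed
  have lip: "norm (w x - w y) \<le> L * norm (x - y)" for x y
    using differentiable_bound[of UNIV w w' L x y] D on by simp
  have vol: "(\<Sum>k\<le>CARD('m). integral ?B (\<lambda>x. msym k (?M x)) * e ^ k) = measure lebesgue ?B"
    if e: "0 < e" "e * L < 1" for e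
  proof -
    define \<Psi> where "\<Psi> = (\<lambda>x. x + e *\<^sub>R w x)"
    have con: "norm (e *\<^sub>R w x - e *\<^sub>R w y) \<le> (e * L) * norm (x - y)" for x y
      using mult_left_mono[OF lip[of x y], of e] e by (simp add: mult.assoc flip: scaleR_diff_right)
    have inj: "inj \<Psi>"
    proof (rule injI)
      fix x y assume "\<Psi> x = \<Psi> y"
      then have "x - y = e *\<^sub>R w y - e *\<^sub>R w x" by (simp add: \<Psi>_def algebra_simps)
      then have "norm (x - y) \<le> (e * L) * norm (x - y)" using con[of y x] by (simp add: norm_minus_commute)
      then have "(1 - e * L) * norm (x - y) \<le> 0" by (simp add: algebra_simps)
      then show "x = y" using e by (simp add: mult_le_0_iff)
    qed
    have surj: "\<exists>x. \<Psi> x = y" for y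
    proof -
      have "\<exists>!x. y - e *\<^sub>R w x = x"
      proof (rule banach_fix_type)
        show "\<forall>u v. dist (y - e *\<^sub>R w u) (y - e *\<^sub>R w v) \<le> (e * L) * dist u v"
          using con by (simp add: dist_norm norm_minus_commute)
      qed (use e L in auto)
      then obtain x where "y - e *\<^sub>R w x = x" by blast
      then show ?thesis by (intro exI[of _ x]) (simp add: \<Psi>_def algebra_simps)
    qed
    have out: "\<Psi> x = x" if "x \<notin> ?B" for x using supp that by (simp add: \<Psi>_def)
    \<comment> \<open>Outside the ball \<Psi> is the identity. A point of the ball sent outside
      would share its image with that image point itself, against injectivity.\<close>
    have img: "\<Psi> ` ?B = ?B"
    proof
      show "\<Psi> ` ?B \<subseteq> ?B"
      proof clarify
        fix x assume x: "x \<in> ?B"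
        show "\<Psi> x \<in> ?B"
        proof (rule ccontr)
          assume "\<Psi> x \<notin> ?B"
          then have "\<Psi> (\<Psi> x) = \<Psi> x" by (rule out)
          then have "\<Psi> x = x" using inj by (simp add: inj_eq)
          with x \<open>\<Psi> x \<notin> ?B\<close> show False by simp
        qed
      qed
      show "?B \<subseteq> \<Psi> ` ?B"
      proof
        fix y assume y: "y \<in> ?B"
        obtain x where x: "\<Psi> x = y" using surj by blast
        then have "x \<in> ?B" using out[of x] y by (cases "x \<in> ?B") auto
        with x show "y \<in> \<Psi> ` ?B" by blast
      qed
    qed
    have der: "(\<Psi> has_derivative (\<lambda>v. v + e *\<^sub>R w' x v)) (at x)" for x
      unfolding \<Psi>_def by (auto intro!: derivative_eq_intros D)
    have mat: "matrix (\<lambda>v. v + e *\<^sub>R w' x v) = mat 1 + e *\<^sub>R ?M x" for x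
      by (simp add: vec_eq_iff matrix_def mat_def axis_def)
    \<comment> \<open>Otherwise the determinant vanishes at some s in [0, e], because it is 1 at s =
      0. A kernel vector v then satisfies v = - s Dw v, impossible since s |Dw| < 1. Positivity
      removes the absolute value in the change of variables.\<close>
    have pos: "det (mat 1 + e *\<^sub>R ?M x) > 0" for x
    proof (rule ccontr)
      assume neg: "\<not> det (mat 1 + e *\<^sub>R ?M x) > 0"
      have "\<exists>s\<ge>0. s \<le> e \<and> det (mat 1 + s *\<^sub>R ?M x) = 0"
      proof (rule IVT2')
        show "continuous_on {0..e} (\<lambda>s. det (mat 1 + s *\<^sub>R ?M x))" by (intro continuous_intros)
      qed (use neg e in auto)
      then obtain s where s: "0 \<le> s" "s \<le> e" "det (mat 1 + s *\<^sub>R ?M x) = 0" by blast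
      then have "\<not> inj ((*v) (mat 1 + s *\<^sub>R ?M x))" by (simp add: det_nz_iff_inj[symmetric])
      then obtain v where v: "v \<noteq> 0" "(mat 1 + s *\<^sub>R ?M x) *v v = 0"
        using linear_injective_0[of "(*v) (mat 1 + s *\<^sub>R ?M x)"] by auto
      have "v + s *\<^sub>R w' x v = 0"
        using v(2) unfolding fun_cong[OF w', of x v] matrix_vector_mult_add_rdistrib
          scaleR_matrix_vector_assoc[symmetric] by simp
      then have "v = - (s *\<^sub>R w' x v)" by (rule eq_neg_iff_add_eq_0[THEN iffD2])
      then have "norm v = norm (s *\<^sub>R w' x v)" using norm_minus_cancel[of "s *\<^sub>R w' x v"] by simp
      then have "norm v = s * norm (w' x v)" using s by simp
      also have "\<dots> \<le> s * (L * norm v)"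
      proof (intro mult_left_mono)
        have "norm (w' x v) \<le> onorm (w' x) * norm v" using has_derivative_bounded_linear[OF D] by (rule onorm)
        also have "\<dots> \<le> L * norm v" using on by (intro mult_right_mono) auto
        finally show "norm (w' x v) \<le> L * norm v" .
      qed (use s in auto)
      also have "\<dots> \<le> e * (L * norm v)" using s L by (intro mult_right_mono) auto
      finally have "(1 - e * L) * norm v \<le> 0" by (simp add: algebra_simps)
      then show False using e v by (simp add: mult_le_0_iff)
    qed
    have cont: "continuous_on ?B (\<lambda>x. det (mat 1 + e *\<^sub>R ?M x))"
      by (intro continuous_intros continuous_on_subset[OF C]) auto
    have "measure lebesgue (\<Psi> ` ?B) = integral ?B (\<lambda>x. \<bar>det (matrix (\<lambda>v. v + e *\<^sub>R w' x v))\<bar>)"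
    proof (rule measure_differentiable_image_eq)
      show "(\<Psi> has_derivative (\<lambda>v. v + e *\<^sub>R w' x v)) (at x within ?B)" for x
        using der by (rule has_derivative_at_withinI)
      show "inj_on \<Psi> ?B" using inj inj_on_subset by blast
      show "(\<lambda>x. \<bar>det (matrix (\<lambda>v. v + e *\<^sub>R w' x v))\<bar>) integrable_on ?B"
        unfolding mat using cont
        by (intro set_borel_integral_eq_integral(1) set_integrable_compact continuous_on_rabs) auto
    qed simp
    also have "\<dots> = integral ?B (\<lambda>x. \<Sum>k\<le>CARD('m). msym k (?M x) * e ^ k)"
      unfolding mat using pos by (simp add: less_imp_le flip: det_msym)
    also have "\<dots> = (\<Sum>k\<le>CARD('m). integral ?B (\<lambda>x. msym k (?M x) * e ^ k))"
    proof (rule integral_sum)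
      fix k
      have "continuous_on ?B (\<lambda>x. msym k (?M x) * e ^ k)"
        by (intro continuous_intros continuous_on_msym continuous_on_subset[OF C]) auto
      then show "(\<lambda>x. msym k (?M x) * e ^ k) integrable_on ?B"
        by (intro set_borel_integral_eq_integral(1) set_integrable_compact) auto
    qed simp
    finally show ?thesis by (simp add: img)
  qed
  \<comment> \<open>Coefficients of the difference of the two sides of \<open>vol\<close>; the
    volume belongs to the constant term. They vanish because the polynomial has all of (0, 1/L) as
    roots.\<close>
  define c where "c k = integral ?B (\<lambda>x. msym k (?M x)) - (if k = 0 then measure lebesgue ?B else 0)" for k
  have sub: "{0<..<1 / L} \<subseteq> {e. (\<Sum>k\<le>CARD('m). c k * e ^ k) = 0}"
  proof
    fix e assume "e \<in> {0<..<1 / L}"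
    then have e: "0 < e" "e * L < 1" using L by (auto simp: field_simps)
    have "(\<Sum>k\<le>CARD('m). c k * e ^ k) = (\<Sum>k\<le>CARD('m). integral ?B (\<lambda>x. msym k (?M x)) * e ^ k)
        - (\<Sum>k\<le>CARD('m). (if k = 0 then measure lebesgue ?B else 0) * e ^ k)"
      by (simp add: c_def left_diff_distrib sum_subtractf)
    also have "(\<Sum>k\<le>CARD('m). (if k = 0 then measure lebesgue ?B else 0) * e ^ k) =
        (\<Sum>k\<in>{0}. (if k = 0 then measure lebesgue ?B else 0) * e ^ k)"
      by (rule sum.mono_neutral_right) auto
    finally show "e \<in> {e. (\<Sum>k\<le>CARD('m). c k * e ^ k) = 0}" using vol[OF e] by simp
  qed
  have "infinite {e. (\<Sum>k\<le>CARD('m). c k * e ^ k) = 0}"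
    using infinite_super[OF sub] L by simp
  then have "c CARD('m) = 0" using polyfun_finite_roots[of c "CARD('m)"] by blast
  then show ?thesis by (simp add: c_def msym_top)
qed

lemma integrable_compact_support:
  fixes f :: "'a::euclidean_space \<Rightarrow> real"
  assumes "continuous_on UNIV f" "\<And>x. R < norm x \<Longrightarrow> f x = 0"
  shows "integrable lborel f" "integral\<^sup>L lborel f = integral (cball 0 R) f"
proof -
  have "set_integrable lborel (cball 0 R) f"
    using assms(1) by (intro set_integrable_compact continuous_on_subset[OF assms(1)]) auto
  moreover have "(\<lambda>x. indicator (cball 0 R) x *\<^sub>R f x) = f"
    using assms(2) by (auto simp: indicator_def fun_eq_iff)
  ultimately show "integrable lborel f" "integral\<^sup>L lborel f = integral (cball 0 R) f"
    using set_borel_integral_eq_integral(2)[of "cball 0 R" f]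
    by (simp_all add: set_integrable_def set_lebesgue_integral_def)
qed

lemma prod_Basis_cart: "(\<Prod>b\<in>Basis. v \<bullet> b) = (\<Prod>i\<in>UNIV. v $ i)" for v :: "real ^ 'n"
proof -
  have B: "(Basis :: (real ^ 'n) set) = range (\<lambda>i. axis i 1)" by (auto simp: Basis_vec_def)
  have "inj (\<lambda>i::'n. axis i (1::real))" by (auto simp: inj_on_def axis_eq_axis)
  then show ?thesis unfolding B by (subst prod.reindex) (simp_all add: inner_axis)
qed

lemma lborel_reindex:
  fixes f :: "'m::finite \<Rightarrow> 'n::finite"
  assumes "bij f"
  shows "distr lborel borel (\<lambda>x::real ^ 'n. \<chi> i. x $ f i) = (lborel :: (real ^ 'm) measure)"
proof (rule lborel_eqI[symmetric])
  let ?P = "\<lambda>x::real ^ 'n. \<chi> i. x $ f i"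
  have meas: "?P \<in> borel_measurable borel"
    by (intro borel_measurable_continuous_onI continuous_intros)
  fix l u :: "real ^ 'm" assume le: "\<And>b. b \<in> Basis \<Longrightarrow> l \<bullet> b \<le> u \<bullet> b"
  let ?Q = "\<lambda>y::real ^ 'm. \<chi> i. y $ inv f i"
  have f: "inv f (f i) = i" "f (inv f j) = j" for i j
    using assms by (simp_all add: bij_is_inj bij_is_surj surj_f_inv_f)
  have vi: "?P -` box l u = box (?Q l) (?Q u)"
    by (auto simp: mem_box_cart) (metis f)+
  have le': "l $ i \<le> u $ i" for i using le[of "axis i 1"] by (auto simp: inner_axis Basis_vec_def)
  have B: "(\<Prod>b\<in>Basis. (v - w) \<bullet> b) = (\<Prod>i\<in>UNIV. v $ i - w $ i)" for v w :: "real ^ 'm"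
    using prod_Basis_cart[of "v - w"] by simp
  have B': "(\<Prod>b\<in>Basis. (v - w) \<bullet> b) = (\<Prod>i\<in>UNIV. v $ i - w $ i)" for v w :: "real ^ 'n"
    using prod_Basis_cart[of "v - w"] by simp
  have "emeasure (distr lborel borel ?P) (box l u) = emeasure lborel (box (?Q l) (?Q u))"
    using meas by (subst emeasure_distr) (simp_all add: vi)
  also have "\<dots> = (\<Prod>b\<in>Basis. (?Q u - ?Q l) \<bullet> b)"
    by (rule emeasure_lborel_box) (use le' in \<open>auto simp: Basis_vec_def inner_axis\<close>)
  also have "(\<Prod>b\<in>Basis. (?Q u - ?Q l) \<bullet> b) = (\<Prod>i\<in>UNIV. u $ inv f i - l $ inv f i)"
    by (subst B') simp
  also have "\<dots> = (\<Prod>i\<in>UNIV. u $ i - l $ i)"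
    by (rule prod.reindex_bij_betw) (use assms in \<open>rule bij_imp_bij_inv\<close>)
  also have "\<dots> = (\<Prod>b\<in>Basis. (u - l) \<bullet> b)" by (rule B[symmetric])
  finally show "emeasure (distr lborel borel ?P) (box l u) = (\<Prod>b\<in>Basis. (u - l) \<bullet> b)" .
qed simp

lemma det_zero_matrix: "det (0 :: real ^ 'n ^ 'n) = 0"
  by (rule det_zero_row(1)[of undefined]) (simp add: row_def vec_eq_iff)

lemma matrix_zero_map: "matrix (\<lambda>_. 0) = (0 :: real ^ 'n ^ 'm)"
  by (simp add: matrix_def vec_eq_iff)

text \<open>Transport to the well-ordered copy of the index type: renaming coordinates preserves
  Lebesgue measure, norms and Jacobian determinants.\<close>

lemma null_lagrangian:
  fixes w :: "real ^ 'n \<Rightarrow> real ^ 'n"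
  assumes D: "\<And>x. (w has_derivative w' x) (at x)"
    and C: "continuous_on UNIV (\<lambda>x. matrix (w' x))"
    and supp: "\<And>x. R < norm x \<Longrightarrow> w x = 0"
  shows "(\<integral>x. det (matrix (w' x)) \<partial>lborel) = 0"
proof -
  obtain f :: "'n fin_idx \<Rightarrow> 'n" where f: "bij f" using bij_fin_idx by blast
  define P where "P = (\<lambda>x::real ^ 'n. \<chi> i. x $ f i)"
  define Q where "Q = (\<lambda>y::real ^ 'n fin_idx. \<chi> i. y $ inv f i)"
  have lin: "linear P" "linear Q" by (auto intro!: linearI simp: P_def Q_def vec_eq_iff)
  then have bl: "bounded_linear P" "bounded_linear Q" by (simp_all add: linear_conv_bounded_linear)
  have inv: "inv f (f i) = i" "f (inv f j) = j" for i j
    using f by (simp_all add: bij_is_inj bij_is_surj surj_f_inv_f)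
  have PQ: "P (Q y) = y" "Q (P x) = x" for x y by (simp_all add: P_def Q_def vec_eq_iff inv)
  have nQ: "norm (Q y) = norm y" for y
  proof -
    have "(\<Sum>i\<in>UNIV. (y $ inv f i)\<^sup>2) = (\<Sum>i\<in>UNIV. (y $ i)\<^sup>2)"
      using bij_imp_bij_inv[OF f] by (rule sum.reindex_bij_betw)
    then show ?thesis by (simp add: norm_vec_def L2_set_def Q_def)
  qed
  define v where "v = (\<lambda>y. P (w (Q y)))"
  define v' where "v' = (\<lambda>y h. P (w' (Q y) (Q h)))"
  have Dv: "(v has_derivative v' y) (at y)" for y
    unfolding v_def v'_def
    by (rule bounded_linear.has_derivative[OF bl(1)] has_derivative_compose[OF bounded_linear_imp_has_derivative[OF bl(2)] D])+
  have Qa: "Q (axis i 1) = axis (f i) 1" for i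
    using inv by (auto simp: Q_def axis_def vec_eq_iff)
  have mv: "matrix (v' y) = (\<chi> i j. matrix (w' (Q y)) $ f i $ f j)" for y
    by (simp add: vec_eq_iff matrix_def v'_def P_def Qa)
  have Cv: "continuous_on UNIV (\<lambda>y. matrix (v' y))"
    unfolding mv
  proof (intro continuous_on_vec_lambda continuous_on_component)
    show "continuous_on UNIV (\<lambda>y. matrix (w' (Q y)))"
      using continuous_on_compose2[OF C linear_continuous_on[OF bl(2)]] by simp
  qed
  have sv: "v y = 0" if "R < norm y" for y
    using supp[of "Q y"] that lin by (simp add: v_def nQ linear_0)
  have z: "integral (cball 0 R) (\<lambda>y. det (matrix (v' y))) = 0"
    by (rule null_lagrangian_wellorder[OF Dv Cv sv])
  have dv: "det (matrix (v' y)) = det (matrix (w' (Q y)))" for y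
    unfolding mv by (rule det_reindex[OF f])
  have zero: "det (matrix (v' y)) = 0" if "R < norm y" for y
    using derivative_outside_ball[OF sv Dv that] det_zero_matrix by (simp add: matrix_zero_map)
  have "(\<integral>x. det (matrix (w' x)) \<partial>lborel) = (\<integral>x. det (matrix (v' (P x))) \<partial>lborel)"
    by (simp add: dv PQ)
  also have "\<dots> = (\<integral>y. det (matrix (v' y)) \<partial>distr lborel borel P)"
  proof (rule integral_distr[symmetric])
    show "P \<in> lborel \<rightarrow>\<^sub>M borel"
      by (simp add: borel_measurable_continuous_onI linear_continuous_on bl)
    show "(\<lambda>y. det (matrix (v' y))) \<in> borel_measurable borel"
      by (intro borel_measurable_continuous_onI continuous_on_det Cv)
  qed
  also have "distr lborel borel P = lborel" unfolding P_def by (rule lborel_reindex[OF f])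
  also have "(\<integral>y. det (matrix (v' y)) \<partial>lborel) = 0"
    using integrable_compact_support(2)[of "\<lambda>y. det (matrix (v' y))" R] zero z
    by (simp add: continuous_on_det Cv)
  finally show ?thesis .
qed

text \<open>The derivative of \<open>det\<close> at \<open>B\<close> in direction \<open>C\<close>.\<close>

definition ddet :: "real ^ 'n ^ 'n \<Rightarrow> real ^ 'n ^ 'n \<Rightarrow> real"
  where "ddet B C = (\<Sum>i\<in>UNIV. det (\<chi> l. if l = i then C $ l else B $ l))"

text \<open>The coefficient of r^k in det (B + r C).\<close>

definition ddets :: "real ^ 'n ^ 'n \<Rightarrow> real ^ 'n ^ 'n \<Rightarrow> nat \<Rightarrow> real"
  where "ddets B C k = (\<Sum>R | card R = k. det (\<chi> l. if l \<in> R then C $ l else B $ l))"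

lemma ddets_1: "ddets B C 1 = ddet B (C :: real ^ 'n ^ 'n)"
proof -
  have "{R :: 'n set. card R = 1} = (\<lambda>i. {i}) ` UNIV" by (auto simp: card_1_singleton_iff)
  then show ?thesis by (simp add: ddets_def ddet_def sum.reindex del: One_nat_def)
qed

lemma det_add_ddets:
  fixes B C :: "real ^ 'n ^ 'n"
  shows "det (B + r *\<^sub>R C) = (\<Sum>k\<le>CARD('n). ddets B C k * r ^ k)"
proof -
  let ?g = "\<lambda>R. det (\<chi> l. if l \<in> R then C $ l else B $ l)"
  have "det (B + r *\<^sub>R C) = (\<Sum>R\<in>UNIV. r ^ card R * ?g R)" by (rule det_add_rows)
  also have "\<dots> = (\<Sum>k\<le>CARD('n). \<Sum>R | R \<in> UNIV \<and> card R = k. r ^ card R * ?g R)"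
    by (rule sum.group[symmetric]) (auto intro: card_mono)
  finally show ?thesis by (simp add: ddets_def sum_distrib_left sum_distrib_right mult.commute)
qed

lemma ddet_unique:
  fixes B C :: "real ^ 'n ^ 'n"
  assumes "\<And>r. det (B + r *\<^sub>R C) = (\<Sum>k\<le>CARD('n). x k * r ^ k)"
  shows "x 1 = ddet B C"
proof -
  have "\<forall>r. (\<Sum>k\<le>CARD('n). x k * r ^ k) = (\<Sum>k\<le>CARD('n). ddets B C k * r ^ k)"
    using assms by (simp add: det_add_ddets)
  then have e: "\<forall>k\<le>CARD('n). x k = ddets B C k"
    unfolding polyfun_eq_coeffs .
  have "1 \<le> CARD('n)" by (simp add: Suc_le_eq)
  then have "x 1 = ddets B C 1" using e by blast
  then show ?thesis by (simp only: ddets_1)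
qed

text \<open>Allows a frame matrix common to both Jacobians to be split off as the factor det
  E.\<close>

lemma ddet_mult_right:
  fixes B C E :: "real ^ 'n ^ 'n"
  shows "ddet (B ** E) (C ** E) = ddet B C * det E"
proof -
  have "det (B ** E + r *\<^sub>R (C ** E)) = (\<Sum>k\<le>CARD('n). (ddets B C k * det E) * r ^ k)" for r
  proof -
    have "B ** E + r *\<^sub>R (C ** E) = (B + r *\<^sub>R C) ** E"
      by (simp add: matrix_add_rdistrib scalar_matrix_assoc)
    then show ?thesis by (simp add: det_mul det_add_ddets sum_distrib_left sum_distrib_right mult_ac)
  qed
  then show ?thesis using ddet_unique[of "B ** E" "C ** E" "\<lambda>k. ddets B C k * det E"] by (simp add: ddets_1[symmetric])
qed

lemma dco_ddet:
  fixes W A K :: "real ^ 'n ^ 'n"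
  shows "(\<Sum>a\<le>CARD('n). \<Sum>b\<le>CARD('n). dco W A K a b 1 * s ^ a * t ^ b) = ddet (mat 1 + s *\<^sub>R W + t *\<^sub>R A) K"
proof (rule ddet_unique)
  fix r
  let ?N = "CARD('n)"
  have "(\<Sum>a\<le>?N. \<Sum>b\<le>?N. \<Sum>c\<le>?N. dco W A K a b c * s ^ a * t ^ b * r ^ c) =
    (\<Sum>c\<le>?N. \<Sum>a\<le>?N. \<Sum>b\<le>?N. dco W A K a b c * s ^ a * t ^ b * r ^ c)" (is "?L = _")
  proof -
    have "?L = (\<Sum>a\<le>?N. \<Sum>c\<le>?N. \<Sum>b\<le>?N. dco W A K a b c * s ^ a * t ^ b * r ^ c)"
      by (intro sum.cong refl sum.swap)
    then show ?thesis by (subst (asm) sum.swap)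
  qed
  then show "det (mat 1 + s *\<^sub>R W + t *\<^sub>R A + r *\<^sub>R K) =
      (\<Sum>c\<le>?N. (\<Sum>a\<le>?N. \<Sum>b\<le>?N. dco W A K a b c * s ^ a * t ^ b) * r ^ c)"
    by (simp add: det_expand sum_distrib_right)
qed

text \<open>First variation of the null Lagrangian: F + r w has compact support for every r, so
  every coefficient in r of its integrated Jacobian vanishes, in particular the linear one.\<close>

lemma null_lagrangian_ddet:
  fixes F w :: "real ^ 'n \<Rightarrow> real ^ 'n"
  assumes F: "\<And>x. (F has_derivative F' x) (at x)" "continuous_on UNIV (\<lambda>x. matrix (F' x))"
      "\<And>x. R < norm x \<Longrightarrow> F x = 0"
    and w: "\<And>x. (w has_derivative w' x) (at x)" "continuous_on UNIV (\<lambda>x. matrix (w' x))"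
      "\<And>x. R < norm x \<Longrightarrow> w x = 0"
  shows "(\<integral>x. ddet (matrix (F' x)) (matrix (w' x)) \<partial>lborel) = 0"
proof -
  let ?N = "CARD('n)"
  let ?g = "\<lambda>x k. ddets (matrix (F' x)) (matrix (w' x)) k"
  have int: "integrable lborel (\<lambda>x. ?g x k)" for k
  proof (rule integrable_compact_support(1))
    show "continuous_on UNIV (\<lambda>x. ?g x k)"
      unfolding ddets_def
    proof (intro continuous_on_sum continuous_on_det continuous_on_vec_lambda)
      fix R :: "'n set" and l
      show "continuous_on UNIV (\<lambda>x. if l \<in> R then matrix (w' x) $ l else matrix (F' x) $ l)"
        using F(2) w(2) by (cases "l \<in> R") (auto intro: continuous_on_component)
    qed
    fix x :: "real ^ 'n" assume x: "R < norm x"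
    have "matrix (w' x) = 0" "matrix (F' x) = 0"
      using derivative_outside_ball[OF w(3) w(1) x] derivative_outside_ball[OF F(3) F(1) x]
      by (simp_all add: matrix_zero_map)
    moreover have "(\<chi> l. if l \<in> R then (0 :: real ^ 'n ^ 'n) $ l else 0 $ l) = 0" for R
      by (simp add: vec_eq_iff)
    ultimately show "?g x k = 0" by (simp add: ddets_def det_zero_matrix)
  qed
  have "(\<Sum>k\<le>?N. (\<integral>x. ?g x k \<partial>lborel) * r ^ k) = (\<Sum>k\<le>?N. 0 * r ^ k)" for r
  proof -
    have "(\<integral>x. det (matrix (\<lambda>h. F' x h + r *\<^sub>R w' x h)) \<partial>lborel) = 0"
    proof (rule null_lagrangian[where w = "\<lambda>x. F x + r *\<^sub>R w x" and R = R])
      show "((\<lambda>x. F x + r *\<^sub>R w x) has_derivative (\<lambda>h. F' x h + r *\<^sub>R w' x h)) (at x)" for x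
        by (intro derivative_intros F w)
      have "matrix (\<lambda>h. F' x h + r *\<^sub>R w' x h) = matrix (F' x) + r *\<^sub>R matrix (w' x)" for x
        by (simp add: matrix_def vec_eq_iff)
      then show "continuous_on UNIV (\<lambda>x. matrix (\<lambda>h. F' x h + r *\<^sub>R w' x h))"
        using F(2) w(2) by (simp add: continuous_intros)
    qed (use F(3) w(3) in auto)
    moreover have "matrix (\<lambda>h. F' x h + r *\<^sub>R w' x h) = matrix (F' x) + r *\<^sub>R matrix (w' x)" for x
      by (simp add: matrix_def vec_eq_iff)
    ultimately have "(\<integral>x. (\<Sum>k\<le>?N. ?g x k * r ^ k) \<partial>lborel) = 0"
      by (simp only: det_add_ddets)
    then show ?thesis using int by simp
  qed
  then have e: "\<forall>k\<le>?N. (\<integral>x. ?g x k \<partial>lborel) = 0"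
    using polyfun_eq_coeffs[where n = ?N and c = "\<lambda>k. \<integral>x. ?g x k \<partial>lborel" and d = "\<lambda>_. 0"] by blast
  have "1 \<le> ?N" by (simp add: Suc_le_eq)
  then have "(\<integral>x. ?g x 1 \<partial>lborel) = 0" using e by blast
  then show ?thesis by (simp only: ddets_1)
qed

section \<open>Symmetric functions of eigenvalues on a hyperplane\<close>

lemma esym_eq_sum_subsets:
  fixes x :: "'i \<Rightarrow> real"
  assumes "finite I"
  shows "esym k I x = (\<Sum>S | S \<subseteq> I \<and> card S = k. \<Prod>i\<in>S. x i)"
proof (cases "k \<le> card I")
  case True
  let ?d = "\<lambda>k. \<Sum>S | S \<subseteq> I \<and> card S = k. \<Prod>i\<in>S. x i"
  have "(\<Sum>k\<le>card I. esym k I x * s ^ k) = (\<Sum>k\<le>card I. ?d k * s ^ k)" for s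
  proof -
    have "(\<Sum>k\<le>card I. esym k I x * s ^ k) = (\<Prod>i\<in>I. s * x i + 1)"
      using prod_eq_sum_esym[OF assms order.refl, of s x] by (simp add: add.commute)
    also have "\<dots> = (\<Sum>S\<in>Pow I. (\<Prod>i\<in>S. s * x i) * (\<Prod>i\<in>I - S. 1))"
      by (rule prod_add[OF assms])
    also have "\<dots> = (\<Sum>S\<in>Pow I. s ^ card S * (\<Prod>i\<in>S. x i))" by (simp add: prod.distrib)
    also have "\<dots> = (\<Sum>k\<le>card I. \<Sum>S | S \<in> Pow I \<and> card S = k. s ^ card S * (\<Prod>i\<in>S. x i))"
      by (rule sum.group[symmetric]) (use assms in \<open>auto intro: card_mono\<close>)
    also have "\<dots> = (\<Sum>k\<le>card I. ?d k * s ^ k)"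
      by (simp add: sum_distrib_left sum_distrib_right mult.commute)
    finally show ?thesis .
  qed
  then have "\<forall>k\<le>card I. esym k I x = ?d k"
    unfolding polyfun_eq_coeffs[symmetric] by blast
  with True show ?thesis by blast
next
  case False
  then have e: "{S. S \<subseteq> I \<and> card S = k} = {}" using card_mono[OF assms] by auto
  show ?thesis unfolding e using False by (simp add: esym_eq_0[OF assms])
qed

lemma elem_sym_eq_esym: "elem_sym k xs = esym k {..<length xs} ((!) xs)"
  by (simp add: elem_sym_def esym_eq_sum_subsets)

lemma orthonormal_expand:
  fixes S :: "'a::euclidean_space set"
  assumes "pairwise orthogonal S" "\<forall>b\<in>S. norm b = 1" "v \<in> span S"
  shows "(\<Sum>b\<in>S. (v \<bullet> b) *\<^sub>R b) = v"
proof -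
  have fin: "finite S"
    using pairwise_orthogonal_independent[OF assms(1)] assms(2) finiteI_independent by force
  define w where "w = v - (\<Sum>b\<in>S. (v \<bullet> b) *\<^sub>R b)"
  have "w \<in> span S" unfolding w_def
    by (intro span_diff assms span_sum span_scale span_base)
  moreover have "orthogonal w b" if b: "b \<in> S" for b
  proof -
    have "(\<Sum>c\<in>S. (v \<bullet> c) *\<^sub>R c) \<bullet> b = (\<Sum>c\<in>S. (v \<bullet> c) * (c \<bullet> b))" by (simp add: inner_sum_left)
    also have "\<dots> = (\<Sum>c\<in>{b}. (v \<bullet> c) * (c \<bullet> b))"
      using fin b assms(1) by (intro sum.mono_neutral_right) (auto simp: pairwise_def orthogonal_def)
    also have "\<dots> = v \<bullet> b" using assms(2) b by (simp add: dot_square_norm)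
    finally show ?thesis by (simp add: w_def orthogonal_def inner_diff_left)
  qed
  ultimately have "orthogonal w w" by (rule orthogonal_to_span)
  then show ?thesis by (simp add: w_def orthogonal_def)
qed

lemma frame_properties:
  assumes "subspace T"
  shows "frame T \<subseteq> T" "pairwise orthogonal (frame T)" "\<forall>e\<in>frame T. norm e = 1" "span (frame T) = T"
proof -
  obtain B where "B \<subseteq> T" "pairwise orthogonal B" "\<And>x. x \<in> B \<Longrightarrow> norm x = 1" "span B = T"
    using orthonormal_basis_subspace[OF assms] by metis
  then have "\<exists>E. E \<subseteq> T \<and> pairwise orthogonal E \<and> (\<forall>e\<in>E. norm e = 1) \<and> span E = T" by blast
  from someI_ex[OF this] show "frame T \<subseteq> T" "pairwise orthogonal (frame T)"
    "\<forall>e\<in>frame T. norm e = 1" "span (frame T) = T"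
    unfolding frame_def by blast+
qed

lemma frame_expand:
  assumes "subspace T" "v \<in> T"
  shows "(\<Sum>e\<in>frame T. (v \<bullet> e) *\<^sub>R e) = v"
  using orthonormal_expand[OF frame_properties(2,3)[OF assms(1)]] frame_properties(4)[OF assms(1)] assms(2)
  by blast

text \<open>By self-adjointness an eigenvector for r is orthogonal to the basis vectors with another
  eigenvalue, so the eigenspace is spanned by the basis vectors labelled r.\<close>

lemma eigenspace_dim:
  fixes L :: "'a::euclidean_space \<Rightarrow> 'a"
  assumes T: "span S = T" "S \<subseteq> T" and S: "pairwise orthogonal S" "\<forall>b\<in>S. norm b = 1"
    and sym: "\<And>x y. x \<in> T \<Longrightarrow> y \<in> T \<Longrightarrow> L x \<bullet> y = x \<bullet> L y"
    and lin: "linear L" and ev: "\<And>b. b \<in> S \<Longrightarrow> L b = c b *\<^sub>R b"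
  shows "dim {v \<in> T. L v = r *\<^sub>R v} = card {b \<in> S. c b = r}"
proof -
  let ?E = "{b \<in> S. c b = r}"
  have "{v \<in> T. L v = r *\<^sub>R v} = span ?E"
  proof
    show "{v \<in> T. L v = r *\<^sub>R v} \<subseteq> span ?E"
    proof clarify
      fix v assume v: "v \<in> T" "L v = r *\<^sub>R v"
      have "(v \<bullet> b) *\<^sub>R b \<in> span ?E" if b: "b \<in> S" for b
      proof (cases "c b = r")
        case False
        have "r * (v \<bullet> b) = c b * (v \<bullet> b)" using sym[OF v(1), of b] b T v(2) ev by auto
        with False show ?thesis by (simp add: span_zero)
      next
        case True
        with b show ?thesis by (intro span_scale span_base) simp
      qed
      then have "(\<Sum>b\<in>S. (v \<bullet> b) *\<^sub>R b) \<in> span ?E" by (rule span_sum)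
      then show "v \<in> span ?E" using orthonormal_expand[OF S] v T by simp
    qed
    have "subspace {v. L v = r *\<^sub>R v}"
      by (auto simp: subspace_def linear_0[OF lin] linear_add[OF lin] linear_cmul[OF lin] scaleR_add_right)
    then have "subspace (T \<inter> {v. L v = r *\<^sub>R v})" using T by (intro subspace_inter) (auto simp: subspace_span)
    then have "span ?E \<subseteq> T \<inter> {v. L v = r *\<^sub>R v}" using T ev by (intro span_minimal) auto
    then show "span ?E \<subseteq> {v \<in> T. L v = r *\<^sub>R v}" by auto
  qed
  moreover have "independent ?E"
    using S by (intro pairwise_orthogonal_independent pairwise_subset[OF S(1)]) auto
  ultimately show ?thesis by (simp add: dim_span dim_eq_card_independent)
qed

text \<open>A sorted list is determined by its multiset, so the definite description in
  \<open>eigenvalues\<close> has a unique solution.\<close>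

lemma eigenvalues_eqI:
  assumes "sorted xs" "\<And>c. count (mset xs) c = dim {v \<in> T. L v = c *\<^sub>R v}"
  shows "eigenvalues T L = xs"
  unfolding eigenvalues_def
proof (rule the_equality)
  fix ys assume ys: "sorted ys \<and> (\<forall>c. count (mset ys) c = dim {v \<in> T. L v = c *\<^sub>R v})"
  then have "mset ys = mset xs" using assms(2) by (intro multiset_eqI) simp
  then show "ys = xs" using ys assms(1) by (metis properties_for_sort)
qed (use assms in auto)

lemma matrix_self_adjoint:
  fixes M :: "real ^ 'n ^ 'n"
  assumes "transpose M = M"
  shows "(M *v x) \<bullet> y = x \<bullet> (M *v y)"
  using assms by (metis dot_lmul_matrix transpose_matrix_vector inner_commute)

text \<open>Completing an orthonormal eigenbasis of T by \<nu> adds the eigenvalue 0, whose factor 1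
  + s 0 does not change the generating polynomial. Hence the ambient matrix carries the symmetric
  functions of the tangential eigenvalues.\<close>

lemma elem_sym_eigenvalues:
  fixes B :: "real ^ 'm ^ 'm"
  assumes \<nu>: "norm \<nu> = 1" and T: "T = {X. \<nu> \<bullet> X = 0}"
    and B: "transpose B = B" "B *v \<nu> = 0" and L: "\<And>X. X \<in> T \<Longrightarrow> L X = B *v X"
    and k: "k \<le> CARD('m)"
  shows "elem_sym k (eigenvalues T L) = msym k B"
proof -
  have sT: "subspace T" unfolding T by (auto simp: subspace_def inner_add_right)
  have sym: "(B *v x) \<bullet> y = x \<bullet> (B *v y)" for x y by (rule matrix_self_adjoint[OF B(1)])
  have BT: "B *v x \<in> T" for x using sym[of x \<nu>] B(2) by (simp add: T inner_commute)
  obtain S where S: "S \<subseteq> T" "pairwise orthogonal S" "\<forall>b\<in>S. norm b = 1" "span S = T"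
      "\<forall>b\<in>S. \<exists>c. B *v b = c *\<^sub>R b"
    using spectral_subspace[OF sT, of "(*v) B"] BT sym by auto
  obtain c where c: "\<And>b. b \<in> S \<Longrightarrow> B *v b = c b *\<^sub>R b" using S(5) by metis
  have fin: "finite S"
    using pairwise_orthogonal_independent[OF S(2)] S(3) finiteI_independent by force
  define xs where "xs = sorted_list_of_multiset (image_mset c (mset_set S))"
  have mxs: "mset xs = image_mset c (mset_set S)" by (simp add: xs_def)
  have ev: "eigenvalues T L = xs"
  proof (rule eigenvalues_eqI)
    show "sorted xs" by (simp add: xs_def)
    fix r
    have "{v \<in> T. L v = r *\<^sub>R v} = {v \<in> T. B *v v = r *\<^sub>R v}" using L by auto
    then have "dim {v \<in> T. L v = r *\<^sub>R v} = card {b \<in> S. c b = r}"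
      using eigenspace_dim[OF S(4,1,2,3), of "(*v) B" c r] sym c by simp
    moreover have "count (mset xs) r = card {b \<in> S. c b = r}"
    proof -
      have "count (mset xs) r = (\<Sum>y\<in>c -` {r} \<inter> S. count (mset_set S) y)"
        using fin by (simp add: mxs count_image_mset)
      also have "\<dots> = (\<Sum>y\<in>c -` {r} \<inter> S. 1)" using fin by (intro sum.cong) auto
      also have "c -` {r} \<inter> S = {b \<in> S. c b = r}" by auto
      finally show ?thesis by simp
    qed
    ultimately show "count (mset xs) r = dim {v \<in> T. L v = r *\<^sub>R v}" by simp
  qed
  have px: "(\<Prod>i<length xs. 1 + s * xs ! i) = (\<Prod>b\<in>S. 1 + s * c b)" for s
  proof -
    have "(\<Prod>i<length xs. 1 + s * xs ! i) = prod_list (map (\<lambda>x. 1 + s * x) xs)"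
      by (simp add: prod.list_conv_set_nth atLeast0LessThan)
    also have "\<dots> = prod_mset (image_mset (\<lambda>x. 1 + s * x) (mset xs))" by (simp flip: prod_mset_prod_list)
    also have "\<dots> = (\<Prod>b\<in>S. 1 + s * c b)" by (simp add: mxs multiset.map_comp o_def prod_unfold_prod_mset)
    finally show ?thesis .
  qed
  have nS: "\<nu> \<notin> S" using S(1) \<nu> by (auto simp: T norm_eq_1)
  have "pairwise orthogonal (insert \<nu> S)"
    using S(1,2) by (auto simp: pairwise_insert orthogonal_def T inner_commute)
  moreover have "\<forall>b\<in>insert \<nu> S. norm b = 1" using S(3) \<nu> by simp
  moreover have "span (insert \<nu> S) = UNIV"
  proof -
    have "x - (\<nu> \<bullet> x) *\<^sub>R \<nu> \<in> span S" for x
      unfolding S(4) T using \<nu> by (simp add: inner_diff_right norm_eq_1)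
    then have "x \<in> span (insert \<nu> S)" for x using span_breakdown_eq by blast
    then show ?thesis by blast
  qed
  ultimately obtain q :: "'m \<Rightarrow> real ^ 'm" where q: "bij_betw q UNIV (insert \<nu> S)" "orthogonal_matrix (\<chi> i. q i)"
    by (rule orthonormal_basis_indexing)
  define d where "d = (\<lambda>b. if b = \<nu> then 0 else c b)"
  have "B *v q i = d (q i) *\<^sub>R q i" for i
  proof -
    have "q i \<in> insert \<nu> S" using q(1) by (auto simp: bij_betw_def)
    then show ?thesis using c B(2) by (auto simp: d_def)
  qed
  then have cj: "(\<chi> i. q i) ** B ** transpose (\<chi> i. q i) = diag_matrix (\<lambda>i. d (q i))"
    by (rule conj_eigenbasis[OF q(2)])
  have mB: "msym j B = esym j UNIV (\<lambda>i. d (q i))" for j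
    using msym_conj[OF q(2), of j B] unfolding cj msym_diag by simp
  have "card (insert \<nu> S) = CARD('m)" using bij_betw_same_card[OF q(1)] by simp
  then have len: "length xs \<le> CARD('m)"
    using fin nS mxs size_mset[of xs] by simp
  have "(\<Sum>j\<le>CARD('m). elem_sym j xs * s ^ j) = (\<Sum>j\<le>CARD('m). msym j B * s ^ j)" for s
  proof -
    have "(\<Sum>j\<le>CARD('m). elem_sym j xs * s ^ j) = (\<Prod>i<length xs. 1 + s * xs ! i)"
      unfolding elem_sym_eq_esym by (rule prod_eq_sum_esym[symmetric]) (use len in auto)
    also have "\<dots> = (\<Prod>b\<in>insert \<nu> S. 1 + s * d b)"
      unfolding px using fin nS by (auto simp: d_def intro!: prod.cong)
    also have "\<dots> = (\<Prod>i\<in>UNIV. 1 + s * d (q i))" by (rule prod.reindex_bij_betw[OF q(1), symmetric])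
    also have "\<dots> = (\<Sum>j\<le>CARD('m). msym j B * s ^ j)" unfolding mB by (rule prod_eq_sum_esym) auto
    finally show ?thesis .
  qed
  then have "\<forall>j\<le>CARD('m). elem_sym j xs = msym j B" unfolding polyfun_eq_coeffs[symmetric] by blast
  with k show ?thesis by (simp add: ev)
qed

section \<open>Rank one matrices and the derivative of \<open>\<sigma>\<^sub>k\<close> in a
  frame\<close>

definition outer :: "real ^ 'n \<Rightarrow> real ^ 'm \<Rightarrow> real ^ 'm ^ 'n"
  where "outer u v = (\<chi> i j. u $ i * v $ j)"

lemma outer_mult_vec: "outer u v *v x = (v \<bullet> x) *\<^sub>R u"
  by (simp add: vec_eq_iff outer_def matrix_vector_mult_def inner_vec_def sum_distrib_left sum_distrib_right mult_ac)

lemma transpose_outer: "transpose (outer u v) = outer v u"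
  by (simp add: vec_eq_iff outer_def transpose_def mult.commute)

lemma matrix_mult_outer: "M ** outer u v = outer (M *v u) v"
  by (simp add: vec_eq_iff outer_def matrix_matrix_mult_def matrix_vector_mult_def sum_distrib_left sum_distrib_right mult_ac)

lemma outer_mult_matrix: "outer u v ** M = outer u (transpose M *v v)"
  by (simp add: vec_eq_iff outer_def matrix_matrix_mult_def matrix_vector_mult_def transpose_def
      sum_distrib_left mult_ac del: transpose_matrix_vector)

lemma outer_scaleR: "outer (r *\<^sub>R u) v = r *\<^sub>R outer u v" "outer u (r *\<^sub>R v) = r *\<^sub>R outer u v"
  by (simp_all add: vec_eq_iff outer_def)

lemma outer_zero: "outer 0 v = 0" "outer u 0 = 0"
  by (simp_all add: vec_eq_iff outer_def)

text \<open>Transposition invariance with W symmetric. It turns the symmetrized variation in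
  \<open>sigma_dot\<close> into a single rank one matrix.\<close>

lemma dco_outer_commute:
  assumes "transpose W = W"
  shows "dco W 0 (outer u v) a 0 1 = dco W 0 (outer v u) a 0 1"
proof -
  have "transpose (0 :: real ^ 'a ^ 'a) = 0" by (simp add: vec_eq_iff transpose_def)
  then show ?thesis
    using dco_transpose[of W 0 "outer u v" a 0 1] assms by (simp add: transpose_outer)
qed

lemma sum_matrix_vector_mult: "(\<Sum>i\<in>I. M i) *v x = (\<Sum>i\<in>I. M i *v (x :: real ^ 'n))"
  by (induction I rule: infinite_finite_induct) (simp_all add: matrix_vector_mult_add_rdistrib)

text \<open>The form b on the hyperplane T together with its extension W to the ambient space by
  zero on \<nu>. As a locale of its own it can be instantiated at W + t K for every t, which
  computes the derivative in \<open>sigma_dot\<close>.\<close>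

locale tangent_data =
  fixes T :: "(real ^ 'm) set" and \<nu> :: "real ^ 'm" and W :: "real ^ 'm ^ 'm"
    and b :: "real ^ 'm \<Rightarrow> real ^ 'm \<Rightarrow> real"
  assumes \<nu>: "norm \<nu> = 1" and T: "T = {X. \<nu> \<bullet> X = 0}"
    and W: "transpose W = W" "W *v \<nu> = 0"
    and b: "\<And>X Y. X \<in> T \<Longrightarrow> Y \<in> T \<Longrightarrow> b X Y = (W *v X) \<bullet> Y"
begin

lemma sT: "subspace T" unfolding T by (auto simp: subspace_def inner_add_right)

lemma W_in_T: "W *v x \<in> T"
  using matrix_self_adjoint[OF W(1), of x \<nu>] W(2) by (simp add: T inner_commute)

lemma raise_index_eq:
  assumes "X \<in> T"
  shows "raise_index T b X = W *v X"
proof -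
  have "raise_index T b X = (\<Sum>e\<in>frame T. ((W *v X) \<bullet> e) *\<^sub>R e)"
    unfolding raise_index_def using b assms frame_properties(1)[OF sT] by (intro sum.cong) auto
  also have "\<dots> = W *v X" by (rule frame_expand[OF sT W_in_T])
  finally show ?thesis .
qed

lemma sigma_form_eq: "k \<le> CARD('m) \<Longrightarrow> sigma_form k T b = msym k W"
  unfolding sigma_form_def by (rule elem_sym_eigenvalues[OF \<nu> T W raise_index_eq])

lemma sigma_dot_eq:
  assumes k: "0 < k" "k \<le> CARD('m)" and uv: "u \<in> T" "v \<in> T"
  shows "sigma_dot k T b u v = dco W 0 (outer u v) (k - 1) 0 1"
proof -
  define K where "K = (1 / 2) *\<^sub>R (outer u v + outer v u)"
  have "sigma_form k T (\<lambda>X Y. b X Y + t * (((u \<bullet> X) * (v \<bullet> Y) + (v \<bullet> X) * (u \<bullet> Y)) / 2)) = msym k (W + t *\<^sub>R K)" for t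
  proof -
    interpret t: tangent_data T \<nu> "W + t *\<^sub>R K"
      "\<lambda>X Y. b X Y + t * (((u \<bullet> X) * (v \<bullet> Y) + (v \<bullet> X) * (u \<bullet> Y)) / 2)"
    proof
      have "transpose K = K" by (simp add: K_def vec_eq_iff outer_def transpose_def mult.commute)
      moreover have "transpose (W + t *\<^sub>R K) = transpose W + t *\<^sub>R transpose K"
        by (simp add: vec_eq_iff transpose_def)
      ultimately show "transpose (W + t *\<^sub>R K) = W + t *\<^sub>R K" using W(1) by simp
      have Kx: "K *v x = (1 / 2) *\<^sub>R ((v \<bullet> x) *\<^sub>R u + (u \<bullet> x) *\<^sub>R v)" for x
        by (simp add: K_def outer_mult_vec matrix_vector_mult_add_rdistrib flip: scaleR_matrix_vector_assoc)
      have "K *v \<nu> = 0" unfolding Kx using uv by (simp add: T inner_commute)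
      then show "(W + t *\<^sub>R K) *v \<nu> = 0"
        using W(2) by (simp add: matrix_vector_mult_add_rdistrib flip: scaleR_matrix_vector_assoc)
      fix X Y assume XY: "X \<in> T" "Y \<in> T"
      show "b X Y + t * (((u \<bullet> X) * (v \<bullet> Y) + (v \<bullet> X) * (u \<bullet> Y)) / 2) = ((W + t *\<^sub>R K) *v X) \<bullet> Y"
        using b[OF XY] by (simp add: matrix_vector_mult_add_rdistrib Kx inner_add_left algebra_simps
            flip: scaleR_matrix_vector_assoc)
    qed (use \<nu> T in auto)
    show ?thesis using t.sigma_form_eq k by blast
  qed
  then have "sigma_dot k T b u v = deriv (\<lambda>t. msym k (W + t *\<^sub>R K)) 0" by (simp add: sigma_dot_def)
  also have "\<dots> = dco W 0 K (k - 1) 0 1" by (rule DERIV_imp_deriv[OF DERIV_msym_line[OF k(1)]])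
  also have "\<dots> = dco W 0 (outer u v) (k - 1) 0 1"
    unfolding K_def dco_scaleR dco_add dco_outer_commute[OF W(1), of v u] by simp
  finally show ?thesis .
qed

lemma sum_sigma_dot:
  assumes k: "0 < k" "k \<le> CARD('m)"
  shows "(\<Sum>e\<in>frame T. \<Sum>e'\<in>frame T. sigma_dot k T b e e' * a e e') =
    dco W 0 (\<Sum>e\<in>frame T. \<Sum>e'\<in>frame T. a e e' *\<^sub>R outer e e') (k - 1) 0 1"
proof -
  have "dco W 0 (\<Sum>e\<in>frame T. \<Sum>e'\<in>frame T. a e e' *\<^sub>R outer e e') (k - 1) 0 1 =
     (\<Sum>e\<in>frame T. \<Sum>e'\<in>frame T. a e e' * dco W 0 (outer e e') (k - 1) 0 1)"
    by (simp only: linear_sum[OF linear_dco] dco_scaleR)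
  also have "\<dots> = (\<Sum>e\<in>frame T. \<Sum>e'\<in>frame T. sigma_dot k T b e e' * a e e')"
  proof (intro sum.cong refl)
    fix e e' assume "e \<in> frame T" "e' \<in> frame T"
    then have "e \<in> T" "e' \<in> T" using frame_properties(1)[OF sT] by auto
    then show "a e e' * dco W 0 (outer e e') (k - 1) 0 1 = sigma_dot k T b e e' * a e e'"
      using sigma_dot_eq[OF k] by (simp only: mult.commute)
  qed
  finally show ?thesis ..
qed

lemma matrix_frame_expand:
  assumes A: "transpose A = A" "A *v \<nu> = 0"
  shows "(\<Sum>e\<in>frame T. \<Sum>e'\<in>frame T. ((A *v e) \<bullet> e') *\<^sub>R outer e e') = A"
proof -
  let ?S = "\<Sum>e\<in>frame T. \<Sum>e'\<in>frame T. ((A *v e) \<bullet> e') *\<^sub>R outer e e'"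
  have sA: "(A *v x) \<bullet> y = x \<bullet> (A *v y)" for x y by (rule matrix_self_adjoint[OF A(1)])
  have AT: "A *v x \<in> T" for x using sA[of x \<nu>] A(2) by (simp add: T inner_commute)
  have "?S *v x = A *v x" for x
  proof -
    have "?S *v x = (\<Sum>e\<in>frame T. (\<Sum>e'\<in>frame T. ((A *v e) \<bullet> e') * (e' \<bullet> x)) *\<^sub>R e)"
      by (simp add: sum_matrix_vector_mult outer_mult_vec scaleR_sum_left flip: scaleR_matrix_vector_assoc)
    also have "\<dots> = (\<Sum>e\<in>frame T. ((A *v x) \<bullet> e) *\<^sub>R e)"
    proof (rule sum.cong[OF refl])
      fix e assume "e \<in> frame T"
      have "(\<Sum>e'\<in>frame T. ((A *v e) \<bullet> e') * (e' \<bullet> x)) = (\<Sum>e'\<in>frame T. ((A *v e) \<bullet> e') *\<^sub>R e') \<bullet> x"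
        by (simp add: inner_sum_left)
      also have "\<dots> = (A *v x) \<bullet> e"
        unfolding frame_expand[OF sT AT] using sA[of e x] by (simp add: inner_commute)
      finally show "(\<Sum>e'\<in>frame T. ((A *v e) \<bullet> e') * (e' \<bullet> x)) *\<^sub>R e = ((A *v x) \<bullet> e) *\<^sub>R e" by simp
    qed
    also have "\<dots> = A *v x" by (rule frame_expand[OF sT AT])
    finally show ?thesis .
  qed
  then show ?thesis by (simp add: matrix_eq)
qed

end

text \<open>The rank one matrix N squares to zero, so p(r) = det (1 + r N) satisfies p(r) p(-r) = 1.
  A polynomial that is a unit is constant, and p(0) = 1.\<close>

lemma det_one_plus_outer:
  fixes x y :: "real ^ 'n"
  assumes "x \<bullet> y = 0"
  shows "det (mat 1 + outer x y) = 1"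
proof -
  let ?N = "outer x y"
  have NN: "?N ** ?N = 0" using assms by (simp add: matrix_mult_outer outer_mult_vec outer_zero inner_commute)
  define p where "p = (\<Sum>k\<le>CARD('n). monom (msym k ?N) k)"
  have p: "poly p r = det (mat 1 + r *\<^sub>R ?N)" for r
    by (simp add: p_def poly_sum poly_monom det_msym)
  have "poly (p * pcompose p [:0, -1:]) r = 1" for r
  proof -
    have "(mat 1 + r *\<^sub>R ?N) ** (mat 1 + q *\<^sub>R ?N) = mat 1 + (r + q) *\<^sub>R ?N" for q
      by (simp add: matrix_add_ldistrib matrix_add_rdistrib NN matrix_scalar_ac scaleR_add_left
          flip: scalar_matrix_assoc)
    from this[of "- r"] have "(mat 1 + r *\<^sub>R ?N) ** (mat 1 + (- r) *\<^sub>R ?N) = mat 1" by simp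
    then have "det (mat 1 + r *\<^sub>R ?N) * det (mat 1 + (- r) *\<^sub>R ?N) = 1" by (metis det_I det_mul)
    then show ?thesis by (simp add: poly_pcompose p)
  qed
  then have "p * pcompose p [:0, -1:] = 1" by (simp add: fun_eq_iff flip: poly_eq_poly_eq_iff)
  then have "p dvd 1" by (metis dvd_triv_left)
  then obtain c where "p = [:c:]" by (auto simp: is_unit_poly_iff)
  moreover have "poly p 0 = 1" by (simp add: p)
  ultimately have "poly p 1 = 1" by simp
  then show ?thesis by (simp add: p)
qed

text \<open>A Schur complement. With respect to the splitting into the complement of \<nu> and the
  line of \<nu>, B is block diagonal with entry 1 at \<nu>; eliminating the bordering row - t u and
  column r V adds t r V \<otimes> u to the first block. The elimination is carried out by two shears
  of determinant 1.\<close>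

lemma det_border:
  fixes B :: "real ^ 'n ^ 'n"
  assumes \<nu>: "norm \<nu> = 1" and B: "B *v \<nu> = \<nu>" "transpose B *v \<nu> = \<nu>" and u: "u \<bullet> \<nu> = 0" and V: "V \<bullet> \<nu> = 0"
  shows "det (B - t *\<^sub>R outer \<nu> u + r *\<^sub>R outer V \<nu>) = det (B + (t * r) *\<^sub>R outer V u)"
proof -
  let ?X = "B - t *\<^sub>R outer \<nu> u + r *\<^sub>R outer V \<nu>" and ?Y = "B + (t * r) *\<^sub>R outer V u"
  have nn: "\<nu> \<bullet> \<nu> = 1" using \<nu> by (simp add: norm_eq_1)
  have uv: "u \<bullet> \<nu> = 0" "\<nu> \<bullet> u = 0" "V \<bullet> \<nu> = 0" "\<nu> \<bullet> V = 0" using u V by (simp_all add: inner_commute)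
  have "?X ** (mat 1 + outer \<nu> (t *\<^sub>R u)) = (mat 1 + outer (r *\<^sub>R V) \<nu>) ** ?Y"
  proof -
    have "?X ** (mat 1 + outer \<nu> (t *\<^sub>R u)) = ?X + outer (?X *v \<nu>) (t *\<^sub>R u)"
      by (simp add: matrix_add_ldistrib matrix_mult_outer)
    also have "?X *v \<nu> = \<nu> + r *\<^sub>R V"
      using B(1) by (simp add: matrix_vector_mult_add_rdistrib matrix_vector_mult_diff_rdistrib outer_mult_vec uv nn
          flip: scaleR_matrix_vector_assoc)
    also have "?X + outer (\<nu> + r *\<^sub>R V) (t *\<^sub>R u) = B + r *\<^sub>R outer V \<nu> + (t * r) *\<^sub>R outer V u"
      by (simp add: vec_eq_iff outer_def algebra_simps)
    finally have l: "?X ** (mat 1 + outer \<nu> (t *\<^sub>R u)) = B + r *\<^sub>R outer V \<nu> + (t * r) *\<^sub>R outer V u" .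
    have "(mat 1 + outer (r *\<^sub>R V) \<nu>) ** ?Y = ?Y + outer (r *\<^sub>R V) (transpose ?Y *v \<nu>)"
      by (simp add: matrix_add_rdistrib outer_mult_matrix del: transpose_matrix_vector)
    also have "transpose ?Y = transpose B + (t * r) *\<^sub>R outer u V"
      by (simp add: vec_eq_iff outer_def transpose_def)
    also have "\<dots> *v \<nu> = \<nu>"
      using B(2) by (simp add: matrix_vector_mult_add_rdistrib outer_mult_vec uv
          del: transpose_matrix_vector flip: scaleR_matrix_vector_assoc)
    finally show ?thesis unfolding l by (simp add: outer_scaleR)
  qed
  then have "det ?X * det (mat 1 + outer \<nu> (t *\<^sub>R u)) = det (mat 1 + outer (r *\<^sub>R V) \<nu>) * det ?Y"
    by (metis det_mul)
  moreover have "det (mat 1 + outer \<nu> (t *\<^sub>R u)) = 1" "det (mat 1 + outer (r *\<^sub>R V) \<nu>) = 1"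
    by (rule det_one_plus_outer; simp add: uv)+
  ultimately show ?thesis by simp
qed

text \<open>Meant for A the Hessian and u = W\<nabla>f, when \<open>A - outer \<nu> u\<close> is the
  full derivative of the gradient along M. In \<open>det_border\<close> the variable r occurs only
  in the product t r, so the coefficient linear in r loses one power of t; without V the border has
  no effect.\<close>

lemma dco_border:
  fixes W A :: "real ^ 'n ^ 'n"
  assumes \<nu>: "norm \<nu> = 1" and W: "W *v \<nu> = 0" "transpose W *v \<nu> = 0" and A: "A *v \<nu> = 0" "transpose A *v \<nu> = 0"
    and u: "u \<bullet> \<nu> = 0" and V: "V \<bullet> \<nu> = 0"
  shows "dco W (A - outer \<nu> u) (outer V \<nu>) a (Suc b) 1 = dco W A (outer V u) a b 1"
    and "dco W (A - outer \<nu> u) 0 a b 0 = dco W A 0 a b 0"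
proof -
  let ?N = "CARD('n)"
  let ?d = "dco W (A - outer \<nu> u) (outer V \<nu>)" and ?e = "dco W A (outer V u)"
  have key: "(\<Sum>a\<le>?N. \<Sum>b\<le>?N. \<Sum>c\<le>?N. ?d a b c * s ^ a * t ^ b * r ^ c) =
      (\<Sum>a\<le>?N. \<Sum>b\<le>?N. \<Sum>c\<le>?N. ?e a b c * s ^ a * t ^ b * (t * r) ^ c)" for s t r
  proof -
    let ?B = "mat 1 + s *\<^sub>R W + t *\<^sub>R A"
    have "?B *v \<nu> = \<nu>" using W A
      by (simp add: matrix_vector_mult_add_rdistrib flip: scaleR_matrix_vector_assoc)
    moreover have "transpose ?B *v \<nu> = \<nu>"
    proof -
      have "transpose ?B = mat 1 + s *\<^sub>R transpose W + t *\<^sub>R transpose A"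
        by (simp add: vec_eq_iff transpose_def mat_def)
      then show ?thesis using W A
        by (simp add: matrix_vector_mult_add_rdistrib del: transpose_matrix_vector flip: scaleR_matrix_vector_assoc)
    qed
    ultimately have "det (?B - t *\<^sub>R outer \<nu> u + r *\<^sub>R outer V \<nu>) = det (?B + (t * r) *\<^sub>R outer V u)"
      using det_border[OF \<nu>, of ?B u V t r] u V by simp
    moreover have "?B - t *\<^sub>R outer \<nu> u = mat 1 + s *\<^sub>R W + t *\<^sub>R (A - outer \<nu> u)"
      by (simp add: scaleR_diff_right)
    ultimately show ?thesis by (simp add: det_expand[symmetric])
  qed
  show 2: "dco W (A - outer \<nu> u) 0 a b 0 = dco W A 0 a b 0" for a b
  proof (cases "a \<le> ?N \<and> b \<le> ?N")
    case True
    have z: "(\<Sum>c\<le>?N. f c * (0::real) ^ c) = f 0" for f by (rule sum_power_0)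
    have "(\<Sum>a\<le>?N. \<Sum>b\<le>?N. ?d a b 0 * s ^ a * t ^ b) = (\<Sum>a\<le>?N. \<Sum>b\<le>?N. ?e a b 0 * s ^ a * t ^ b)" for s t
      using key[of s t 0] by (simp only: z mult_zero_right)
    then have "?d a b 0 = ?e a b 0" using poly2_unique[of "\<lambda>a b. ?d a b 0" ?N ?N "\<lambda>a b. ?e a b 0" a b] True by blast
    then show ?thesis
      using dco_independent[of W "A - outer \<nu> u" 0 a b "outer V \<nu>"] dco_independent[of W A 0 a b "outer V u"] by simp
  next
    case False
    then show ?thesis by (auto simp: dco_eq_0 not_le)
  qed
  show "?d a (Suc b) 1 = ?e a b 1"
  proof -
    \<comment> \<open>The derivative at r = 0 of either side of \<open>key\<close>: q = 1 for the
      left side, q = t for the right side, where the additional factor t shifts the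
      exponent.\<close>
    have lin: "((\<lambda>r. \<Sum>a\<le>?N. \<Sum>b\<le>?N. \<Sum>c\<le>?N. g a b c * s ^ a * t ^ b * (q * r) ^ c) has_real_derivative
        (\<Sum>a\<le>?N. \<Sum>b\<le>?N. g a b 1 * s ^ a * t ^ b * q)) (at 0)" for g and s t q :: real
    proof -
      have "((\<lambda>r. \<Sum>a\<le>?N. \<Sum>b\<le>?N. \<Sum>c\<le>?N. g a b c * s ^ a * t ^ b * (q * r) ^ c) has_real_derivative
        (\<Sum>a\<le>?N. \<Sum>b\<le>?N. \<Sum>c\<le>?N. g a b c * s ^ a * t ^ b * (of_nat c * (q * 0) ^ (c - 1) * q))) (at 0)"
        by (auto intro!: derivative_eq_intros simp: mult_ac)
      moreover have "(\<Sum>c\<le>?N. g a b c * s ^ a * t ^ b * (of_nat c * (q * 0) ^ (c - 1) * q)) = g a b 1 * s ^ a * t ^ b * q" for a b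
      proof -
        have "(\<Sum>c\<le>?N. g a b c * s ^ a * t ^ b * (of_nat c * (q * 0) ^ (c - 1) * q)) =
          (\<Sum>c\<in>{1}. g a b c * s ^ a * t ^ b * (of_nat c * (q * 0) ^ (c - 1) * q))"
          by (rule sum.mono_neutral_right) (auto simp: Suc_le_eq)
        then show ?thesis by simp
      qed
      ultimately show ?thesis by (simp only:)
    qed
    have eq: "(\<Sum>a\<le>?N. \<Sum>b\<le>?N. ?d a b 1 * s ^ a * t ^ b) = (\<Sum>a\<le>?N. \<Sum>b\<le>?N. ?e a b 1 * s ^ a * t ^ Suc b)" for s t
    proof -
      have "(\<Sum>a\<le>?N. \<Sum>b\<le>?N. ?d a b 1 * s ^ a * t ^ b * 1) = (\<Sum>a\<le>?N. \<Sum>b\<le>?N. ?e a b 1 * s ^ a * t ^ b * t)"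
        by (rule DERIV_unique[OF lin[of ?d s t 1]]) (use lin[of ?e s t t] in \<open>simp add: key mult_1\<close>)
      then show ?thesis by (simp add: mult_ac)
    qed
    have "(\<Sum>a\<le>?N. \<Sum>b\<le>Suc ?N. ?d a b 1 * s ^ a * t ^ b) =
      (\<Sum>a\<le>?N. \<Sum>b\<le>Suc ?N. (case b of 0 \<Rightarrow> 0 | Suc b' \<Rightarrow> ?e a b' 1) * s ^ a * t ^ b)" for s t
    proof -
      have "(\<Sum>b\<le>Suc ?N. (case b of 0 \<Rightarrow> 0 | Suc b' \<Rightarrow> ?e a b' 1) * s ^ a * t ^ b) = (\<Sum>b\<le>?N. ?e a b 1 * s ^ a * t ^ Suc b)" for a
        by (subst sum.atMost_Suc_shift) simp
      moreover have "(\<Sum>b\<le>Suc ?N. ?d a b 1 * s ^ a * t ^ b) = (\<Sum>b\<le>?N. ?d a b 1 * s ^ a * t ^ b)" for a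
        by (simp add: dco_eq_0)
      ultimately show ?thesis using eq by (simp only:)
    qed
    from poly2_unique[OF this, of a "Suc b"] show ?thesis
      by (cases "a \<le> ?N \<and> b \<le> ?N") (auto simp: dco_eq_0 not_le)
  qed
qed

section \<open>Differential calculus in charts\<close>

text \<open>Continuity is required of each directional derivative separately, in accordance with
  \<open>Ck_on\<close>; the derivative map is existentially bound so that explicit formulas can
  serve as witnesses.\<close>

definition C1_on :: "'a::real_normed_vector set \<Rightarrow> ('a \<Rightarrow> 'b::real_normed_vector) \<Rightarrow> bool"
  where "C1_on U g \<longleftrightarrow> (\<exists>g'. (\<forall>x\<in>U. (g has_derivative g' x) (at x)) \<and> (\<forall>v. continuous_on U (\<lambda>x. g' x v)))"

lemma C1_onI:
  assumes "\<And>x. x \<in> U \<Longrightarrow> (g has_derivative g' x) (at x)" "\<And>v. continuous_on U (\<lambda>x. g' x v)"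
  shows "C1_on U g"
  using assms unfolding C1_on_def by blast

lemma C1_onE:
  assumes "C1_on U g"
  obtains g' where "\<And>x. x \<in> U \<Longrightarrow> (g has_derivative g' x) (at x)" "\<And>v. continuous_on U (\<lambda>x. g' x v)"
  using assms unfolding C1_on_def by blast

lemma C1_on_frechet:
  assumes "C1_on U g"
  shows "x \<in> U \<Longrightarrow> (g has_derivative frechet_derivative g (at x)) (at x)"
    and "continuous_on U (\<lambda>x. frechet_derivative g (at x) v)"
proof -
  obtain g' where g': "\<And>x. x \<in> U \<Longrightarrow> (g has_derivative g' x) (at x)" "\<And>v. continuous_on U (\<lambda>x. g' x v)"
    using assms by (rule C1_onE) blast
  have eq: "g' x = frechet_derivative g (at x)" if "x \<in> U" for x
    using g'(1)[OF that] by (rule frechet_derivative_at)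
  then show "x \<in> U \<Longrightarrow> (g has_derivative frechet_derivative g (at x)) (at x)" using g'(1) by fastforce
  show "continuous_on U (\<lambda>x. frechet_derivative g (at x) v)"
    by (rule continuous_on_eq[OF g'(2)]) (simp add: eq)
qed

lemma C1_on_imp_continuous_on: "C1_on U g \<Longrightarrow> continuous_on U g"
  unfolding C1_on_def by (meson continuous_at_imp_continuous_on has_derivative_continuous)

lemma Ck_on_1: "Ck_on (Suc 0) U g \<longleftrightarrow> C1_on U g"
proof
  assume "Ck_on (Suc 0) U g"
  then show "C1_on U g"
    by (intro C1_onI[where g' = "\<lambda>x. frechet_derivative g (at x)"]) (auto simp: frechet_derivative_works)
next
  assume "C1_on U g"
  then show "Ck_on (Suc 0) U g"
    using C1_on_frechet[of U g] by (auto simp: differentiable_def)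
qed

lemma C1_on_subset: "C1_on U g \<Longrightarrow> V \<subseteq> U \<Longrightarrow> C1_on V g"
  unfolding C1_on_def by (meson continuous_on_subset subsetD)

lemma C1_on_cong:
  assumes "open U" "\<And>x. x \<in> U \<Longrightarrow> f x = g x" "C1_on U g"
  shows "C1_on U f"
proof -
  obtain g' where g': "\<And>x. x \<in> U \<Longrightarrow> (g has_derivative g' x) (at x)" "\<And>v. continuous_on U (\<lambda>x. g' x v)"
    using assms(3) by (rule C1_onE) blast
  have "(f has_derivative g' x) (at x)" if "x \<in> U" for x
    by (rule has_derivative_transform_within_open[OF g'(1)[OF that] assms(1) that]) (simp add: assms(2))
  then show ?thesis using g'(2) by (rule C1_onI)
qed

lemma C1_on_const: "C1_on U (\<lambda>x. c)"
  by (rule C1_onI[where g' = "\<lambda>_ _. 0"]) auto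

lemma C1_on_bounded_linear:
  assumes "bounded_linear h" "C1_on U g"
  shows "C1_on U (\<lambda>x. h (g x))"
proof -
  obtain g' where g': "\<And>x. x \<in> U \<Longrightarrow> (g has_derivative g' x) (at x)" "\<And>v. continuous_on U (\<lambda>x. g' x v)"
    using assms(2) by (rule C1_onE) blast
  show ?thesis
    by (rule C1_onI[where g' = "\<lambda>x v. h (g' x v)"])
       (auto intro: bounded_linear.has_derivative[OF assms(1)] g' bounded_linear.continuous_on[OF assms(1)])
qed

lemma C1_on_bilinear:
  assumes "bounded_bilinear h" "C1_on U f" "C1_on U g"
  shows "C1_on U (\<lambda>x. h (f x) (g x))"
proof -
  obtain f' where f': "\<And>x. x \<in> U \<Longrightarrow> (f has_derivative f' x) (at x)" "\<And>v. continuous_on U (\<lambda>x. f' x v)"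
    using assms(2) by (rule C1_onE) blast
  obtain g' where g': "\<And>x. x \<in> U \<Longrightarrow> (g has_derivative g' x) (at x)" "\<And>v. continuous_on U (\<lambda>x. g' x v)"
    using assms(3) by (rule C1_onE) blast
  show ?thesis
  proof (rule C1_onI[where g' = "\<lambda>x v. h (f x) (g' x v) + h (f' x v) (g x)"])
    show "((\<lambda>x. h (f x) (g x)) has_derivative (\<lambda>v. h (f x) (g' x v) + h (f' x v) (g x))) (at x)" if "x \<in> U" for x
      by (rule bounded_bilinear.FDERIV[OF assms(1) f'(1)[OF that] g'(1)[OF that]])
    show "continuous_on U (\<lambda>x. h (f x) (g' x v) + h (f' x v) (g x))" for v
      by (intro continuous_on_add bounded_bilinear.continuous_on[OF assms(1)] f' g' C1_on_imp_continuous_on assms)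
  qed
qed

lemmas C1_on_mult = C1_on_bilinear[OF bounded_bilinear_mult]
lemmas C1_on_inner = C1_on_bilinear[OF bounded_bilinear_inner]
lemmas C1_on_scaleR = C1_on_bilinear[OF bounded_bilinear_scaleR]

lemma C1_on_add:
  assumes "C1_on U f" "C1_on U g"
  shows "C1_on U (\<lambda>x. f x + g x)"
proof -
  obtain f' where f': "\<And>x. x \<in> U \<Longrightarrow> (f has_derivative f' x) (at x)" "\<And>v. continuous_on U (\<lambda>x. f' x v)"
    using assms(1) by (rule C1_onE) blast
  obtain g' where g': "\<And>x. x \<in> U \<Longrightarrow> (g has_derivative g' x) (at x)" "\<And>v. continuous_on U (\<lambda>x. g' x v)"
    using assms(2) by (rule C1_onE) blast
  show ?thesis
    by (rule C1_onI[where g' = "\<lambda>x v. f' x v + g' x v"]) (auto intro: has_derivative_add f' g' continuous_on_add)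
qed

lemma C1_on_sum:
  "(\<And>i. i \<in> I \<Longrightarrow> C1_on U (f i)) \<Longrightarrow> C1_on U (\<lambda>x. \<Sum>i\<in>I. f i x)"
  by (induction I rule: infinite_finite_induct) (auto intro: C1_on_add C1_on_const)

lemma C1_on_prod:
  fixes f :: "'i \<Rightarrow> 'a::real_normed_vector \<Rightarrow> real"
  shows "(\<And>i. i \<in> I \<Longrightarrow> C1_on U (f i)) \<Longrightarrow> C1_on U (\<lambda>x. \<Prod>i\<in>I. f i x)"
  by (induction I rule: infinite_finite_induct) (auto intro: C1_on_mult C1_on_const)

lemma C1_on_real_compose:
  fixes g :: "'a::real_normed_vector \<Rightarrow> real"
  assumes g: "C1_on U g" and h: "\<And>x. x \<in> U \<Longrightarrow> (h has_real_derivative h' (g x)) (at (g x))"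
    and c: "continuous_on (g ` U) h'"
  shows "C1_on U (\<lambda>x. h (g x))"
proof -
  obtain g' where g': "\<And>x. x \<in> U \<Longrightarrow> (g has_derivative g' x) (at x)" "\<And>v. continuous_on U (\<lambda>x. g' x v)"
    using g by (rule C1_onE) blast
  show ?thesis
  proof (rule C1_onI[where g' = "\<lambda>x v. h' (g x) * g' x v"])
    show "((\<lambda>x. h (g x)) has_derivative (\<lambda>v. h' (g x) * g' x v)) (at x)" if "x \<in> U" for x
      using has_derivative_compose[OF g'(1)[OF that] h[OF that, unfolded has_field_derivative_def]] .
    show "continuous_on U (\<lambda>x. h' (g x) * g' x v)" for v
      by (intro continuous_on_mult continuous_on_compose2[OF c] C1_on_imp_continuous_on[OF g] g') auto
  qed
qed

lemma C1_on_inverse: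
  fixes g :: "'a::real_normed_vector \<Rightarrow> real"
  assumes "C1_on U g" "\<And>x. x \<in> U \<Longrightarrow> g x \<noteq> 0"
  shows "C1_on U (\<lambda>x. inverse (g x))"
proof (rule C1_on_real_compose[OF assms(1), where h' = "\<lambda>y. - (inverse y ^ Suc (Suc 0))"])
  show "(inverse has_real_derivative - (inverse (g x) ^ Suc (Suc 0))) (at (g x))" if "x \<in> U" for x
    by (rule DERIV_inverse[OF assms(2)[OF that]])
  show "continuous_on (g ` U) (\<lambda>y. - (inverse y ^ Suc (Suc 0)))"
    using assms(2) by (intro continuous_intros) auto
qed

lemma C1_on_component:
  assumes "C1_on U g"
  shows "C1_on U (\<lambda>x. g x $ i)"
  by (rule C1_on_bounded_linear[OF bounded_linear_vec_nth assms])

lemma C1_on_vec: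
  fixes g :: "'a::real_normed_vector \<Rightarrow> real ^ 'n"
  assumes "\<And>i. C1_on U (\<lambda>x. g x $ i)"
  shows "C1_on U g"
proof -
  have "C1_on U (\<lambda>x. \<Sum>i\<in>UNIV. (g x $ i) *\<^sub>R axis i (1::real))"
    by (intro C1_on_sum C1_on_scaleR assms C1_on_const)
  moreover have "(\<Sum>i\<in>UNIV. (g x $ i) *\<^sub>R axis i (1::real)) = g x" for x
    by (simp add: vec_eq_iff axis_def sum.delta if_distrib[of "\<lambda>y. _ * y"] cong: if_cong)
  ultimately show ?thesis by (simp only:)
qed

lemma C1_on_det:
  fixes E :: "'a::real_normed_vector \<Rightarrow> real ^ 'n ^ 'n"
  assumes "\<And>i j. C1_on U (\<lambda>x. E x $ i $ j)"
  shows "C1_on U (\<lambda>x. det (E x))"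
  unfolding det_def by (intro C1_on_sum C1_on_mult C1_on_prod C1_on_const assms)

text \<open>Cramer's rule writes the solution with determinants and one quotient, all of them C^1.
  The gradient is defined by such a linear system in a chart.\<close>

lemma C1_on_cramer:
  fixes E :: "'a::real_normed_vector \<Rightarrow> real ^ 'n ^ 'n"
  assumes "open U" "\<And>i j. C1_on U (\<lambda>x. E x $ i $ j)" "\<And>i. C1_on U (\<lambda>x. c x $ i)"
    and "\<And>x. x \<in> U \<Longrightarrow> det (E x) \<noteq> 0" "\<And>x. x \<in> U \<Longrightarrow> E x *v V x = c x"
  shows "C1_on U V"
proof (rule C1_on_cong[OF assms(1)])
  let ?V = "\<lambda>x. \<chi> k. det (\<chi> i j. if j = k then c x $ i else E x $ i $ j) / det (E x)"
  show "V x = ?V x" if "x \<in> U" for x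
    using cramer[OF assms(4)[OF that], of "V x" "c x"] assms(5)[OF that] by simp
  show "C1_on U ?V"
  proof (rule C1_on_vec)
    fix k
    have "C1_on U (\<lambda>x. (\<chi> i j. if j = k then c x $ i else E x $ i $ j) $ i $ j)" for i j
      using assms(2,3) by (cases "j = k") auto
    then have "C1_on U (\<lambda>x. det (\<chi> i j. if j = k then c x $ i else E x $ i $ j) * inverse (det (E x)))"
      by (intro C1_on_mult C1_on_det C1_on_inverse assms) auto
    then show "C1_on U (\<lambda>x. ?V x $ k)" by (simp add: divide_inverse)
  qed
qed

lemma continuous_on_cramer:
  fixes E :: "'a::topological_space \<Rightarrow> real ^ 'n ^ 'n"
  assumes "continuous_on U E" "continuous_on U c"
    and "\<And>x. x \<in> U \<Longrightarrow> det (E x) \<noteq> 0" "\<And>x. x \<in> U \<Longrightarrow> E x *v V x = c x"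
  shows "continuous_on U V"
proof (rule continuous_on_eq)
  let ?V = "\<lambda>x. \<chi> k. det (\<chi> i j. if j = k then c x $ i else E x $ i $ j) / det (E x)"
  show "?V x = V x" if "x \<in> U" for x
    using cramer[OF assms(3)[OF that], of "V x" "c x"] assms(4)[OF that] by simp
  have "continuous_on U (\<lambda>x. if j = k then c x $ i else E x $ i $ j)" for i j k
    using assms(1,2) by (cases "j = k") (auto intro!: continuous_intros)
  then show "continuous_on U ?V"
    using assms(3) by (intro continuous_on_vec_lambda continuous_on_divide continuous_on_det assms(1)) auto
qed

lemma continuous_on_matrix_cramer:
  fixes E C N :: "'a::topological_space \<Rightarrow> real ^ 'n ^ 'n"
  assumes "continuous_on U E" "continuous_on U C"
    and "\<And>x. x \<in> U \<Longrightarrow> det (E x) \<noteq> 0" "\<And>x. x \<in> U \<Longrightarrow> N x ** E x = C x"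
  shows "continuous_on U N"
proof -
  have "continuous_on U (\<lambda>x. N x $ i)" for i
  proof (rule continuous_on_cramer[where E = "\<lambda>x. transpose (E x)" and c = "\<lambda>x. C x $ i"])
    show "continuous_on U (\<lambda>x. transpose (E x))"
      using assms(1) unfolding transpose_def by (intro continuous_on_vec_lambda continuous_intros)
    show "continuous_on U (\<lambda>x. C x $ i)" using assms(2) by (intro continuous_intros)
    show "det (transpose (E x)) \<noteq> 0" if "x \<in> U" for x using assms(3)[OF that] by simp
    show "transpose (E x) *v N x $ i = C x $ i" if "x \<in> U" for x
      unfolding assms(4)[OF that, symmetric]
      by (simp add: vec_eq_iff matrix_matrix_mult_def matrix_vector_mult_def transpose_def mult.commute
          del: transpose_matrix_vector)
  qed
  then have "continuous_on U (\<lambda>x. \<chi> i. N x $ i)" by (intro continuous_on_vec_lambda)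
  then show ?thesis by simp
qed

text \<open>The mean value theorem is applied in direction u to the increment in v, and then in
  direction v to the derivative along u. Exchanging u and v leaves the second difference
  unchanged.\<close>

lemma second_difference:
  fixes g :: "'a::real_normed_vector \<Rightarrow> real"
  assumes h: "h > 0" and S: "\<And>s t. 0 \<le> s \<Longrightarrow> s \<le> h \<Longrightarrow> 0 \<le> t \<Longrightarrow> t \<le> h \<Longrightarrow> x + s *\<^sub>R u + t *\<^sub>R v \<in> U"
    and G: "\<And>y. y \<in> U \<Longrightarrow> (g has_derivative G y) (at y)"
    and Gu: "\<And>y. y \<in> U \<Longrightarrow> ((\<lambda>y. G y u) has_derivative Gu y) (at y)"
  shows "\<exists>s t. 0 \<le> s \<and> s \<le> h \<and> 0 \<le> t \<and> t \<le> h \<and>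
    g (x + h *\<^sub>R u + h *\<^sub>R v) - g (x + h *\<^sub>R u) - g (x + h *\<^sub>R v) + g x = h * h * Gu (x + s *\<^sub>R u + t *\<^sub>R v) v"
proof -
  let ?k = "\<lambda>s. g (x + s *\<^sub>R u + h *\<^sub>R v) - g (x + s *\<^sub>R u + 0 *\<^sub>R v)"
  have aff: "((\<lambda>s. x + s *\<^sub>R u + t *\<^sub>R v) has_derivative (\<lambda>r. r *\<^sub>R u)) (at s)" for s t
    by (auto intro!: derivative_eq_intros)
  have lin: "G y (r *\<^sub>R w) = r * G y w" if "y \<in> U" for y r w
    using linear_cmul[OF has_derivative_linear[OF G[OF that]]] by simp
  have dg: "((\<lambda>s. g (x + s *\<^sub>R u + t *\<^sub>R v)) has_real_derivative G (x + s *\<^sub>R u + t *\<^sub>R v) u) (at s)"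
    if "0 \<le> s" "s \<le> h" "0 \<le> t" "t \<le> h" for s t
    using has_derivative_compose[OF aff G[OF S[OF that]]] lin[OF S[OF that]]
    by (simp add: has_field_derivative_def mult.commute[of _ "G _ _"] mult_commute_abs)
  have "\<exists>s. 0 < s \<and> s < h \<and> ?k h - ?k 0 = (h - 0) * (G (x + s *\<^sub>R u + h *\<^sub>R v) u - G (x + s *\<^sub>R u + 0 *\<^sub>R v) u)"
    by (rule MVT2[OF h]) (use h in \<open>intro DERIV_diff dg; simp\<close>)
  then obtain s where s: "0 < s" "s < h" "?k h - ?k 0 = h * (G (x + s *\<^sub>R u + h *\<^sub>R v) u - G (x + s *\<^sub>R u + 0 *\<^sub>R v) u)"
    by auto
  have aff2: "((\<lambda>t. x + s *\<^sub>R u + t *\<^sub>R v) has_derivative (\<lambda>r. r *\<^sub>R v)) (at t)" for t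
    by (auto intro!: derivative_eq_intros)
  have dG: "((\<lambda>t. G (x + s *\<^sub>R u + t *\<^sub>R v) u) has_real_derivative Gu (x + s *\<^sub>R u + t *\<^sub>R v) v) (at t)"
    if "0 \<le> t" "t \<le> h" for t
  proof -
    have y: "x + s *\<^sub>R u + t *\<^sub>R v \<in> U" using s that by (intro S) auto
    have "Gu (x + s *\<^sub>R u + t *\<^sub>R v) (r *\<^sub>R v) = r * Gu (x + s *\<^sub>R u + t *\<^sub>R v) v" for r
      using linear_cmul[OF has_derivative_linear[OF Gu[OF y]]] by simp
    then show ?thesis
      using has_derivative_compose[OF aff2 Gu[OF y]]
      by (simp add: has_field_derivative_def mult_commute_abs)
  qed
  have "\<exists>t. 0 < t \<and> t < h \<and> G (x + s *\<^sub>R u + h *\<^sub>R v) u - G (x + s *\<^sub>R u + 0 *\<^sub>R v) u = (h - 0) * Gu (x + s *\<^sub>R u + t *\<^sub>R v) v"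
    by (rule MVT2[OF h]) (rule dG)
  then obtain t where t: "0 < t" "t < h"
      "G (x + s *\<^sub>R u + h *\<^sub>R v) u - G (x + s *\<^sub>R u + 0 *\<^sub>R v) u = h * Gu (x + s *\<^sub>R u + t *\<^sub>R v) v"
    by auto
  have "g (x + h *\<^sub>R u + h *\<^sub>R v) - g (x + h *\<^sub>R u) - g (x + h *\<^sub>R v) + g x = ?k h - ?k 0" by simp
  also have "\<dots> = h * h * Gu (x + s *\<^sub>R u + t *\<^sub>R v) v" using s(3) t(3) by simp
  finally show ?thesis using s t by (intro exI[of _ s] exI[of _ t]) auto
qed

text \<open>The two mean value expressions for the same second difference agree at points close to
  x, and continuity of the mixed derivatives carries the equality over to x.\<close>

lemma clairaut:
  fixes g :: "'a::real_normed_vector \<Rightarrow> real"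
  assumes "open U" "x \<in> U"
    and G: "\<And>y. y \<in> U \<Longrightarrow> (g has_derivative G y) (at y)"
    and Gu: "\<And>y. y \<in> U \<Longrightarrow> ((\<lambda>y. G y u) has_derivative Gu y) (at y)" "continuous_on U (\<lambda>y. Gu y v)"
    and Gv: "\<And>y. y \<in> U \<Longrightarrow> ((\<lambda>y. G y v) has_derivative Gv y) (at y)" "continuous_on U (\<lambda>y. Gv y u)"
  shows "Gu x v = Gv x u"
proof (rule ccontr)
  assume neq: "Gu x v \<noteq> Gv x u"
  define d where "d = \<bar>Gu x v - Gv x u\<bar> / 2"
  have d: "d > 0" using neq by (simp add: d_def)
  have "isCont (\<lambda>y. Gu y v) x" "isCont (\<lambda>y. Gv y u) x"
    using assms(1,2) Gu(2) Gv(2) by (auto simp: continuous_on_eq_continuous_at)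
  then obtain d1 d2 where d1: "d1 > 0" "\<And>y. dist y x < d1 \<Longrightarrow> \<bar>Gu y v - Gu x v\<bar> < d"
    and d2: "d2 > 0" "\<And>y. dist y x < d2 \<Longrightarrow> \<bar>Gv y u - Gv x u\<bar> < d"
    using d unfolding continuous_at_eps_delta dist_real_def by metis
  obtain d3 where d3: "d3 > 0" "ball x d3 \<subseteq> U" using assms(1,2) open_contains_ball by blast
  define e where "e = Min {d1, d2, d3}"
  have e: "e > 0" "e \<le> d1" "e \<le> d2" "e \<le> d3" using d1 d2 d3 by (auto simp: e_def)
  \<comment> \<open>Keeps the parallelogram spanned by h u and h v within e / 2 of x; the added 1
    covers u = v = 0.\<close>
  define h where "h = e / (2 * (norm u + norm v + 1))"
  have h: "h > 0" using e by (simp add: h_def add_nonneg_pos)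
  have near: "dist (x + s *\<^sub>R u + t *\<^sub>R v) x < e" if "0 \<le> s" "s \<le> h" "0 \<le> t" "t \<le> h" for s t
  proof -
    have "dist (x + s *\<^sub>R u + t *\<^sub>R v) x = norm (s *\<^sub>R u + t *\<^sub>R v)" by (simp add: dist_norm add.assoc)
    also have "\<dots> \<le> s * norm u + t * norm v"
      using norm_triangle_ineq[of "s *\<^sub>R u" "t *\<^sub>R v"] that by simp
    also have "\<dots> \<le> h * norm u + h * norm v" using that by (intro add_mono mult_right_mono) auto
    also have "\<dots> \<le> h * (norm u + norm v + 1)" using h by (simp add: algebra_simps)
    also have "\<dots> = e / 2"
      using add_nonneg_pos[of "norm u + norm v" 1] by (simp add: h_def field_simps)
    also have "\<dots> < e" using e by simp
    finally show ?thesis .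
  qed
  have S: "x + s *\<^sub>R u + t *\<^sub>R v \<in> U" if "0 \<le> s" "s \<le> h" "0 \<le> t" "t \<le> h" for s t
    using near[OF that] e d3(2) by (auto simp: dist_commute)
  obtain s t where st: "0 \<le> s" "s \<le> h" "0 \<le> t" "t \<le> h"
    "g (x + h *\<^sub>R u + h *\<^sub>R v) - g (x + h *\<^sub>R u) - g (x + h *\<^sub>R v) + g x = h * h * Gu (x + s *\<^sub>R u + t *\<^sub>R v) v"
    using second_difference[OF h S G Gu(1)] by blast
  have S': "x + s *\<^sub>R v + t *\<^sub>R u \<in> U" if "0 \<le> s" "s \<le> h" "0 \<le> t" "t \<le> h" for s t
    using S[OF that(3,4,1,2)] by (simp add: add_ac)
  obtain s' t' where st': "0 \<le> s'" "s' \<le> h" "0 \<le> t'" "t' \<le> h"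
    "g (x + h *\<^sub>R v + h *\<^sub>R u) - g (x + h *\<^sub>R v) - g (x + h *\<^sub>R u) + g x = h * h * Gv (x + s' *\<^sub>R v + t' *\<^sub>R u) u"
    using second_difference[OF h S' G Gv(1)] by blast
  have "h * h * Gu (x + s *\<^sub>R u + t *\<^sub>R v) v = h * h * Gv (x + s' *\<^sub>R v + t' *\<^sub>R u) u"
    unfolding st(5)[symmetric] st'(5)[symmetric] by (simp add: add_ac)
  then have eq: "Gu (x + s *\<^sub>R u + t *\<^sub>R v) v = Gv (x + s' *\<^sub>R v + t' *\<^sub>R u) u" using h by simp
  have "\<bar>Gu (x + s *\<^sub>R u + t *\<^sub>R v) v - Gu x v\<bar> < d" using near[OF st(1-4)] e by (intro d1) simp
  moreover have "\<bar>Gv (x + s' *\<^sub>R v + t' *\<^sub>R u) u - Gv x u\<bar> < d"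
    using near[OF st'(3,4,1,2)] e by (intro d2) (simp add: add_ac)
  moreover have "\<bar>a - b\<bar> \<le> \<bar>c - a\<bar> + \<bar>c - b\<bar>" for a b c :: real by (simp add: abs_if)
  ultimately have "\<bar>Gu x v - Gv x u\<bar> < d + d" unfolding eq by (meson add_strict_mono order_le_less_trans)
  then show False by (simp add: d_def)
qed

text \<open>Expansion along the column \<open>None\<close>: a permutation that moves
  \<open>None\<close> has to send some \<open>Some j\<close> to \<open>None\<close> and meets a zero
  entry.\<close>

lemma det_option:
  fixes M :: "real ^ ('n::finite) option ^ 'n option"
  assumes "M $ None $ None = 1" "\<And>i. M $ Some i $ None = 0"
  shows "det M = det (\<chi> i j. M $ Some i $ Some j)"
proof -
  let ?m = "map_permutation UNIV (Some :: 'n \<Rightarrow> 'n option)"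
  have inj: "inj (Some :: 'n \<Rightarrow> 'n option)" by simp
  have bb: "bij_betw (Some :: 'n \<Rightarrow> 'n option) UNIV (range Some)" by (simp add: bij_betw_def)
  have bi: "bij_betw (the :: 'n option \<Rightarrow> 'n) (range Some) UNIV"
    by (auto simp: bij_betw_def inj_on_def image_image)
  have UN: "(UNIV :: 'n option set) = insert None (range Some)" by (rule UNIV_option_conv)
  have bij: "bij_betw ?m {p. p permutes UNIV} {p. p permutes range Some}"
  proof (rule bij_betwI[where g = "map_permutation (range Some) (the :: 'n option \<Rightarrow> 'n)"])
    show "?m \<in> {p. p permutes UNIV} \<rightarrow> {p. p permutes range Some}"
      using map_permutation_permutes[OF bb] by auto
    show "map_permutation (range Some) (the :: 'n option \<Rightarrow> 'n) \<in> {p. p permutes range Some} \<rightarrow> {p. p permutes UNIV}"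
      using map_permutation_permutes[OF bi] by auto
    show "map_permutation (range Some) (the :: 'n option \<Rightarrow> 'n) (?m p) = p" if "p \<in> {p. p permutes UNIV}" for p
      using map_permutation_compose_inv[OF bb, of p the] that by simp
    show "?m (map_permutation (range Some) (the :: 'n option \<Rightarrow> 'n) p) = p" if "p \<in> {p. p permutes range Some}" for p
      by (rule map_permutation_compose_inv[OF bi]) (use that in auto)
  qed
  have "det M = (\<Sum>p | p permutes range Some. of_int (sign p) * (\<Prod>i\<in>UNIV. M $ i $ p i))"
    unfolding det_def
  proof (rule sum.mono_neutral_right)
    show "{p. p permutes range Some} \<subseteq> {p. p permutes (UNIV :: 'n option set)}"
      using permutes_subset by blast
    show "\<forall>p\<in>{p. p permutes UNIV} - {p. p permutes range Some}. of_int (sign p) * (\<Prod>i\<in>UNIV. M $ i $ p i) = 0"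
    proof
      fix p assume p: "p \<in> {p. p permutes (UNIV :: 'n option set)} - {p. p permutes range Some}"
      then have "p None \<noteq> None" unfolding permutes_def by (auto simp: notin_range_Some)
      moreover obtain i where i: "p i = None" using p by (metis DiffD1 mem_Collect_eq permutes_univ)
      ultimately obtain j where "i = Some j" by (cases i) auto
      then have "M $ i $ p i = 0" using assms(2) i by simp
      then have "(\<Prod>i\<in>UNIV. M $ i $ p i) = 0" by (intro prod_zero) auto
      then show "of_int (sign p) * (\<Prod>i\<in>UNIV. M $ i $ p i) = 0" by simp
    qed
  qed simp
  also have "\<dots> = (\<Sum>p | p permutes UNIV. of_int (sign (?m p)) * (\<Prod>i\<in>UNIV. M $ i $ (?m p) i))"
    by (rule sum.reindex_bij_betw[OF bij, symmetric])
  also have "\<dots> = (\<Sum>p | p permutes UNIV. of_int (sign p) * (\<Prod>i\<in>UNIV. M $ Some i $ Some (p i)))"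
  proof (rule sum.cong[OF refl])
    fix p :: "'n \<Rightarrow> 'n" assume p: "p \<in> {p. p permutes UNIV}"
    then have "sign (?m p) = sign p" using sign_map_permutation[OF inj, of p] by simp
    moreover have "(?m p) None = None"
      using map_permutation_permutes[OF bb, of p] p unfolding permutes_def by auto
    moreover have "(?m p) (Some i) = Some (p i)" for i by (rule map_permutation_apply[OF inj]) simp
    ultimately show "of_int (sign (?m p)) * (\<Prod>i\<in>UNIV. M $ i $ (?m p) i) =
        of_int (sign p) * (\<Prod>i\<in>UNIV. M $ Some i $ Some (p i))"
      using assms(1) unfolding UN by (simp add: prod.reindex)
  qed
  also have "\<dots> = det (\<chi> i j. M $ Some i $ Some j)" by (simp add: det_def)
  finally show ?thesis .
qed

section \<open>Hypersurfaces and their charts\<close>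

lemma sum_option_UNIV: "(\<Sum>o'\<in>UNIV. f o') = f None + (\<Sum>i\<in>UNIV. f (Some (i::'n::finite)))"
proof -
  have "(\<Sum>o'\<in>UNIV. f o') = (\<Sum>o'\<in>insert None (range Some). f o')" by (simp only: UNIV_option_conv)
  then show ?thesis by (simp add: sum.reindex notin_range_Some)
qed

text \<open>Differentiates identities valid along a chart, such as \<nu> \<bullet> \<nu> = 1 or the
  orthogonality of \<nu> to the tangent vectors.\<close>

lemma const_derivative:
  assumes "open U" "x \<in> U" "\<And>y. y \<in> U \<Longrightarrow> h y = c" "(h has_derivative h') (at x)"
  shows "h' v = 0"
proof -
  have "((\<lambda>_. c) has_derivative h') (at x)"
    by (rule has_derivative_transform_within_open[OF assms(4,1,2)]) (simp add: assms(3))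
  then have "h' = (\<lambda>_. 0)" by (rule has_derivative_unique) simp
  then show ?thesis by simp
qed

locale hypersurface =
  fixes M :: "('n::finite) ambient set" and \<nu> :: "'n ambient \<Rightarrow> 'n ambient"
  assumes closed: "closed_hypersurface M" and cont_\<nu>: "continuous_on M \<nu>"
    and unit: "\<And>p. p \<in> M \<Longrightarrow> norm (\<nu> p) = 1"
    and orth: "\<And>p X. p \<in> M \<Longrightarrow> X \<in> tangent_space M p \<Longrightarrow> \<nu> p \<bullet> X = 0"
begin

definition C1_field :: "('n ambient \<Rightarrow> 'b::real_normed_vector) \<Rightarrow> bool"
  where "C1_field Z \<longleftrightarrow> (\<forall>U \<phi>. local_param M U \<phi> \<longrightarrow> C1_on U (\<lambda>x. Z (\<phi> x)))"

text \<open>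
  The value \<open>0\<close> in the normal direction leaves the elementary symmetric functions of the tangential
  derivative unchanged, so that these can be read off from ambient determinants.
\<close>

definition dmat :: "('n ambient \<Rightarrow> 'n ambient) \<Rightarrow> 'n ambient \<Rightarrow> real ^ 'n option ^ 'n option"
  where "dmat Z p = matrix (\<lambda>X. deriv_along M Z p (X - (\<nu> p \<bullet> X) *\<^sub>R \<nu> p))"

lemma unit': "p \<in> M \<Longrightarrow> \<nu> p \<bullet> \<nu> p = 1"
  using unit by (simp add: norm_eq_1)

lemma compact_M: "compact M"
  using closed by (simp add: closed_hypersurface_def)

lemma charts: "p \<in> M \<Longrightarrow> \<exists>U \<phi> x. local_param M U \<phi> \<and> x \<in> U \<and> \<phi> x = p"
  using closed unfolding closed_hypersurface_def by (metis imageE)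

end

locale chart = hypersurface M \<nu> for M :: "('n::finite) ambient set" and \<nu> +
  fixes U :: "(real ^ 'n) set" and \<phi> :: "real ^ 'n \<Rightarrow> 'n ambient"
  assumes param: "local_param M U \<phi>"
begin

abbreviation "D x \<equiv> frechet_derivative \<phi> (at x)"

text \<open>The Jacobian matrix at s = 0 of the normal map (y, s) \<mapsto> \<phi> y + s
  \<nu>(\<phi> y), with column \<open>None\<close> for s. It is the moving frame in which all
  ambient matrices are expressed.\<close>

definition E :: "real ^ 'n \<Rightarrow> real ^ 'n option ^ 'n option"
  where "E x = (\<chi> r c. case c of None \<Rightarrow> \<nu> (\<phi> x) $ r | Some i \<Rightarrow> D x (axis i 1) $ r)"

lemma open_U: "open U" and inj_D: "x \<in> U \<Longrightarrow> inj (D x)" and openin_image: "openin (top_of_set M) (\<phi> ` U)"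
  using param by (auto simp: local_param_def)

lemma image_subset: "\<phi> ` U \<subseteq> M"
  using openin_image openin_imp_subset by blast

lemma in_M: "x \<in> U \<Longrightarrow> \<phi> x \<in> M"
  using image_subset by blast

lemma Ck: "Ck_on m U \<phi>"
  using param by (simp add: local_param_def smooth_on_def)

lemma C1_\<phi>: "C1_on U \<phi>"
  using Ck[of "Suc 0"] unfolding Ck_on_1 .

lemma C1_D: "C1_on U (\<lambda>x. D x v)"
  using Ck[of "Suc (Suc 0)"] unfolding Ck_on.simps(2)[of "Suc 0"] Ck_on_1 by blast

lemma deriv_\<phi>: "x \<in> U \<Longrightarrow> (\<phi> has_derivative D x) (at x)"
  by (rule C1_on_frechet(1)[OF C1_\<phi>])

lemma linear_D: "x \<in> U \<Longrightarrow> linear (D x)"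
  by (rule has_derivative_linear[OF deriv_\<phi>])

lemma at_within_image:
  assumes "x \<in> U"
  shows "at (\<phi> x) within M = at (\<phi> x) within \<phi> ` U"
proof -
  obtain O' where O': "open O'" "\<phi> ` U = M \<inter> O'" using openin_image by (auto simp: openin_open)
  then have "\<phi> x \<in> O'" using assms by blast
  then show ?thesis using O' by (intro at_within_nhd[of _ O']) auto
qed

text \<open>The homeomorphism property supplies continuity of \<psi>, which is upgraded to
  differentiability. The injective derivative is bounded below, so |z - x| is controlled by |\<phi>
  z - \<phi> x| and the remainder of \<phi> is also small relative to the latter. On tangent vectors
  the left inverse L is the only possible derivative.\<close>

lemma inverse_derivative:
  assumes x: "x \<in> U"
  obtains \<psi> L where "\<And>y. y \<in> U \<Longrightarrow> \<psi> (\<phi> y) = y" "L \<circ> D x = id" "(\<psi> has_derivative L) (at (\<phi> x) within M)"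
    "continuous_on (\<phi> ` U) \<psi>"
proof -
  obtain \<psi> where hom: "homeomorphism U (\<phi> ` U) \<phi> \<psi>" using param by (auto simp: local_param_def)
  have \<psi>: "\<psi> (\<phi> y) = y" if "y \<in> U" for y using hom that by (simp add: homeomorphism_def)
  obtain L where L: "linear L" "L \<circ> D x = id"
    using linear_injective_left_inverse[OF linear_D[OF x] inj_D[OF x]] by blast
  have bL: "bounded_linear L" using L(1) by (simp add: linear_conv_bounded_linear)
  obtain K where K: "K > 0" "\<And>v. norm (L v) \<le> norm v * K"
    using bounded_linear.pos_bounded[OF bL] by blast
  obtain B where B: "B > 0" "\<And>v. B * norm v \<le> norm (D x v)"
    using linear_inj_bounded_below_pos[OF linear_D[OF x] inj_D[OF x]] by blast
  have c\<psi>: "continuous_on (\<phi> ` U) \<psi>" using hom by (simp add: homeomorphism_def)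
  have "(\<psi> has_derivative L) (at (\<phi> x) within \<phi> ` U)"
    unfolding has_derivative_within_alt
  proof (intro conjI allI impI)
    show "bounded_linear L" by (rule bL)
    fix e :: real assume e: "e > 0"
    \<comment> \<open>The first bound lets half of B |z - x| be absorbed; the second makes the
      resulting error \<eta> K (2 / B) at most e.\<close>
    define \<eta> where "\<eta> = min (B / 2) (e * B / (2 * K))"
    have \<eta>: "\<eta> > 0" "\<eta> \<le> B / 2" "\<eta> * K * (2 / B) \<le> e"
    proof -
      show "\<eta> > 0" "\<eta> \<le> B / 2" using e B K by (simp_all add: \<eta>_def)
      have "\<eta> \<le> e * B / (2 * K)" by (simp add: \<eta>_def)
      then show "\<eta> * K * (2 / B) \<le> e" using B K by (simp add: field_simps)
    qed
    obtain \<delta> where \<delta>: "\<delta> > 0" "\<And>z. norm (z - x) < \<delta> \<Longrightarrow> norm (\<phi> z - \<phi> x - D x (z - x)) \<le> \<eta> * norm (z - x)"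
      using deriv_\<phi>[OF x] \<eta>(1) unfolding has_derivative_at_alt by blast
    obtain d where d: "d > 0" "\<And>y. y \<in> \<phi> ` U \<Longrightarrow> dist y (\<phi> x) < d \<Longrightarrow> dist (\<psi> y) (\<psi> (\<phi> x)) < \<delta>"
      using c\<psi> x \<delta>(1) unfolding continuous_on_iff by blast
    have "norm (\<psi> y - \<psi> (\<phi> x) - L (y - \<phi> x)) \<le> e * norm (y - \<phi> x)"
      if y: "y \<in> \<phi> ` U" "norm (y - \<phi> x) < d" for y
    proof -
      obtain z where z: "z \<in> U" "y = \<phi> z" using y by blast
      have zx: "norm (z - x) < \<delta>" using d(2)[of y] y z \<psi> x by (simp add: dist_norm)
      define R where "R = \<phi> z - \<phi> x - D x (z - x)"
      have R: "norm R \<le> \<eta> * norm (z - x)" unfolding R_def by (rule \<delta>(2)[OF zx])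
      have "L (y - \<phi> x) = (z - x) + L R"
      proof -
        have "y - \<phi> x = D x (z - x) + R" by (simp add: R_def z)
        then show ?thesis using fun_cong[OF L(2), of "z - x"] by (simp add: linear_add[OF L(1)])
      qed
      then have "norm (\<psi> y - \<psi> (\<phi> x) - L (y - \<phi> x)) = norm (L R)" using \<psi> z x by simp
      also have "\<dots> \<le> (\<eta> * norm (z - x)) * K" using K(2)[of R] R K(1) by (meson mult_right_mono less_imp_le order_trans)
      finally have 1: "norm (\<psi> y - \<psi> (\<phi> x) - L (y - \<phi> x)) \<le> \<eta> * K * norm (z - x)" by (simp add: mult_ac)
      have "B * norm (z - x) \<le> norm (y - \<phi> x) + norm R"
      proof -
        have "D x (z - x) = (y - \<phi> x) - R" by (simp add: R_def z)
        then show ?thesis using B(2)[of "z - x"] norm_triangle_ineq4[of "y - \<phi> x" R] by simp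
      qed
      also have "\<dots> \<le> norm (y - \<phi> x) + B / 2 * norm (z - x)"
        using R mult_right_mono[OF \<eta>(2), of "norm (z - x)"] by simp
      finally have "norm (z - x) \<le> (2 / B) * norm (y - \<phi> x)" using B by (simp add: field_simps)
      then have "\<eta> * K * norm (z - x) \<le> \<eta> * K * ((2 / B) * norm (y - \<phi> x))"
        using \<eta>(1) K(1) by (intro mult_left_mono) auto
      also have "\<dots> \<le> e * norm (y - \<phi> x)"
        using mult_right_mono[OF \<eta>(3), of "norm (y - \<phi> x)"] by (simp add: mult_ac)
      finally show ?thesis using 1 by simp
    qed
    then show "\<exists>d>0. \<forall>y\<in>\<phi> ` U. norm (y - \<phi> x) < d \<longrightarrow> norm (\<psi> y - \<psi> (\<phi> x) - L (y - \<phi> x)) \<le> e * norm (y - \<phi> x)"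
      using d(1) by blast
  qed
  then show ?thesis using that \<psi> L(2) c\<psi> unfolding at_within_image[OF x] by blast
qed

lemma D_tangent:
  assumes x: "x \<in> U"
  shows "D x v \<in> tangent_space M (\<phi> x)"
  unfolding tangent_space_def
proof (intro CollectI exI conjI)
  let ?\<gamma> = "\<lambda>t::real. \<phi> (x + t *\<^sub>R v)"
  show "?\<gamma> 0 = \<phi> x" by simp
  have "((\<lambda>t::real. x + t *\<^sub>R v) \<longlongrightarrow> x + 0 *\<^sub>R v) (nhds 0)"
    by (intro tendsto_intros filterlim_ident)
  then have "\<forall>\<^sub>F t in nhds 0. x + t *\<^sub>R v \<in> U"
    using open_U x by (intro topological_tendstoD[where l = "x + 0 *\<^sub>R v"]) auto
  then show "\<forall>\<^sub>F t in nhds 0. ?\<gamma> t \<in> M" by eventually_elim (rule in_M)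
  have "((\<lambda>t::real. x + t *\<^sub>R v) has_derivative (\<lambda>r. r *\<^sub>R v)) (at 0)"
    by (auto intro!: derivative_eq_intros)
  moreover have "(\<phi> has_derivative D x) (at (x + 0 *\<^sub>R v))" using deriv_\<phi>[OF x] by simp
  ultimately have "(?\<gamma> has_derivative (\<lambda>r. D x (r *\<^sub>R v))) (at 0)" by (rule has_derivative_compose)
  then show "(?\<gamma> has_vector_derivative D x v) (at 0)"
    by (simp add: has_vector_derivative_def linear_cmul[OF linear_D[OF x]])
qed

lemma \<nu>_D: "x \<in> U \<Longrightarrow> \<nu> (\<phi> x) \<bullet> D x v = 0"
  using orth[OF in_M D_tangent] by blast

lemma D_expand:
  assumes "x \<in> U"
  shows "D x v = (\<Sum>i\<in>UNIV. (v $ i) *\<^sub>R D x (axis i 1))"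
proof -
  have "D x v = D x (\<Sum>i\<in>UNIV. (v $ i) *\<^sub>R axis i 1)" by (simp add: basis_expansion flip: scalar_mult_eq_scaleR)
  then show ?thesis by (simp add: linear_sum[OF linear_D[OF assms]] linear_cmul[OF linear_D[OF assms]])
qed

lemma E_mult:
  assumes "x \<in> U"
  shows "E x *v c = (c $ None) *\<^sub>R \<nu> (\<phi> x) + D x (\<chi> i. c $ Some i)"
  unfolding D_expand[OF assms, of "\<chi> i. c $ Some i"]
  by (simp add: vec_eq_iff matrix_vector_mult_def E_def sum_option_UNIV mult.commute)

lemma det_E:
  assumes x: "x \<in> U"
  shows "det (E x) \<noteq> 0"
proof -
  have "c = 0" if c: "E x *v c = 0" for c
  proof -
    have e: "(c $ None) *\<^sub>R \<nu> (\<phi> x) + D x (\<chi> i. c $ Some i) = 0" using c by (simp add: E_mult[OF x])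
    then have "\<nu> (\<phi> x) \<bullet> ((c $ None) *\<^sub>R \<nu> (\<phi> x) + D x (\<chi> i. c $ Some i)) = 0" by simp
    then have c0: "c $ None = 0" by (simp add: inner_add_right \<nu>_D[OF x] unit' in_M x)
    then have "D x (\<chi> i. c $ Some i) = 0" using e by simp
    then have "(\<chi> i. c $ Some i) = 0"
      using linear_injective_0[OF linear_D[OF x]] inj_D[OF x] by blast
    then have "c $ Some i = 0" for i by (simp add: vec_eq_iff)
    then show "c = 0" using c0 by (metis (no_types, opaque_lifting) option.exhaust vec_eq_iff zero_index)
  qed
  then have "inj ((*v) (E x))" by (subst linear_injective_0) auto
  then show ?thesis using det_nz_iff_inj[of "(*v) (E x)"] by simp
qed

lemma normal_complement:
  assumes x: "x \<in> U" and X: "\<nu> (\<phi> x) \<bullet> X = 0"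
  obtains v where "X = D x v"
proof -
  obtain c where c: "E x *v c = X" using cramer[OF det_E[OF x]] by blast
  then have e: "(c $ None) *\<^sub>R \<nu> (\<phi> x) + D x (\<chi> i. c $ Some i) = X" by (simp add: E_mult[OF x])
  then have "\<nu> (\<phi> x) \<bullet> ((c $ None) *\<^sub>R \<nu> (\<phi> x) + D x (\<chi> i. c $ Some i)) = 0" using X by simp
  then have "c $ None = 0" by (simp add: inner_add_right \<nu>_D[OF x] unit' in_M x)
  then show ?thesis using that e by auto
qed

lemma chain:
  assumes x: "x \<in> U" and Z: "(Z has_derivative Z') (at (\<phi> x) within M)"
  shows "((\<lambda>x. Z (\<phi> x)) has_derivative (\<lambda>v. Z' (D x v))) (at x)"
proof -
  have "(Z has_derivative Z') (at (\<phi> x) within \<phi> ` U)" using Z at_within_image[OF x] by simp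
  then have "((Z \<circ> \<phi>) has_derivative (Z' \<circ> D x)) (at x within U)"
    using diff_chain_within[OF has_derivative_at_withinI[OF deriv_\<phi>[OF x]]] by blast
  then show ?thesis using at_within_open[OF x open_U] by (simp add: o_def)
qed

lemma differentiable_within:
  assumes x: "x \<in> U" and Z: "((\<lambda>x. Z (\<phi> x)) has_derivative g') (at x)"
  shows "Z differentiable (at (\<phi> x) within M)"
proof -
  obtain \<psi> L where \<psi>: "\<And>y. y \<in> U \<Longrightarrow> \<psi> (\<phi> y) = y" "(\<psi> has_derivative L) (at (\<phi> x) within M)"
    using inverse_derivative[OF x] by metis
  have "(((\<lambda>x. Z (\<phi> x)) \<circ> \<psi>) has_derivative (g' \<circ> L)) (at (\<phi> x) within \<phi> ` U)"
  proof (rule diff_chain_within)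
    show "(\<psi> has_derivative L) (at (\<phi> x) within \<phi> ` U)" using \<psi>(2) by (simp only: at_within_image[OF x])
    show "((\<lambda>x. Z (\<phi> x)) has_derivative g') (at (\<psi> (\<phi> x)) within \<psi> ` \<phi> ` U)"
      using Z by (simp add: \<psi>(1)[OF x] has_derivative_at_withinI)
  qed
  then have "(Z has_derivative (g' \<circ> L)) (at (\<phi> x) within \<phi> ` U)"
    by (rule has_derivative_transform[rotated -1]) (use x \<psi> in auto)
  then show ?thesis by (auto simp: at_within_image[OF x] differentiable_def)
qed

lemma deriv_along_chart:
  assumes x: "x \<in> U" and Z: "C1_on U (\<lambda>x. Z (\<phi> x))"
  shows "(Z has_derivative deriv_along M Z (\<phi> x)) (at (\<phi> x) within M)"
    and "deriv_along M Z (\<phi> x) (D x v) = frechet_derivative (\<lambda>x. Z (\<phi> x)) (at x) v"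
proof -
  show 1: "(Z has_derivative deriv_along M Z (\<phi> x)) (at (\<phi> x) within M)"
    using differentiable_within[OF x C1_on_frechet(1)[OF Z x]]
    by (simp add: deriv_along_def[abs_def] frechet_derivative_works)
  show "deriv_along M Z (\<phi> x) (D x v) = frechet_derivative (\<lambda>x. Z (\<phi> x)) (at x) v"
    using frechet_derivative_at[OF chain[OF x 1]] by metis
qed

lemma dmat_mult:
  assumes x: "x \<in> U" and Z: "C1_on U (\<lambda>x. Z (\<phi> x))"
  shows "dmat Z (\<phi> x) *v X = deriv_along M Z (\<phi> x) (X - (\<nu> (\<phi> x) \<bullet> X) *\<^sub>R \<nu> (\<phi> x))"
proof -
  have lin: "linear (deriv_along M Z (\<phi> x))"
    by (rule has_derivative_linear[OF deriv_along_chart(1)[OF x Z]])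
  have "linear (\<lambda>X. X - (\<nu> (\<phi> x) \<bullet> X) *\<^sub>R \<nu> (\<phi> x))"
    by (intro linearI) (simp_all add: inner_add_right algebra_simps)
  then have "linear (\<lambda>X. deriv_along M Z (\<phi> x) (X - (\<nu> (\<phi> x) \<bullet> X) *\<^sub>R \<nu> (\<phi> x)))"
    using linear_compose[OF _ lin] by (simp add: o_def)
  then show ?thesis unfolding dmat_def by (simp add: matrix_works)
qed

lemma dmat_\<nu>: "x \<in> U \<Longrightarrow> C1_on U (\<lambda>x. Z (\<phi> x)) \<Longrightarrow> dmat Z (\<phi> x) *v \<nu> (\<phi> x) = 0"
  using linear_0[OF has_derivative_linear[OF deriv_along_chart(1)]] by (simp add: dmat_mult unit' in_M)

lemma dmat_D:
  "x \<in> U \<Longrightarrow> C1_on U (\<lambda>x. Z (\<phi> x)) \<Longrightarrow> dmat Z (\<phi> x) *v D x v = frechet_derivative (\<lambda>x. Z (\<phi> x)) (at x) v"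
  by (simp add: dmat_mult \<nu>_D deriv_along_chart(2))

lemma matrix_eqI_chart:
  assumes x: "x \<in> U" and "N *v \<nu> (\<phi> x) = N' *v \<nu> (\<phi> x)" "\<And>v. N *v D x v = N' *v D x v"
  shows "N = N'"
proof -
  have "N *v X = N' *v X" for X
  proof -
    obtain c where c: "E x *v c = X" using cramer[OF det_E[OF x]] by blast
    then show ?thesis using assms
      by (auto simp: E_mult[OF x] matrix_vector_right_distrib matrix_vector_mult_scaleR)
  qed
  then show ?thesis by (simp add: matrix_eq)
qed

lemma continuous_\<nu>: "continuous_on U (\<lambda>x. \<nu> (\<phi> x))"
  by (rule continuous_on_compose2[OF cont_\<nu> C1_on_imp_continuous_on[OF C1_\<phi>] image_subset])

lemma continuous_E: "continuous_on U E"
proof (rule continuous_on_matrix)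
  fix r and c :: "'n option"
  show "continuous_on U (\<lambda>x. E x $ r $ c)"
    using continuous_\<nu> C1_on_imp_continuous_on[OF C1_D]
    by (cases c) (auto simp: E_def intro!: continuous_intros)
qed

lemma dmat_E:
  assumes x: "x \<in> U" and Z: "C1_on U (\<lambda>x. Z (\<phi> x))"
  shows "dmat Z (\<phi> x) ** E x =
    (\<chi> r c. case c of None \<Rightarrow> 0 | Some i \<Rightarrow> frechet_derivative (\<lambda>x. Z (\<phi> x)) (at x) (axis i 1) $ r)"
proof -
  have "(dmat Z (\<phi> x) ** E x) $ r $ c = (dmat Z (\<phi> x) *v (case c of None \<Rightarrow> \<nu> (\<phi> x) | Some i \<Rightarrow> D x (axis i 1))) $ r" for r c
    by (cases c) (simp_all add: matrix_matrix_mult_def matrix_vector_mult_def E_def)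
  then show ?thesis
    unfolding vec_eq_iff using dmat_\<nu>[OF x Z] dmat_D[OF x Z] by (auto split: option.split)
qed

lemma continuous_dmat:
  assumes Z: "C1_on U (\<lambda>x. Z (\<phi> x))"
  shows "continuous_on U (\<lambda>x. dmat Z (\<phi> x))"
proof (rule continuous_on_matrix_cramer[OF continuous_E _ det_E dmat_E[OF _ Z]])
  show "continuous_on U (\<lambda>x. \<chi> r c. case c of None \<Rightarrow> 0 | Some i \<Rightarrow> frechet_derivative (\<lambda>x. Z (\<phi> x)) (at x) (axis i 1) $ r)"
  proof (intro continuous_on_vec_lambda)
    fix r and c :: "'n option"
    show "continuous_on U (\<lambda>x. case c of None \<Rightarrow> 0 | Some i \<Rightarrow> frechet_derivative (\<lambda>x. Z (\<phi> x)) (at x) (axis i 1) $ r)"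
      using C1_on_frechet(2)[OF Z] by (cases c) (auto intro!: continuous_intros)
  qed
qed

text \<open>
  The cofactor vector \<open>n = det(E) \<nu>\<close> is built from \<open>D\<phi>\<close> only, and \<open>det(E)\<^sup>2 = |n|\<^sup>2\<close>; this gives
  the regularity of the unit normal, which is only assumed continuous.
\<close>

lemma C1_\<nu>_chart: "C1_on U (\<lambda>x. \<nu> (\<phi> x))"
proof -
  define n where "n x = (\<chi> j. det (\<chi> r c. case c of None \<Rightarrow> axis j (1::real) $ r | Some i \<Rightarrow> D x (axis i 1) $ r))" for x
  let ?J = "\<lambda>x. det (E x)"
  have C1_n: "C1_on U n"
  proof (rule C1_on_vec)
    fix j
    have "C1_on U (\<lambda>x. (\<chi> r c. case c of None \<Rightarrow> axis j (1::real) $ r | Some i \<Rightarrow> D x (axis i 1) $ r) $ r $ c)"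
      for r and c :: "'n option"
      by (cases c) (auto intro: C1_on_const C1_on_component[OF C1_D])
    then have "C1_on U (\<lambda>x. det (\<chi> r c. case c of None \<Rightarrow> axis j (1::real) $ r | Some i \<Rightarrow> D x (axis i 1) $ r))"
      by (rule C1_on_det)
    then show "C1_on U (\<lambda>x. n x $ j)" by (simp add: n_def)
  qed
  \<comment> \<open>Linearity of the determinant in the column \<open>None\<close>. For v = D x e_i
    two columns coincide, which shows that n is normal to M.\<close>
  have n_inner: "n x \<bullet> v = det (\<chi> r c. case c of None \<Rightarrow> v $ r | Some i \<Rightarrow> D x (axis i 1) $ r)" for x and v :: "'n ambient"
  proof -
    let ?R = "\<lambda>w. \<chi> r. if r = None then w else (\<chi> s. D x (axis (the r) 1) $ s)"
    have tr: "det (\<chi> r c. case c of None \<Rightarrow> w $ r | Some i \<Rightarrow> D x (axis i 1) $ r) = det (?R w)" for w :: "'n ambient"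
    proof -
      have "transpose (?R w) = (\<chi> r c. case c of None \<Rightarrow> w $ r | Some i \<Rightarrow> D x (axis i 1) $ r)"
        by (simp add: vec_eq_iff transpose_def split: option.split)
      then show ?thesis using det_transpose[of "?R w"] by simp
    qed
    have add: "det (?R (w + w')) = det (?R w) + det (?R w')" for w w'
      by (rule det_row_add)
    have mult: "det (?R (c *\<^sub>R w)) = c * det (?R w)" for c w
      unfolding scalar_mult_eq_scaleR[symmetric] by (rule det_row_mul)
    have lin: "linear (\<lambda>w. det (?R w))" by (intro linearI) (simp_all only: add mult real_scaleR_def)
    have "(\<Sum>j\<in>UNIV. (v $ j) *\<^sub>R axis j 1) = v" by (simp add: basis_expansion flip: scalar_mult_eq_scaleR)
    then have "det (?R v) = det (?R (\<Sum>j\<in>UNIV. (v $ j) *\<^sub>R axis j 1))" by (simp only:)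
    also have "\<dots> = (\<Sum>j\<in>UNIV. (v $ j) * det (?R (axis j 1)))"
      by (simp only: linear_sum[OF lin] mult)
    also have "\<dots> = n x \<bullet> v"
      by (simp add: inner_vec_def n_def tr mult.commute)
    finally show ?thesis by (simp add: tr)
  qed
  have n_eq: "n x = ?J x *\<^sub>R \<nu> (\<phi> x)" if x: "x \<in> U" for x
  proof -
    have nD: "n x \<bullet> D x (axis i 1) = 0" for i
      unfolding n_inner
      by (rule det_identical_columns[of None "Some i"]) (simp_all add: column_def)
    have "n x \<bullet> D x v = 0" for v
      unfolding D_expand[OF x, of v] by (simp add: inner_sum_right nD)
    moreover have n\<nu>: "n x \<bullet> \<nu> (\<phi> x) = ?J x" by (simp add: n_inner E_def)
    ultimately have "(n x - ?J x *\<^sub>R \<nu> (\<phi> x)) \<bullet> (E x *v c) = 0" for c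
      by (simp add: E_mult[OF x] inner_add_right inner_diff_left \<nu>_D[OF x] unit' in_M x)
    moreover obtain c where "E x *v c = n x - ?J x *\<^sub>R \<nu> (\<phi> x)" using cramer[OF det_E[OF x]] by blast
    ultimately have "(n x - ?J x *\<^sub>R \<nu> (\<phi> x)) \<bullet> (n x - ?J x *\<^sub>R \<nu> (\<phi> x)) = 0" by metis
    then show ?thesis by simp
  qed
  have nn: "n x \<bullet> n x = (?J x)\<^sup>2" if "x \<in> U" for x
    using n_eq[OF that] unit'[OF in_M[OF that]] by (simp add: power2_eq_square)
  have cJ: "continuous_on U ?J" by (intro continuous_on_det continuous_E)
  have "C1_on U (\<lambda>x. n x \<bullet> n x)" by (intro C1_on_inner C1_n)
  then obtain q' where q': "\<And>x. x \<in> U \<Longrightarrow> ((\<lambda>x. n x \<bullet> n x) has_derivative q' x) (at x)"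
      "\<And>v. continuous_on U (\<lambda>x. q' x v)"
    by (rule C1_onE) blast
  have "C1_on U ?J"
  proof (rule C1_onI[where g' = "\<lambda>x v. q' x v / (2 * ?J x)"])
    show "continuous_on U (\<lambda>x. q' x v / (2 * ?J x))" for v
      using det_E by (intro continuous_intros q' cJ) auto
    fix x assume x: "x \<in> U"
    let ?s = "sgn (?J x)"
    have s: "?s * ?s = 1" "?s * ?J x = \<bar>?J x\<bar>" using det_E[OF x] by (auto simp: sgn_if)
    \<comment> \<open>Near x the determinant keeps its sign, so it equals that sign times sqrt (n
      \<bullet> n), and the square root is differentiable because n \<bullet> n > 0.\<close>
    let ?O = "{y \<in> U. ?J y * ?J x > 0}"
    have oO: "open ?O"
    proof -
      have "?O = U \<inter> (\<lambda>y. ?J y * ?J x) -` {0<..}" by auto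
      then show ?thesis
        using continuous_open_preimage[OF _ open_U, of "\<lambda>y. ?J y * ?J x" "{0<..}"] cJ
        by (simp add: continuous_on_mult_right)
    qed
    have xO: "x \<in> ?O" using x det_E[OF x] by (simp add: zero_less_mult_iff) linarith
    have eqO: "?s * sqrt (n y \<bullet> n y) = ?J y" if "y \<in> ?O" for y
      using that nn[of y] by (auto simp: sgn_if zero_less_mult_iff)
    have der: "((\<lambda>y. ?s * sqrt (n y \<bullet> n y)) has_derivative (\<lambda>v. q' x v / (2 * ?J x))) (at x)"
    proof -
      have "(sqrt has_real_derivative inverse (sqrt (n x \<bullet> n x)) / 2) (at (n x \<bullet> n x))"
        using nn[OF x] det_E[OF x] by (intro DERIV_real_sqrt) simp
      from has_derivative_compose[OF q'(1)[OF x] this[unfolded has_field_derivative_def]]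
      have "((\<lambda>y. ?s * sqrt (n y \<bullet> n y)) has_derivative (\<lambda>v. ?s * (inverse (sqrt (n x \<bullet> n x)) / 2 * q' x v))) (at x)"
        by (rule has_derivative_mult_right)
      moreover have "?s * (inverse (sqrt (n x \<bullet> n x)) / 2 * q' x v) = q' x v / (2 * ?J x)" for v
        using nn[OF x] det_E[OF x] by (auto simp: sgn_if field_simps)
      ultimately show ?thesis by (simp only:)
    qed
    show "(?J has_derivative (\<lambda>v. q' x v / (2 * ?J x))) (at x)"
      by (rule has_derivative_transform_within_open[OF der oO xO]) (rule eqO)
  qed
  then have "C1_on U (\<lambda>x. inverse (?J x) *\<^sub>R n x)"
    by (intro C1_on_scaleR C1_on_inverse C1_n det_E)
  then show ?thesis
    by (rule C1_on_cong[OF open_U, rotated]) (simp add: n_eq det_E)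
qed

end

section \<open>Gradient and Hessian of a function\<close>

lemma symmetric_matrixI:
  fixes N :: "real ^ 'm ^ 'm"
  assumes "\<And>x y. (N *v x) \<bullet> y = x \<bullet> (N *v y)"
  shows "transpose N = N"
proof -
  have "N $ j $ i = (N *v axis i 1) \<bullet> axis j 1" for i j
    by (simp add: inner_axis matrix_vector_mult_basis column_def)
  then have "N $ j $ i = N $ i $ j" for i j using assms[of "axis i 1" "axis j 1"] by (simp add: inner_commute)
  then show ?thesis by (simp add: vec_eq_iff transpose_def)
qed

context hypersurface
begin

lemma chart_at:
  assumes "p \<in> M"
  obtains U \<phi> x where "chart M \<nu> U \<phi>" "x \<in> U" "\<phi> x = p"
proof -
  obtain U \<phi> x where "local_param M U \<phi>" "x \<in> U" "\<phi> x = p" using charts[OF assms] by blast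
  moreover have "chart M \<nu> U \<phi>"
    using \<open>local_param M U \<phi>\<close> hypersurface_axioms by (simp add: chart_def chart_axioms_def)
  ultimately show ?thesis using that by blast
qed

lemma C1_field_\<nu>: "C1_field \<nu>"
  unfolding C1_field_def
proof (intro allI impI)
  fix U \<phi> assume "local_param M U \<phi>"
  then interpret chart M \<nu> U \<phi> by unfold_locales
  show "C1_on U (\<lambda>x. \<nu> (\<phi> x))" by (rule C1_\<nu>_chart)
qed

lemma continuous_from_charts:
  assumes "\<And>U \<phi>. local_param M U \<phi> \<Longrightarrow> continuous_on U (\<lambda>x. F (\<phi> x))"
  shows "continuous_on M F"
  unfolding continuous_on_eq_continuous_within
proof
  fix p assume "p \<in> M"
  then obtain U \<phi> x where "chart M \<nu> U \<phi>" and x: "x \<in> U" "\<phi> x = p" by (rule chart_at)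
  then interpret chart M \<nu> U \<phi> by simp
  obtain \<psi> L where \<psi>: "\<And>y. y \<in> U \<Longrightarrow> \<psi> (\<phi> y) = y" "continuous_on (\<phi> ` U) \<psi>"
    using inverse_derivative[OF x(1)] by metis
  have "continuous_on (\<phi> ` U) (\<lambda>q. F (\<phi> (\<psi> q)))"
    by (rule continuous_on_compose2[OF assms[OF param] \<psi>(2)]) (use \<psi>(1) in auto)
  then have "continuous_on (\<phi> ` U) F"
    by (rule continuous_on_eq) (use \<psi>(1) in auto)
  then have "continuous (at p within \<phi> ` U) F" using x by (auto simp: continuous_on_eq_continuous_within)
  then show "continuous (at p within M) F" using at_within_image[OF x(1)] x(2) by simp
qed

lemma continuous_on_dmat: "C1_field Z \<Longrightarrow> continuous_on M (dmat Z)"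
proof (rule continuous_from_charts)
  fix U \<phi> assume Z: "C1_field Z" and "local_param M U \<phi>"
  then interpret chart M \<nu> U \<phi> by unfold_locales
  show "continuous_on U (\<lambda>x. dmat Z (\<phi> x))" using Z param by (intro continuous_dmat) (simp add: C1_field_def)
qed

lemma continuous_on_C1_field: "C1_field Z \<Longrightarrow> continuous_on M Z"
  by (rule continuous_from_charts) (simp add: C1_field_def C1_on_imp_continuous_on)

end

context chart
begin

lemma C1_fieldD: "C1_field Z \<Longrightarrow> C1_on U (\<lambda>x. Z (\<phi> x))"
  using param by (simp add: C1_field_def)

lemma decompose:
  assumes x: "x \<in> U"
  obtains c v where "X = c *\<^sub>R \<nu> (\<phi> x) + D x v"
proof -
  obtain c where "E x *v c = X" using cramer[OF det_E[OF x]] by blast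
  then show ?thesis using that by (simp add: E_mult[OF x]) blast
qed

lemma tangent_eq:
  assumes x: "x \<in> U"
  shows "tangent_space M (\<phi> x) = {X. \<nu> (\<phi> x) \<bullet> X = 0}"
proof (intro subset_antisym subsetI)
  fix X assume "X \<in> {X. \<nu> (\<phi> x) \<bullet> X = 0}"
  then obtain v where "X = D x v" using normal_complement[OF x, of X] by blast
  then show "X \<in> tangent_space M (\<phi> x)" using D_tangent[OF x] by simp
qed (use orth[OF in_M[OF x]] in simp)

abbreviation "D\<nu> x \<equiv> frechet_derivative (\<lambda>x. \<nu> (\<phi> x)) (at x)"
abbreviation "H x u v \<equiv> frechet_derivative (\<lambda>y. D y v) (at x) u"

lemma \<nu>_D\<nu>:
  assumes x: "x \<in> U"
  shows "\<nu> (\<phi> x) \<bullet> D\<nu> x v = 0"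
proof -
  have d: "((\<lambda>x. \<nu> (\<phi> x)) has_derivative D\<nu> x) (at x)" by (rule C1_on_frechet(1)[OF C1_\<nu>_chart x])
  have "\<nu> (\<phi> x) \<bullet> D\<nu> x v + D\<nu> x v \<bullet> \<nu> (\<phi> x) = 0"
    by (rule const_derivative[OF open_U x _ has_derivative_inner[OF d d]]) (simp add: unit' in_M)
  then show ?thesis by (simp add: inner_commute)
qed

lemma H_symmetric:
  assumes x: "x \<in> U"
  shows "H x u v \<bullet> w = H x v u \<bullet> w"
proof -
  have "H x v u \<bullet> w = H x u v \<bullet> w"
  proof (rule clairaut[OF open_U x, where g = "\<lambda>y. \<phi> y \<bullet> w" and G = "\<lambda>y u. D y u \<bullet> w"
        and Gu = "\<lambda>y v. H y v u \<bullet> w" and Gv = "\<lambda>y u. H y u v \<bullet> w" and u = u and v = v])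
    show "((\<lambda>y. \<phi> y \<bullet> w) has_derivative (\<lambda>u. D y u \<bullet> w)) (at y)" if "y \<in> U" for y
      by (intro has_derivative_inner_left deriv_\<phi> that)
    show "((\<lambda>y. D y u \<bullet> w) has_derivative (\<lambda>v. H y v u \<bullet> w)) (at y)"
      "((\<lambda>y. D y v \<bullet> w) has_derivative (\<lambda>u. H y u v \<bullet> w)) (at y)" if "y \<in> U" for y
      by (intro has_derivative_inner_left C1_on_frechet(1)[OF C1_D that])+
    show "continuous_on U (\<lambda>y. H y v u \<bullet> w)" "continuous_on U (\<lambda>y. H y u v \<bullet> w)"
      by (intro continuous_on_inner C1_on_frechet(2)[OF C1_D] continuous_on_const)+
  qed
  then show ?thesis ..
qed

lemma D\<nu>_D:
  assumes x: "x \<in> U"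
  shows "D\<nu> x u \<bullet> D x v = - (\<nu> (\<phi> x) \<bullet> H x u v)"
proof -
  have d: "((\<lambda>x. \<nu> (\<phi> x)) has_derivative D\<nu> x) (at x)" by (rule C1_on_frechet(1)[OF C1_\<nu>_chart x])
  have "\<nu> (\<phi> x) \<bullet> H x u v + D\<nu> x u \<bullet> D x v = 0"
    by (rule const_derivative[OF open_U x _ has_derivative_inner[OF d C1_on_frechet(1)[OF C1_D x]]]) (simp add: \<nu>_D)
  then show ?thesis by simp
qed

lemma W_D: "x \<in> U \<Longrightarrow> dmat \<nu> (\<phi> x) *v D x v = D\<nu> x v"
  by (rule dmat_D[OF _ C1_\<nu>_chart])

lemma W_\<nu>: "x \<in> U \<Longrightarrow> dmat \<nu> (\<phi> x) *v \<nu> (\<phi> x) = 0"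
  by (rule dmat_\<nu>[OF _ C1_\<nu>_chart])

text \<open>Differentiating the orthogonality of \<nu> and D v gives <D\<nu> u, D v> = - <\<nu>, H u
  v>, symmetric by Clairaut. In the normal direction both sides vanish, since D\<nu> is
  tangential.\<close>

lemma W_symmetric:
  assumes x: "x \<in> U"
  shows "transpose (dmat \<nu> (\<phi> x)) = dmat \<nu> (\<phi> x)"
proof (rule symmetric_matrixI)
  fix X Y
  obtain a u where X: "X = a *\<^sub>R \<nu> (\<phi> x) + D x u" using decompose[OF x] by metis
  obtain b v where Y: "Y = b *\<^sub>R \<nu> (\<phi> x) + D x v" using decompose[OF x] by metis
  have "(dmat \<nu> (\<phi> x) *v X) \<bullet> Y = D\<nu> x u \<bullet> D x v"
    unfolding X Y using \<nu>_D\<nu>[OF x, of u]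
    by (simp add: matrix_vector_right_distrib matrix_vector_mult_scaleR W_D[OF x] W_\<nu>[OF x] inner_add_right inner_commute)
  also have "\<dots> = D\<nu> x v \<bullet> D x u"
    using H_symmetric[OF x, of u v "\<nu> (\<phi> x)"] unfolding D\<nu>_D[OF x] by (simp add: inner_commute)
  also have "\<dots> = X \<bullet> (dmat \<nu> (\<phi> x) *v Y)"
    unfolding X Y using \<nu>_D\<nu>[OF x, of v]
    by (simp add: matrix_vector_right_distrib matrix_vector_mult_scaleR W_D[OF x] W_\<nu>[OF x] inner_add_left inner_add_right inner_commute)
  finally show "(dmat \<nu> (\<phi> x) *v X) \<bullet> Y = X \<bullet> (dmat \<nu> (\<phi> x) *v Y)" .
qed

end

locale chart_function = chart +
  fixes f :: "'a ambient \<Rightarrow> real"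
  assumes C2: "C2_function M f"
begin

abbreviation "V \<equiv> gradient M f"
abbreviation "F x \<equiv> frechet_derivative (\<lambda>x. f (\<phi> x)) (at x)"

lemma Ck_f: "Ck_on 2 U (\<lambda>x. f (\<phi> x))"
  using C2 param by (auto simp: C2_function_def o_def)

lemma C1_F: "C1_on U (\<lambda>x. F x v)"
  using Ck_f unfolding numeral_2_eq_2 Ck_on.simps(2)[of "Suc 0"] Ck_on_1 by blast

lemma deriv_f: "x \<in> U \<Longrightarrow> ((\<lambda>x. f (\<phi> x)) has_derivative F x) (at x)"
  using Ck_f unfolding numeral_2_eq_2 Ck_on.simps(2)[of "Suc 0"] by (simp add: frechet_derivative_works)

lemma deriv_along_f:
  assumes x: "x \<in> U"
  shows "linear (deriv_along M f (\<phi> x))" "deriv_along M f (\<phi> x) (D x v) = F x v"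
proof -
  have 1: "(f has_derivative deriv_along M f (\<phi> x)) (at (\<phi> x) within M)"
    using differentiable_within[OF x deriv_f[OF x]]
    by (simp add: deriv_along_def[abs_def] frechet_derivative_works)
  then show "linear (deriv_along M f (\<phi> x))" by (rule has_derivative_linear)
  show "deriv_along M f (\<phi> x) (D x v) = F x v"
    using frechet_derivative_at[OF chain[OF x 1]] by metis
qed

lemma transpose_E_mult:
  "transpose (E x) *v w = (\<chi> c. case c of None \<Rightarrow> \<nu> (\<phi> x) \<bullet> w | Some i \<Rightarrow> D x (axis i 1) \<bullet> w)"
proof -
  have "(transpose (E x) *v w) $ c = (case c of None \<Rightarrow> \<nu> (\<phi> x) \<bullet> w | Some i \<Rightarrow> D x (axis i 1) \<bullet> w)" for c
    by (cases c) (simp_all add: matrix_vector_mult_def transpose_def E_def inner_vec_def del: transpose_matrix_vector)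
  then show ?thesis by (simp add: vec_eq_iff)
qed

text \<open>Orthogonality to \<nu> and the prescribed products with the D x e_i form a linear system
  with invertible matrix \<open>transpose (E x)\<close>; this gives existence for the definite
  description in \<open>gradient\<close>.\<close>

lemma gradient_properties:
  assumes x: "x \<in> U"
  shows "V (\<phi> x) \<in> tangent_space M (\<phi> x)"
    and "X \<in> tangent_space M (\<phi> x) \<Longrightarrow> deriv_along M f (\<phi> x) X = V (\<phi> x) \<bullet> X"
proof -
  let ?c = "\<chi> c. case c of None \<Rightarrow> 0 | Some i \<Rightarrow> F x (axis i 1)"
  have "det (transpose (E x)) \<noteq> 0" using det_E[OF x] by simp
  then obtain w where w: "transpose (E x) *v w = ?c" using cramer by blast
  have w0: "\<nu> (\<phi> x) \<bullet> w = 0"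
    using arg_cong[OF w, of "\<lambda>z. z $ None"] unfolding transpose_E_mult by simp
  have wi: "D x (axis i 1) \<bullet> w = F x (axis i 1)" for i
    using arg_cong[OF w, of "\<lambda>z. z $ Some i"] unfolding transpose_E_mult by simp
  have lF: "linear (F x)" by (rule has_derivative_linear[OF deriv_f[OF x]])
  have wD: "w \<bullet> D x v = F x v" for v
  proof -
    have ve: "(\<Sum>i\<in>UNIV. (v $ i) *\<^sub>R axis i 1) = v" by (simp add: basis_expansion flip: scalar_mult_eq_scaleR)
    have "F x (\<Sum>i\<in>UNIV. (v $ i) *\<^sub>R axis i 1) = (\<Sum>i\<in>UNIV. (v $ i) * F x (axis i 1))"
      by (simp add: linear_sum[OF lF] linear_cmul[OF lF])
    then have "F x v = (\<Sum>i\<in>UNIV. (v $ i) * F x (axis i 1))" unfolding ve .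
    then show ?thesis unfolding D_expand[OF x, of v]
      by (simp add: inner_sum_left inner_sum_right wi inner_commute[of w])
  qed
  let ?P = "\<lambda>v. v \<in> tangent_space M (\<phi> x) \<and> (\<forall>X\<in>tangent_space M (\<phi> x). deriv_along M f (\<phi> x) X = v \<bullet> X)"
  have P: "?P w"
  proof (intro conjI ballI)
    show "w \<in> tangent_space M (\<phi> x)" using w0 by (simp add: tangent_eq[OF x])
    fix X assume "X \<in> tangent_space M (\<phi> x)"
    then obtain v where "X = D x v" using normal_complement[OF x] tangent_eq[OF x] by blast
    then show "deriv_along M f (\<phi> x) X = w \<bullet> X" by (simp add: deriv_along_f[OF x] wD)
  qed
  have "?P (V (\<phi> x))"
    unfolding gradient_def
  proof (rule theI2[where P = ?P, OF P])
    fix z assume z: "?P z"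
    have "z - w \<in> tangent_space M (\<phi> x)" using z P by (simp add: tangent_eq[OF x] inner_diff_right)
    then have "(z - w) \<bullet> (z - w) = 0" using z P by (simp add: inner_diff_left)
    then show "z = w" by simp
  qed
  then show "V (\<phi> x) \<in> tangent_space M (\<phi> x)"
    and "X \<in> tangent_space M (\<phi> x) \<Longrightarrow> deriv_along M f (\<phi> x) X = V (\<phi> x) \<bullet> X"
    by blast+
qed

lemma V_\<nu>: "x \<in> U \<Longrightarrow> \<nu> (\<phi> x) \<bullet> V (\<phi> x) = 0"
  using gradient_properties(1) by (simp add: tangent_eq)

lemma V_D: "x \<in> U \<Longrightarrow> V (\<phi> x) \<bullet> D x v = F x v"
  using gradient_properties(2)[OF _ D_tangent] by (simp add: deriv_along_f)

lemma C1_V: "C1_on U (\<lambda>x. V (\<phi> x))"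
proof (rule C1_on_cramer[OF open_U, where E = "\<lambda>x. transpose (E x)" and c = "\<lambda>x. \<chi> c. case c of None \<Rightarrow> 0 | Some i \<Rightarrow> F x (axis i 1)"])
  show "C1_on U (\<lambda>x. transpose (E x) $ i $ j)" for i j
    by (cases i) (auto simp: transpose_def E_def intro: C1_on_component[OF C1_\<nu>_chart] C1_on_component[OF C1_D])
  show "C1_on U (\<lambda>x. (\<chi> c. case c of None \<Rightarrow> 0 | Some i \<Rightarrow> F x (axis i 1)) $ i)" for i
    by (cases i) (auto intro: C1_on_const C1_F)
  show "det (transpose (E x)) \<noteq> 0" if "x \<in> U" for x using det_E[OF that] by simp
  show "transpose (E x) *v V (\<phi> x) = (\<chi> c. case c of None \<Rightarrow> 0 | Some i \<Rightarrow> F x (axis i 1))" if x: "x \<in> U" for x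
    unfolding transpose_E_mult using V_\<nu>[OF x] V_D[OF x] by (simp add: vec_eq_iff inner_commute split: option.split)
qed

abbreviation "DV x \<equiv> frechet_derivative (\<lambda>x. V (\<phi> x)) (at x)"

text \<open>The Hessian as an ambient matrix. The derivative of the gradient has normal component -
  <W\<nabla>f, X>, as one sees by differentiating \<nu> \<bullet> \<nabla>f = 0, and the rank one
  term cancels it.\<close>

definition "A p = dmat V p + outer (\<nu> p) (dmat \<nu> p *v V p)"

lemma \<nu>_DV:
  assumes x: "x \<in> U"
  shows "\<nu> (\<phi> x) \<bullet> DV x u = - (V (\<phi> x) \<bullet> D\<nu> x u)"
proof -
  have "\<nu> (\<phi> x) \<bullet> DV x u + D\<nu> x u \<bullet> V (\<phi> x) = 0"
    by (rule const_derivative[OF open_U x _ has_derivative_inner[OF C1_on_frechet(1)[OF C1_\<nu>_chart x]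
        C1_on_frechet(1)[OF C1_V x]]]) (simp add: V_\<nu>)
  then show ?thesis by (simp add: inner_commute)
qed

lemma DV_D:
  assumes x: "x \<in> U"
  shows "DV x u \<bullet> D x v = frechet_derivative (\<lambda>y. F y v) (at x) u - V (\<phi> x) \<bullet> H x u v"
proof -
  have "V (\<phi> x) \<bullet> H x u v + DV x u \<bullet> D x v - frechet_derivative (\<lambda>y. F y v) (at x) u = 0"
    by (rule const_derivative[OF open_U x _ has_derivative_diff[OF has_derivative_inner[OF C1_on_frechet(1)[OF C1_V x]
        C1_on_frechet(1)[OF C1_D x]] C1_on_frechet(1)[OF C1_F x]]]) (simp add: V_D)
  then show ?thesis by simp
qed

lemma F_symmetric:
  assumes x: "x \<in> U"
  shows "frechet_derivative (\<lambda>y. F y v) (at x) u = frechet_derivative (\<lambda>y. F y u) (at x) v"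
  by (rule clairaut[OF open_U x deriv_f C1_on_frechet(1)[OF C1_F] C1_on_frechet(2)[OF C1_F]
      C1_on_frechet(1)[OF C1_F] C1_on_frechet(2)[OF C1_F]])

lemma A_D:
  assumes x: "x \<in> U"
  shows "A (\<phi> x) *v D x u = DV x u + (V (\<phi> x) \<bullet> D\<nu> x u) *\<^sub>R \<nu> (\<phi> x)"
  using matrix_self_adjoint[OF W_symmetric[OF x], of "V (\<phi> x)" "D x u"]
  by (simp add: A_def matrix_vector_mult_add_rdistrib outer_mult_vec dmat_D[OF x C1_V] W_D[OF x])

lemma A_\<nu>:
  assumes x: "x \<in> U"
  shows "A (\<phi> x) *v \<nu> (\<phi> x) = 0"
  using matrix_self_adjoint[OF W_symmetric[OF x], of "V (\<phi> x)" "\<nu> (\<phi> x)"]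
  by (simp add: A_def matrix_vector_mult_add_rdistrib outer_mult_vec dmat_\<nu>[OF x C1_V] W_\<nu>[OF x])

lemma \<nu>_A:
  assumes x: "x \<in> U"
  shows "\<nu> (\<phi> x) \<bullet> (A (\<phi> x) *v D x u) = 0"
  by (simp add: A_D[OF x] inner_add_right \<nu>_DV[OF x] unit' in_M x)

text \<open>On tangent vectors the form is the second derivative of f in the chart minus <\<nabla>f,
  H u v>. Clairaut applies to both terms, to f with its two continuous derivatives and to
  \<phi>.\<close>

lemma A_symmetric:
  assumes x: "x \<in> U"
  shows "transpose (A (\<phi> x)) = A (\<phi> x)"
proof (rule symmetric_matrixI)
  fix X Y
  obtain a u where X: "X = a *\<^sub>R \<nu> (\<phi> x) + D x u" using decompose[OF x] by metis
  obtain b v where Y: "Y = b *\<^sub>R \<nu> (\<phi> x) + D x v" using decompose[OF x] by metis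
  have e: "(A (\<phi> x) *v D x u) \<bullet> D x v = DV x u \<bullet> D x v" for u v
    by (simp add: A_D[OF x] inner_add_left \<nu>_D[OF x])
  have "(A (\<phi> x) *v X) \<bullet> Y = DV x u \<bullet> D x v"
    unfolding X Y using \<nu>_A[OF x, of u] e
    by (simp add: matrix_vector_right_distrib matrix_vector_mult_scaleR A_\<nu>[OF x] inner_add_right inner_commute[of _ "\<nu> (\<phi> x)"])
  also have "\<dots> = DV x v \<bullet> D x u"
    using H_symmetric[OF x, of u v "V (\<phi> x)"] F_symmetric[OF x, of u v]
    unfolding DV_D[OF x] by (simp add: inner_commute)
  also have "\<dots> = X \<bullet> (A (\<phi> x) *v Y)"
    unfolding X Y using \<nu>_A[OF x, of v] e
    by (simp add: matrix_vector_right_distrib matrix_vector_mult_scaleR A_\<nu>[OF x] inner_add_left inner_commute[of "D x u"])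
  finally show "(A (\<phi> x) *v X) \<bullet> Y = X \<bullet> (A (\<phi> x) *v Y)" .
qed

lemma hessian_eq:
  assumes x: "x \<in> U" and XY: "X \<in> tangent_space M (\<phi> x)" "Y \<in> tangent_space M (\<phi> x)"
  shows "hessian M f (\<phi> x) X Y = (A (\<phi> x) *v X) \<bullet> Y"
proof -
  let ?T = "tangent_space M (\<phi> x)"
  have sT: "subspace ?T" unfolding tangent_eq[OF x] by (auto simp: subspace_def inner_add_right)
  obtain v where v: "X = D x v" using normal_complement[OF x] XY tangent_eq[OF x] by blast
  have "hessian M f (\<phi> x) X Y = (\<Sum>e\<in>frame ?T. (deriv_along M V (\<phi> x) X \<bullet> e) * (e \<bullet> Y))"
    by (simp add: hessian_def levi_civita_def inner_sum_left)
  also have "\<dots> = deriv_along M V (\<phi> x) X \<bullet> (\<Sum>e\<in>frame ?T. (Y \<bullet> e) *\<^sub>R e)"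
    by (simp add: inner_sum_right inner_commute[of Y] mult.commute)
  also have "\<dots> = DV x v \<bullet> Y"
    unfolding frame_expand[OF sT XY(2)] by (simp add: v deriv_along_chart(2)[OF x C1_V])
  also have "\<dots> = (A (\<phi> x) *v X) \<bullet> Y"
    using XY(2) by (simp add: v A_D[OF x] inner_add_left tangent_eq[OF x])
  finally show ?thesis .
qed

lemma tangent_data_at:
  assumes x: "x \<in> U"
  shows "tangent_data (tangent_space M (\<phi> x)) (\<nu> (\<phi> x)) (dmat \<nu> (\<phi> x)) (second_fundamental_form M \<nu> (\<phi> x))"
proof
  fix X Y assume "X \<in> tangent_space M (\<phi> x)"
  then obtain v where v: "X = D x v" using normal_complement[OF x] tangent_eq[OF x] by blast
  show "second_fundamental_form M \<nu> (\<phi> x) X Y = (dmat \<nu> (\<phi> x) *v X) \<bullet> Y"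
    by (simp add: second_fundamental_form_def v deriv_along_chart(2)[OF x C1_\<nu>_chart] W_D[OF x])
qed (use x unit in_M tangent_eq W_symmetric W_\<nu> in auto)

lemma sigma_curv_eq:
  assumes x: "x \<in> U" and k: "k \<le> CARD('a option)"
  shows "sigma_curv k M \<nu> (\<phi> x) = msym k (dmat \<nu> (\<phi> x))"
proof -
  interpret tangent_data "tangent_space M (\<phi> x)" "\<nu> (\<phi> x)" "dmat \<nu> (\<phi> x)" "second_fundamental_form M \<nu> (\<phi> x)"
    by (rule tangent_data_at[OF x])
  show ?thesis
    using sigma_form_eq[OF k] by (simp add: sigma_form_def sigma_curv_def principal_curvatures_def weingarten_def)
qed

lemma tr_sigma_dot_hess_eq:
  assumes x: "x \<in> U" and k: "0 < k" "k \<le> CARD('a option)"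
  shows "tr_sigma_dot_hess k M \<nu> f (\<phi> x) = dco (dmat \<nu> (\<phi> x)) 0 (A (\<phi> x)) (k - 1) 0 1"
proof -
  let ?T = "tangent_space M (\<phi> x)"
  interpret tangent_data ?T "\<nu> (\<phi> x)" "dmat \<nu> (\<phi> x)" "second_fundamental_form M \<nu> (\<phi> x)"
    by (rule tangent_data_at[OF x])
  have "tr_sigma_dot_hess k M \<nu> f (\<phi> x) = (\<Sum>e\<in>frame ?T. \<Sum>e'\<in>frame ?T.
      sigma_dot k ?T (second_fundamental_form M \<nu> (\<phi> x)) e e' * ((A (\<phi> x) *v e) \<bullet> e'))"
    unfolding tr_sigma_dot_hess_def Let_def
  proof (intro sum.cong refl)
    fix e e' assume "e \<in> frame ?T" "e' \<in> frame ?T"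
    then have "e \<in> ?T" "e' \<in> ?T" using frame_properties(1)[OF sT] by auto
    then show "sigma_dot k ?T (second_fundamental_form M \<nu> (\<phi> x)) e e' * hessian M f (\<phi> x) e e' =
        sigma_dot k ?T (second_fundamental_form M \<nu> (\<phi> x)) e e' * ((A (\<phi> x) *v e) \<bullet> e')"
      by (simp add: hessian_eq[OF x])
  qed
  then show ?thesis
    unfolding sum_sigma_dot[OF k] matrix_frame_expand[OF A_symmetric[OF x] A_\<nu>[OF x]] .
qed

text \<open>Summation over the last frame vector reassembles the gradient, self-adjointness moves W
  onto it, and the remaining coefficients are those of a rank one matrix.\<close>

lemma weingarten_grad_eq:
  assumes x: "x \<in> U" and k: "0 < k" "k \<le> CARD('a option)"
  shows "weingarten_grad_sigma_dot k M \<nu> f (\<phi> x) =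
    dco (dmat \<nu> (\<phi> x)) 0 (outer (V (\<phi> x)) (dmat \<nu> (\<phi> x) *v V (\<phi> x))) (k - 1) 0 1"
proof -
  let ?T = "tangent_space M (\<phi> x)" and ?V = "V (\<phi> x)" and ?W = "dmat \<nu> (\<phi> x)"
  let ?h = "second_fundamental_form M \<nu> (\<phi> x)"
  interpret tangent_data ?T "\<nu> (\<phi> x)" ?W ?h by (rule tangent_data_at[OF x])
  have V: "?V \<in> ?T" by (rule gradient_properties(1)[OF x])
  have "weingarten_grad_sigma_dot k M \<nu> f (\<phi> x) =
      (\<Sum>e\<in>frame ?T. \<Sum>e'\<in>frame ?T. sigma_dot k ?T ?h e e' * ((?V \<bullet> e) * ((?W *v ?V) \<bullet> e')))"
    unfolding weingarten_grad_sigma_dot_def Let_def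
  proof (intro sum.cong refl)
    fix e e' assume "e \<in> frame ?T" "e' \<in> frame ?T"
    then have e: "e \<in> ?T" "e' \<in> ?T" using frame_properties(1)[OF sT] by auto
    have w: "weingarten M \<nu> (\<phi> x) e' = ?W *v e'" unfolding weingarten_def by (rule raise_index_eq[OF e(2)])
    have "(\<Sum>e''\<in>frame ?T. sigma_dot k ?T ?h e e' * (weingarten M \<nu> (\<phi> x) e' \<bullet> e'') *
        deriv_along M f (\<phi> x) e * deriv_along M f (\<phi> x) e'') =
      (\<Sum>e''\<in>frame ?T. sigma_dot k ?T ?h e e' * (?V \<bullet> e) * ((?W *v e') \<bullet> ((?V \<bullet> e'') *\<^sub>R e'')))"
    proof (intro sum.cong refl)
      fix e'' assume "e'' \<in> frame ?T"
      then have "e'' \<in> ?T" using frame_properties(1)[OF sT] by auto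
      then show "sigma_dot k ?T ?h e e' * (weingarten M \<nu> (\<phi> x) e' \<bullet> e'') *
        deriv_along M f (\<phi> x) e * deriv_along M f (\<phi> x) e'' =
        sigma_dot k ?T ?h e e' * (?V \<bullet> e) * ((?W *v e') \<bullet> ((?V \<bullet> e'') *\<^sub>R e''))"
        by (simp add: w gradient_properties(2)[OF x e(1)] gradient_properties(2)[OF x])
    qed
    also have "\<dots> = sigma_dot k ?T ?h e e' * (?V \<bullet> e) * ((?W *v e') \<bullet> ?V)"
      by (simp only: sum_distrib_left[symmetric] inner_sum_right[symmetric] frame_expand[OF sT V])
    also have "(?W *v e') \<bullet> ?V = (?W *v ?V) \<bullet> e'"
      using matrix_self_adjoint[OF W(1), of e' ?V] by (simp add: inner_commute)
    finally show "(\<Sum>e''\<in>frame ?T. sigma_dot k ?T ?h e e' * (weingarten M \<nu> (\<phi> x) e' \<bullet> e'') *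
        deriv_along M f (\<phi> x) e * deriv_along M f (\<phi> x) e'') =
      sigma_dot k ?T ?h e e' * ((?V \<bullet> e) * ((?W *v ?V) \<bullet> e'))"
      by (simp only: mult.assoc)
  qed
  also have "\<dots> = dco ?W 0 (\<Sum>e\<in>frame ?T. \<Sum>e'\<in>frame ?T. ((?V \<bullet> e) * ((?W *v ?V) \<bullet> e')) *\<^sub>R outer e e') (k - 1) 0 1"
    by (rule sum_sigma_dot[OF k])
  also have "(\<Sum>e\<in>frame ?T. \<Sum>e'\<in>frame ?T. ((?V \<bullet> e) * ((?W *v ?V) \<bullet> e')) *\<^sub>R outer e e') = outer ?V (?W *v ?V)"
  proof -
    have "outer (\<Sum>e\<in>frame ?T. (?V \<bullet> e) *\<^sub>R e) (\<Sum>e'\<in>frame ?T. ((?W *v ?V) \<bullet> e') *\<^sub>R e') =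
        (\<Sum>e\<in>frame ?T. \<Sum>e'\<in>frame ?T. ((?V \<bullet> e) * ((?W *v ?V) \<bullet> e')) *\<^sub>R outer e e')"
      by (simp add: vec_eq_iff outer_def sum_product mult_ac)
    then show ?thesis by (simp only: frame_expand[OF sT V] frame_expand[OF sT W_in_T])
  qed
  finally show ?thesis .
qed

end

section \<open>Integration over a hypersurface\<close>

lemma prod_option_UNIV: "(\<Prod>o'\<in>UNIV. f o') = f None * (\<Prod>i\<in>UNIV. f (Some (i::'n::finite)))"
proof -
  have "(\<Prod>o'\<in>UNIV. f o') = (\<Prod>o'\<in>insert None (range Some). f o')" by (simp only: UNIV_option_conv)
  then show ?thesis by (simp add: prod.reindex notin_range_Some)
qed

definition vec_cons :: "(real ^ ('n::finite)) \<times> real \<Rightarrow> real ^ 'n option"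
  where "vec_cons z = (\<chi> o'. case o' of None \<Rightarrow> snd z | Some i \<Rightarrow> fst z $ i)"

lemma continuous_vec_cons:
  fixes S :: "((real ^ ('n::finite)) \<times> real) set"
  shows "continuous_on S vec_cons"
proof -
  have "continuous_on S (\<lambda>z. case o' of None \<Rightarrow> snd z | Some i \<Rightarrow> fst z $ i)" for o' :: "'n option"
    by (cases o') (auto intro!: continuous_intros)
  then show ?thesis unfolding vec_cons_def by (intro continuous_on_vec_lambda)
qed

lemma lborel_vec_cons: "distr (lborel \<Otimes>\<^sub>M lborel) borel vec_cons = (lborel :: (real ^ ('n::finite) option) measure)"
proof (rule lborel_eqI[symmetric])
  have meas: "vec_cons \<in> (lborel \<Otimes>\<^sub>M lborel :: ((real ^ 'n) \<times> real) measure) \<rightarrow>\<^sub>M borel"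
    unfolding lborel_prod using borel_measurable_continuous_onI[OF continuous_vec_cons] by simp
  fix l u :: "real ^ 'n option" assume le: "\<And>b. b \<in> Basis \<Longrightarrow> l \<bullet> b \<le> u \<bullet> b"
  have le': "l $ o' \<le> u $ o'" for o' using le[of "axis o' 1"] by (auto simp: inner_axis Basis_vec_def)
  let ?l = "\<chi> i. l $ Some i" and ?u = "\<chi> i. u $ Some i"
  have "vec_cons -` box l u = box ?l ?u \<times> {l $ None<..<u $ None}"
    by (auto simp: mem_box_cart vec_cons_def split: option.splits)
  then have "emeasure (distr (lborel \<Otimes>\<^sub>M lborel) borel vec_cons) (box l u) =
      emeasure (lborel \<Otimes>\<^sub>M lborel) (box ?l ?u \<times> {l $ None<..<u $ None})"
    using meas by (subst emeasure_distr) (simp_all add: space_pair_measure)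
  also have "\<dots> = emeasure lborel (box ?l ?u) * emeasure lborel {l $ None<..<u $ None}"
    by (rule lborel.emeasure_pair_measure_Times) auto
  also have "emeasure lborel (box ?l ?u) = (\<Prod>b\<in>Basis. (?u - ?l) \<bullet> b)"
    by (rule emeasure_lborel_box) (use le' in \<open>auto simp: Basis_vec_def inner_axis\<close>)
  also have "emeasure lborel {l $ None<..<u $ None} = u $ None - l $ None" using le' by simp
  also have "ennreal (\<Prod>b\<in>Basis. (?u - ?l) \<bullet> b) * ennreal (u $ None - l $ None) = (\<Prod>b\<in>Basis. (u - l) \<bullet> b)"
    using le' by (simp add: prod_Basis_cart prod_option_UNIV ennreal_mult[symmetric] prod_nonneg mult.commute)
  finally show "emeasure (distr (lborel \<Otimes>\<^sub>M lborel) borel vec_cons) (box l u) = (\<Prod>b\<in>Basis. (u - l) \<bullet> b)" .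
qed simp

lemma fubini_vec_cons:
  fixes f :: "real ^ ('n::finite) option \<Rightarrow> real"
  assumes "integrable lborel f"
  shows "(\<integral>y. (\<integral>s. f (vec_cons (y, s)) \<partial>lborel) \<partial>lborel) = integral\<^sup>L lborel f"
proof -
  have meas: "vec_cons \<in> (lborel \<Otimes>\<^sub>M lborel :: ((real ^ 'n) \<times> real) measure) \<rightarrow>\<^sub>M borel"
    unfolding lborel_prod using borel_measurable_continuous_onI[OF continuous_vec_cons] by simp
  have i: "integrable (distr (lborel \<Otimes>\<^sub>M lborel) borel vec_cons) f" using assms by (simp add: lborel_vec_cons)
  have "integral\<^sup>L lborel f = integral\<^sup>L (distr (lborel \<Otimes>\<^sub>M lborel) borel vec_cons) f" by (simp add: lborel_vec_cons)
  also have "\<dots> = integral\<^sup>L (lborel \<Otimes>\<^sub>M lborel) (\<lambda>z. f (vec_cons z))"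
    by (rule integral_distr[OF meas]) (use assms in auto)
  also have "\<dots> = (\<integral>y. (\<integral>s. f (vec_cons (y, s)) \<partial>lborel) \<partial>lborel)"
    by (rule lborel_pair.integral_fst'[symmetric]) (rule integrable_distr[OF meas i])
  finally show ?thesis ..
qed

lemma Ck_on_subset: "Ck_on m U f \<Longrightarrow> V \<subseteq> U \<Longrightarrow> Ck_on m V f"
  by (induction m arbitrary: f) (auto intro: continuous_on_subset)

lemma local_param_subset:
  assumes "local_param M U \<phi>" "open V" "V \<subseteq> U"
  shows "local_param M V \<phi>"
proof -
  obtain \<psi> where hom: "homeomorphism U (\<phi> ` U) \<phi> \<psi>" using assms(1) by (auto simp: local_param_def)
  have "openin (top_of_set U) V" using assms(2,3) by (simp add: open_subset)
  then have "openin (top_of_set (\<phi> ` U)) (\<phi> ` V)" by (rule homeomorphism_imp_open_map[OF hom])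
  then have "openin (top_of_set M) (\<phi> ` V)"
    using assms(1) by (auto simp: local_param_def intro: openin_trans)
  moreover have "homeomorphism V (\<phi> ` V) \<phi> \<psi>"
    by (rule homeomorphism_of_subsets[OF hom assms(3) order.refl[of "\<phi> ` U"]]) simp
  ultimately show ?thesis
    using assms by (auto simp: local_param_def smooth_on_def intro: Ck_on_subset)
qed

context chart
begin

text \<open>Because \<nu> is a unit normal, the product of \<open>transpose (E x)\<close> and
  \<open>E x\<close> is block diagonal with blocks 1 and g. The area density is therefore the
  absolute Jacobian of the normal map.\<close>

lemma first_fundamental_det:
  assumes x: "x \<in> U"
  shows "sqrt (det (first_fundamental_matrix \<phi> x)) = \<bar>det (E x)\<bar>"
proof -
  let ?G = "transpose (E x) ** E x"
  have G: "?G $ a $ b = (\<Sum>r\<in>UNIV. E x $ r $ a * E x $ r $ b)" for a b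
    by (simp add: matrix_matrix_mult_def transpose_def)
  have "det ?G = det (\<chi> i j. ?G $ Some i $ Some j)"
  proof (rule det_option)
    show "?G $ None $ None = 1"
      unfolding G using unit'[OF in_M[OF x]] by (simp add: E_def inner_vec_def)
    show "?G $ Some i $ None = 0" for i
      unfolding G using \<nu>_D[OF x, of "axis i 1"] by (simp add: E_def inner_vec_def mult.commute)
  qed
  also have "(\<chi> i j. ?G $ Some i $ Some j) = first_fundamental_matrix \<phi> x"
    unfolding G by (simp add: E_def first_fundamental_matrix_def inner_vec_def vec_eq_iff)
  finally have "det (first_fundamental_matrix \<phi> x) = (det (E x))\<^sup>2" by (simp add: det_mul power2_eq_square)
  then show ?thesis by simp
qed

lemma borel_image: "\<phi> ` U \<in> sets borel"
proof -
  obtain O' where "open O'" "\<phi> ` U = M \<inter> O'" using openin_image by (auto simp: openin_open)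
  then show ?thesis using compact_M by (auto simp: borel_compact)
qed

end

section \<open>Area integrals in charts and finiteness of the area\<close>

locale measured_hypersurface = hypersurface +
  fixes \<mu> :: "'a ambient measure"
  assumes area: "area_measure M \<mu>"
begin

lemma sets_\<mu>: "sets \<mu> = sets (restrict_space borel M)"
  using area by (simp add: area_measure_def)

lemma space_\<mu>: "space \<mu> = M"
  using sets_eq_imp_space_eq[OF sets_\<mu>] by (simp add: space_restrict_space)

lemma emeasure_chart:
  assumes "local_param M U \<phi>" "A \<in> sets borel" "A \<subseteq> \<phi> ` U"
  shows "emeasure \<mu> A = (\<integral>\<^sup>+x\<in>{x\<in>U. \<phi> x \<in> A}. ennreal (sqrt (det (first_fundamental_matrix \<phi> x))) \<partial>lborel)"
  using area assms unfolding area_measure_def by blast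

text \<open>On the image of a chart \<mu> is the push-forward of |det E| dx: the two measures agree
  on Borel sets by \<open>area_measure\<close>, and integrals are transferred along this equality of
  measures.\<close>

lemma integral_chart:
  assumes "chart M \<nu> U \<phi>" and g: "g \<in> borel_measurable (restrict_space borel M)"
    and supp: "\<And>p. p \<in> M - \<phi> ` U \<Longrightarrow> g p = (0::real)"
  shows "(\<integral>p. g p \<partial>\<mu>) = (\<integral>x. indicator U x * (\<bar>det (chart.E \<nu> \<phi> x)\<bar> * g (\<phi> x)) \<partial>lborel)"
proof -
  interpret chart M \<nu> U \<phi> by fact
  let ?N = "\<phi> ` U" and ?J = "\<lambda>x. \<bar>det (E x)\<bar>"
  let ?L = "restrict_space lborel U"
  let ?\<mu>N = "restrict_space \<mu> ?N"
  let ?\<rho> = "distr (density ?L ?J) (restrict_space borel ?N) \<phi>"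
  have U: "U \<in> sets lborel" using open_U by simp
  have N: "?N \<in> sets borel" by (rule borel_image)
  have N\<mu>: "?N \<in> sets \<mu>"
    unfolding sets_\<mu> using N image_subset compact_M by (subst sets_restrict_space_iff) (auto simp: borel_compact)
  have cJ: "continuous_on U ?J" by (intro continuous_on_rabs continuous_on_det continuous_E)
  have mJ: "?J \<in> borel_measurable ?L"
    using borel_measurable_continuous_on_restrict[OF cJ] by (simp cong: measurable_cong_sets sets_restrict_space_cong)
  have m\<phi>b: "\<phi> \<in> ?L \<rightarrow>\<^sub>M borel"
    using borel_measurable_continuous_on_restrict[OF C1_on_imp_continuous_on[OF C1_\<phi>]]
    by (simp cong: measurable_cong_sets sets_restrict_space_cong)
  have m\<phi>: "\<phi> \<in> density ?L ?J \<rightarrow>\<^sub>M restrict_space borel ?N"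
    using m\<phi>b by (intro measurable_restrict_space2) (auto simp: space_restrict_space)
  have setsN: "sets ?\<mu>N = sets (restrict_space borel ?N)"
  proof -
    have "sets ?\<mu>N = sets (restrict_space (restrict_space borel M) ?N)" by (rule sets_restrict_space_cong[OF sets_\<mu>])
    also have "\<dots> = sets (restrict_space borel (M \<inter> ?N))" by (rule sets_restrict_restrict_space)
    finally show ?thesis using image_subset by (simp add: Int_absorb1)
  qed
  have eq: "?\<mu>N = ?\<rho>"
  proof (rule measure_eqI)
    show "sets ?\<mu>N = sets ?\<rho>" by (simp add: setsN)
    fix A assume "A \<in> sets ?\<mu>N"
    then have "A \<in> sets (restrict_space borel ?N)" by (simp add: setsN)
    then have A: "A \<in> sets borel" "A \<subseteq> ?N" using N by (auto simp: sets_restrict_space_iff)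
    let ?P = "{x \<in> U. \<phi> x \<in> A}"
    have P: "?P \<in> sets ?L"
    proof -
      have "?P = \<phi> -` A \<inter> space ?L" by (auto simp: space_restrict_space)
      then show ?thesis using measurable_sets[OF m\<phi>b A(1)] by simp
    qed
    have "emeasure ?\<mu>N A = emeasure \<mu> A"
      by (rule emeasure_restrict_space) (use N\<mu> A space_\<mu> image_subset in \<open>auto simp: Int_absorb2\<close>)
    also have "\<dots> = (\<integral>\<^sup>+x\<in>?P. ennreal (sqrt (det (first_fundamental_matrix \<phi> x))) \<partial>lborel)"
      by (rule emeasure_chart[OF param A])
    also have "\<dots> = (\<integral>\<^sup>+x. (ennreal (?J x) * indicator ?P x) * indicator U x \<partial>lborel)"
      by (intro nn_integral_cong) (auto simp: indicator_def first_fundamental_det)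
    also have "\<dots> = (\<integral>\<^sup>+x. ennreal (?J x) * indicator ?P x \<partial>?L)"
      by (rule nn_integral_restrict_space[symmetric]) (use U in simp)
    also have "\<dots> = emeasure (density ?L ?J) ?P"
      by (rule emeasure_density[symmetric]) (use mJ P in auto)
    also have "\<dots> = emeasure ?\<rho> A"
    proof -
      have "\<phi> -` A \<inter> space (density ?L ?J) = ?P" by (auto simp: space_restrict_space)
      then show ?thesis using A N by (subst emeasure_distr[OF m\<phi>]) (auto simp: sets_restrict_space_iff)
    qed
    finally show "emeasure ?\<mu>N A = emeasure ?\<rho> A" .
  qed
  have gN: "g \<in> borel_measurable (restrict_space borel ?N)"
  proof -
    have "g \<in> borel_measurable (restrict_space (restrict_space borel M) ?N)" using g by (rule measurable_restrict_space1)
    moreover have "sets (restrict_space (restrict_space borel M) ?N) = sets (restrict_space borel ?N)"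
      using image_subset by (simp add: sets_restrict_restrict_space Int_absorb1)
    ultimately show ?thesis by (simp cong: measurable_cong_sets)
  qed
  have "(\<integral>p. g p \<partial>\<mu>) = (\<integral>p. indicator ?N p *\<^sub>R g p \<partial>\<mu>)"
    by (rule Bochner_Integration.integral_cong) (use supp space_\<mu> in \<open>auto simp: indicator_def\<close>)
  also have "\<dots> = (\<integral>p. g p \<partial>?\<mu>N)"
    by (rule integral_restrict_space[symmetric]) (use N\<mu> space_\<mu> image_subset in \<open>auto simp: Int_absorb2\<close>)
  also have "\<dots> = (\<integral>x. g (\<phi> x) \<partial>density ?L ?J)"
    unfolding eq by (rule integral_distr[OF m\<phi> gN])
  also have "\<dots> = (\<integral>x. ?J x *\<^sub>R g (\<phi> x) \<partial>?L)"
  proof (rule integral_density[OF _ mJ])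
    show "(\<lambda>x. g (\<phi> x)) \<in> borel_measurable ?L"
      using measurable_compose[OF m\<phi> gN] by (simp cong: measurable_cong_sets)
  qed simp
  also have "\<dots> = (\<integral>x. indicator U x *\<^sub>R (?J x *\<^sub>R g (\<phi> x)) \<partial>lborel)"
    by (rule integral_restrict_space) (use U in simp)
  finally show ?thesis by simp
qed

lemma ball_chart:
  assumes "p \<in> M"
  obtains x R \<phi> where "chart M \<nu> (ball x R) \<phi>" "R > 0" "\<phi> x = p"
proof -
  obtain U \<phi> x where c: "chart M \<nu> U \<phi>" and x: "x \<in> U" "\<phi> x = p" using assms by (rule chart_at)
  then interpret chart M \<nu> U \<phi> by simp
  obtain R where R: "R > 0" "ball x R \<subseteq> U" using open_U x(1) open_contains_ball by blast
  have "local_param M (ball x R) \<phi>" by (rule local_param_subset[OF param _ R(2)]) simp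
  then have "chart M \<nu> (ball x R) \<phi>" using hypersurface_axioms by (simp add: chart_def chart_axioms_def)
  then show ?thesis using that R(1) x(2) by blast
qed

text \<open>By compactness finitely many images of closed half-radius balls cover M, and on each of
  these the area density is continuous on a compact set.\<close>

lemma finite_\<mu>: "finite_measure \<mu>"
proof
  have "\<forall>p\<in>M. \<exists>O'. open O' \<and> p \<in> O' \<and> (\<exists>K. M \<inter> O' \<subseteq> K \<and> K \<in> sets \<mu> \<and> emeasure \<mu> K < \<infinity>)"
  proof
    fix p assume "p \<in> M"
    then obtain x R \<phi> where c: "chart M \<nu> (ball x R) \<phi>" and R: "R > 0" "\<phi> x = p" by (rule ball_chart)
    interpret chart M \<nu> "ball x R" \<phi> by fact
    have "local_param M (ball x (R / 2)) \<phi>"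
      by (rule local_param_subset[OF param]) (use R in auto)
    then have "openin (top_of_set M) (\<phi> ` ball x (R / 2))" by (simp add: local_param_def)
    then obtain O' where O': "open O'" "\<phi> ` ball x (R / 2) = M \<inter> O'" by (auto simp: openin_open)
    let ?C = "cball x (R / 2)"
    have sub: "?C \<subseteq> ball x R" using R by auto
    have K: "compact (\<phi> ` ?C)"
      by (intro compact_continuous_image continuous_on_subset[OF C1_on_imp_continuous_on[OF C1_\<phi>] sub]) auto
    have KM: "\<phi> ` ?C \<subseteq> M" using image_subset sub by blast
    have "emeasure \<mu> (\<phi> ` ?C) = (\<integral>\<^sup>+y\<in>{y \<in> ball x R. \<phi> y \<in> \<phi> ` ?C}. ennreal (sqrt (det (first_fundamental_matrix \<phi> y))) \<partial>lborel)"
      by (rule emeasure_chart[OF param]) (use K sub in \<open>auto simp: borel_compact\<close>)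
    also have "{y \<in> ball x R. \<phi> y \<in> \<phi> ` ?C} = ?C"
    proof -
      obtain \<psi> where "homeomorphism (ball x R) (\<phi> ` ball x R) \<phi> \<psi>" using param by (auto simp: local_param_def)
      then have "inj_on \<phi> (ball x R)" by (metis homeomorphism_def inj_on_inverseI)
      then have "y \<in> ?C" if y: "y \<in> ball x R" "\<phi> y \<in> \<phi> ` ?C" for y
      proof -
        obtain z where z: "z \<in> ?C" "\<phi> y = \<phi> z" using y(2) by blast
        then have "y = z" using inj_onD[OF \<open>inj_on \<phi> (ball x R)\<close> z(2) y(1)] sub by blast
        with z show ?thesis by simp
      qed
      then show ?thesis using sub by blast
    qed
    also have "(\<integral>\<^sup>+y\<in>?C. ennreal (sqrt (det (first_fundamental_matrix \<phi> y))) \<partial>lborel) = (\<integral>\<^sup>+y. ennreal (indicator ?C y *\<^sub>R \<bar>det (E y)\<bar>) \<partial>lborel)"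
      by (intro nn_integral_cong) (use sub in \<open>auto simp: indicator_def first_fundamental_det\<close>)
    also have "\<dots> < \<infinity>"
    proof -
      have "set_integrable lborel ?C (\<lambda>y. \<bar>det (E y)\<bar>)"
        by (intro set_integrable_compact continuous_on_subset[OF _ sub] continuous_on_rabs continuous_on_det continuous_E) auto
      then show ?thesis
        unfolding set_integrable_def integrable_iff_bounded by simp
    qed
    finally have "emeasure \<mu> (\<phi> ` ?C) < \<infinity>" .
    moreover have "\<phi> ` ?C \<in> sets \<mu>"
      unfolding sets_\<mu> using K KM compact_M by (subst sets_restrict_space_iff) (auto simp: borel_compact)
    moreover have "M \<inter> O' \<subseteq> \<phi> ` ?C" unfolding O'(2)[symmetric] by (intro image_mono) auto
    moreover have "p \<in> O'"
    proof -
      have "\<phi> x \<in> \<phi> ` ball x (R / 2)" using R(1) by simp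
      then show ?thesis using O'(2) R(2) by auto
    qed
    ultimately show "\<exists>O'. open O' \<and> p \<in> O' \<and> (\<exists>K. M \<inter> O' \<subseteq> K \<and> K \<in> sets \<mu> \<and> emeasure \<mu> K < \<infinity>)"
      using O'(1) by blast
  qed
  then obtain Q where Q: "\<And>p. p \<in> M \<Longrightarrow> open (Q p)" "\<And>p. p \<in> M \<Longrightarrow> p \<in> Q p"
      "\<And>p. p \<in> M \<Longrightarrow> \<exists>K. M \<inter> Q p \<subseteq> K \<and> K \<in> sets \<mu> \<and> emeasure \<mu> K < \<infinity>"
    by metis
  obtain S where S: "S \<subseteq> M" "finite S" "M \<subseteq> (\<Union>p\<in>S. Q p)"
    using compactE_image[OF compact_M, of M Q] Q(1,2) by blast
  obtain K where K: "\<And>p. p \<in> S \<Longrightarrow> M \<inter> Q p \<subseteq> K p" "\<And>p. p \<in> S \<Longrightarrow> K p \<in> sets \<mu>"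
      "\<And>p. p \<in> S \<Longrightarrow> emeasure \<mu> (K p) < \<infinity>"
    using Q(3) S(1) by (metis subsetD)
  have "M \<subseteq> (\<Union>p\<in>S. K p)" using S(3) K(1) by blast
  moreover have "(\<Union>p\<in>S. K p) \<in> sets \<mu>" using S(2) K(2) by auto
  ultimately have "emeasure \<mu> M \<le> emeasure \<mu> (\<Union>p\<in>S. K p)" by (intro emeasure_mono)
  also have "\<dots> \<le> (\<Sum>p\<in>S. emeasure \<mu> (K p))"
    using S(2) K(2) by (intro emeasure_subadditive_finite) auto
  also have "\<dots> < \<infinity>" using K(3) S(2) by (simp add: ennreal_sum_less_top)
  finally show "emeasure \<mu> (space \<mu>) \<noteq> \<infinity>" by (simp add: space_\<mu>)
qed

lemma measurable_continuous: "continuous_on M g \<Longrightarrow> g \<in> borel_measurable (restrict_space borel M)"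
  by (rule borel_measurable_continuous_on_restrict)

lemma integrable_continuous:
  fixes g :: "'a ambient \<Rightarrow> real"
  assumes "continuous_on M g"
  shows "integrable \<mu> g"
proof -
  have "compact (g ` M)" by (rule compact_continuous_image[OF assms compact_M])
  then obtain B where "\<And>p. p \<in> M \<Longrightarrow> norm (g p) \<le> B"
    using compact_imp_bounded bounded_iff by (metis image_eqI)
  moreover have "g \<in> borel_measurable \<mu>"
    using measurable_continuous[OF assms] by (simp cong: measurable_cong_sets[OF sets_\<mu> refl])
  ultimately show ?thesis
    by (intro finite_measure.integrable_const_bound[OF finite_\<mu>, of g B]) (auto simp: space_\<mu>)
qed

end

section \<open>Compactly supported variations\<close>

lemma C1_on_open_Un:
  assumes "open A" "open B" "C1_on A g" "C1_on B g"
  shows "C1_on (A \<union> B) g"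
proof (rule C1_onI[where g' = "\<lambda>x. frechet_derivative g (at x)"])
  show "(g has_derivative frechet_derivative g (at x)) (at x)" if "x \<in> A \<union> B" for x
    using that C1_on_frechet(1)[OF assms(3)] C1_on_frechet(1)[OF assms(4)] by blast
  show "continuous_on (A \<union> B) (\<lambda>x. frechet_derivative g (at x) v)" for v
    by (intro continuous_on_open_Un assms C1_on_frechet(2))
qed

text \<open>The extension is C^1 on the open sets U and - C, which cover the space.\<close>

lemma C1_on_extend:
  assumes "open U" "closed C" "C \<subseteq> U" "C1_on U g" "\<And>x. x \<in> U - C \<Longrightarrow> g x = 0"
  shows "C1_on UNIV (\<lambda>x. if x \<in> U then g x else 0)"
proof -
  let ?g = "\<lambda>x. if x \<in> U then g x else 0"
  have "C1_on U ?g" by (rule C1_on_cong[OF assms(1) _ assms(4)]) simp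
  moreover have "C1_on (- C) ?g"
    by (rule C1_on_cong[OF _ _ C1_on_const[of _ 0]]) (use assms in auto)
  ultimately have "C1_on (U \<union> - C) ?g" using assms by (intro C1_on_open_Un) auto
  moreover have "U \<union> - C = UNIV" using assms(3) by auto
  ultimately show ?thesis by simp
qed

lemma C1_on_compose_linear:
  assumes "bounded_linear L" "C1_on U g"
  shows "C1_on {z. L z \<in> U} (\<lambda>z. g (L z))"
proof -
  obtain g' where g': "\<And>x. x \<in> U \<Longrightarrow> (g has_derivative g' x) (at x)" "\<And>v. continuous_on U (\<lambda>x. g' x v)"
    using assms(2) by (rule C1_onE) blast
  show ?thesis
  proof (rule C1_onI[where g' = "\<lambda>z h. g' (L z) (L h)"])
    show "((\<lambda>z. g (L z)) has_derivative (\<lambda>h. g' (L z) (L h))) (at z)" if "z \<in> {z. L z \<in> U}" for z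
      using has_derivative_compose[OF bounded_linear_imp_has_derivative[OF assms(1)], of g "g' (L z)" z] g'(1) that
      by simp
    show "continuous_on {z. L z \<in> U} (\<lambda>z. g' (L z) (L h))" for h
      by (rule continuous_on_compose2[OF g'(2) linear_continuous_on[OF assms(1)]]) auto
  qed
qed

text \<open>An explicit C^1 function that is positive exactly on the positive half-line. It builds
  the cutoffs, the partition of unity and the weight on [-1, 1].\<close>

definition pos_sq :: "real \<Rightarrow> real"
  where "pos_sq t = (max 0 t)\<^sup>2"

lemma DERIV_pos_sq: "(pos_sq has_real_derivative 2 * max 0 t) (at t)"
proof -
  consider "t > 0" | "t < 0" | "t = 0" by linarith
  then show ?thesis
  proof cases
    case 1
    have "((\<lambda>t. t\<^sup>2) has_real_derivative 2 * t) (at t)" by (auto intro!: derivative_eq_intros)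
    then have "(pos_sq has_real_derivative 2 * t) (at t)"
      by (rule has_field_derivative_transform_within_open[of _ _ _ "{0<..}"]) (use 1 in \<open>auto simp: pos_sq_def max_def\<close>)
    with 1 show ?thesis by simp
  next
    case 2
    have "((\<lambda>t. 0) has_real_derivative 0) (at t)" by simp
    then have "(pos_sq has_real_derivative 0) (at t)"
      by (rule has_field_derivative_transform_within_open[of _ _ _ "{..<0}"]) (use 2 in \<open>auto simp: pos_sq_def max_def\<close>)
    with 2 show ?thesis by simp
  next
    case 3
    have "((\<lambda>h. (pos_sq (0 + h) - pos_sq 0) / h) \<longlongrightarrow> 0) (at 0)"
    proof (rule Lim_null_comparison)
      show "\<forall>\<^sub>F h in at 0. norm ((pos_sq (0 + h) - pos_sq 0) / h) \<le> \<bar>h\<bar>"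
        by (rule always_eventually) (auto simp: pos_sq_def max_def power2_eq_square)
      show "((\<lambda>h. \<bar>h\<bar>) \<longlongrightarrow> 0) (at (0::real))" by (rule tendsto_eq_intros | simp)+
    qed
    with 3 show ?thesis by (simp add: DERIV_def)
  qed
qed

lemma C1_on_pos_sq: "C1_on U g \<Longrightarrow> C1_on U (\<lambda>x. pos_sq (g x))"
  by (rule C1_on_real_compose[where h = pos_sq and h' = "\<lambda>t. 2 * max 0 t"])
     (auto intro!: DERIV_pos_sq continuous_intros)

lemma C1_on_diff:
  assumes "C1_on U f" "C1_on U g"
  shows "C1_on U (\<lambda>x. f x - g x)"
  using C1_on_add[OF assms(1) C1_on_bounded_linear[OF bounded_linear_minus[OF bounded_linear_ident] assms(2)]] by simp

lemma C1_on_ident: "C1_on U (\<lambda>x. x)"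
  by (rule C1_onI[where g' = "\<lambda>_ v. v"]) auto

text \<open>A quotient a / (a + b), where a is supported within radius R and b vanishes within
  radius r; as r < R, the two have no common zero.\<close>

lemma C1_bump:
  fixes c :: "'a::real_inner"
  assumes "0 < r" "r < R"
  shows "\<exists>\<beta> :: 'a \<Rightarrow> real. C1_on UNIV \<beta> \<and> (\<forall>y. dist c y \<le> r \<longrightarrow> \<beta> y = 1) \<and> (\<forall>y. R \<le> dist c y \<longrightarrow> \<beta> y = 0)"
proof -
  define q where "q y = (y - c) \<bullet> (y - c)" for y :: 'a
  define \<beta> where "\<beta> y = pos_sq (R\<^sup>2 - q y) * inverse (pos_sq (R\<^sup>2 - q y) + pos_sq (q y - r\<^sup>2))" for y
  have q: "q y = (dist c y)\<^sup>2" for y by (simp add: q_def dot_square_norm dist_norm norm_minus_commute)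
  have rR: "r\<^sup>2 < R\<^sup>2" using assms by (intro power_strict_mono) auto
  have C1q: "C1_on UNIV q" unfolding q_def by (intro C1_on_inner C1_on_diff C1_on_ident C1_on_const)
  have nz: "pos_sq (R\<^sup>2 - q y) + pos_sq (q y - r\<^sup>2) \<noteq> 0" for y
  proof -
    have "R\<^sup>2 - q y > 0 \<or> q y - r\<^sup>2 > 0" using rR by linarith
    then have "pos_sq (R\<^sup>2 - q y) > 0 \<or> pos_sq (q y - r\<^sup>2) > 0" by (auto simp: pos_sq_def)
    moreover have "pos_sq (R\<^sup>2 - q y) \<ge> 0" "pos_sq (q y - r\<^sup>2) \<ge> 0" by (auto simp: pos_sq_def)
    ultimately show ?thesis by linarith
  qed
  show ?thesis
  proof (intro exI[of _ \<beta>] conjI allI impI)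
    show "C1_on UNIV \<beta>"
      unfolding \<beta>_def by (intro C1_on_mult C1_on_inverse C1_on_add C1_on_pos_sq C1_on_diff C1_on_const C1q nz)
    show "\<beta> y = 1" if "dist c y \<le> r" for y
    proof -
      have "q y \<le> r\<^sup>2" unfolding q using that by (intro power_mono) auto
      then have "pos_sq (q y - r\<^sup>2) = 0" by (simp add: pos_sq_def)
      then show ?thesis using nz[of y] by (simp add: \<beta>_def)
    qed
    show "\<beta> y = 0" if "R \<le> dist c y" for y
    proof -
      have "R\<^sup>2 \<le> q y" unfolding q using that assms by (intro power_mono) auto
      then show ?thesis by (simp add: \<beta>_def pos_sq_def)
    qed
  qed
qed

lemma C1_on_matrix_frechet:
  fixes F :: "real ^ 'n \<Rightarrow> real ^ 'm"
  assumes "C1_on U F"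
  shows "continuous_on U (\<lambda>x. matrix (frechet_derivative F (at x)))"
proof (rule continuous_on_matrix)
  show "continuous_on U (\<lambda>x. matrix (frechet_derivative F (at x)) $ i $ j)" for i j
    using C1_on_frechet(2)[OF assms, of "axis j 1"] by (simp add: matrix_def continuous_on_component)
qed

lemma ddet_zero: "ddet B 0 = 0"
proof -
  have "det (\<chi> l. if l = i then 0 $ l else B $ l) = 0" for i
    by (rule det_zero_row(1)[of i]) (simp add: row_def vec_eq_iff)
  then show ?thesis by (simp add: ddet_def)
qed

definition vtl :: "real ^ ('n::finite) option \<Rightarrow> real ^ 'n"
  where "vtl z = (\<chi> i. z $ Some i)"

lemma bounded_linear_vtl: "bounded_linear vtl"
  unfolding linear_conv_bounded_linear[symmetric] by (intro linearI) (simp_all add: vtl_def vec_eq_iff)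

lemma vec_cons_simps [simp]: "vtl (vec_cons (y, s)) = y" "vec_cons (y, s) $ None = s"
  by (simp_all add: vtl_def vec_cons_def vec_eq_iff)

lemma norm_le_vtl: "norm z \<le> norm (vtl z) + \<bar>z $ None\<bar>"
proof -
  have "(norm z)\<^sup>2 = (z $ None)\<^sup>2 + (norm (vtl z))\<^sup>2"
    by (simp add: norm_vec_def L2_set_def sum_option_UNIV vtl_def sum_nonneg add_nonneg_nonneg)
  also have "\<dots> \<le> (norm (vtl z) + \<bar>z $ None\<bar>)\<^sup>2" by (simp add: power2_sum)
  finally show ?thesis by (rule power2_le_imp_le) simp
qed

lemma integral_double_sum:
  fixes f g :: "nat \<Rightarrow> 'b \<Rightarrow> real" and x y :: "nat \<Rightarrow> nat \<Rightarrow> real"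
  assumes "\<And>i. integrable L (f i)" "\<And>i. integrable L (g i)"
  shows "(\<integral>s. (\<Sum>i\<le>N. \<Sum>j\<le>N. x i j * f i s + y i j * g i s) \<partial>L) =
    (\<Sum>i\<le>N. \<Sum>j\<le>N. x i j * integral\<^sup>L L (f i) + y i j * integral\<^sup>L L (g i))"
  using assms by simp

text \<open>
  The map \<open>F\<close> is \<open>\<phi> + t V + s \<nu>\<close>, cut off; its variation \<open>w = a(s) Z\<close> does not change the integral of
  the Jacobian determinant.
\<close>

lemma (in measured_hypersurface) local_identity:
  assumes ch: "chart M \<nu> (ball x0 R) \<phi>" and R: "R > 0"
    and V: "C1_field V" and Z: "C1_field Z"
    and Zsupp: "\<And>y. y \<in> ball x0 R \<Longrightarrow> R / 4 \<le> dist x0 y \<Longrightarrow> Z (\<phi> y) = 0"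
    and Zout: "\<And>p. p \<in> M - \<phi> ` ball x0 R \<Longrightarrow> Z p = 0 \<and> dmat Z p = 0"
    and a: "\<And>s. (a has_real_derivative a' s) (at s)" "continuous_on UNIV a'" "\<And>s. 1 \<le> \<bar>s\<bar> \<Longrightarrow> a s = 0"
  defines "m \<equiv> \<lambda>i. \<integral>s. a s * s ^ i \<partial>lborel" and "m' \<equiv> \<lambda>i. \<integral>s. a' s * s ^ i \<partial>lborel"
  shows "(\<integral>p. (\<Sum>i\<le>CARD('a option). \<Sum>j\<le>CARD('a option).
      (m i * dco (dmat \<nu> p) (dmat V p) (dmat Z p) i j 1 + m' i * dco (dmat \<nu> p) (dmat V p) (outer (Z p) (\<nu> p)) i j 1) * t ^ j) \<partial>\<mu>) = 0"
proof -
  interpret chart M \<nu> "ball x0 R" \<phi> by (rule ch)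
  let ?U = "ball x0 R" and ?N = "CARD('a option)"
  let ?W = "dmat \<nu>" and ?DV = "dmat V" and ?DZ = "dmat Z"
  have C1s: "C1_on ?U (\<lambda>y. V (\<phi> y))" "C1_on ?U (\<lambda>y. Z (\<phi> y))" "C1_on ?U (\<lambda>y. \<nu> (\<phi> y))"
    using C1_fieldD V Z C1_\<nu>_chart by auto
  have r: "0 < R / 2" "R / 2 < 3 * R / 4" using R by auto
  \<comment> \<open>The radii are staggered. The variation w lives over the ball of radius R / 4 and
    |s| \<le> 1, while both cutoffs of F are 1 up to R / 2 and |s| \<le> 2; so F is the uncut map
    wherever the derivative of w is nonzero.\<close>
  obtain \<beta> :: "real ^ 'a \<Rightarrow> real" where \<beta>: "C1_on UNIV \<beta>" "\<And>y. dist x0 y \<le> R / 2 \<Longrightarrow> \<beta> y = 1" "\<And>y. 3 * R / 4 \<le> dist x0 y \<Longrightarrow> \<beta> y = 0"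
    using C1_bump[OF r, of x0] by metis
  obtain \<gamma> :: "real \<Rightarrow> real" where \<gamma>: "C1_on UNIV \<gamma>" "\<And>s::real. dist 0 s \<le> 2 \<Longrightarrow> \<gamma> s = 1" "\<And>s. 3 \<le> dist 0 s \<Longrightarrow> \<gamma> s = 0"
  proof -
    have "(0::real) < 2" "(2::real) < 3" by simp_all
    from C1_bump[OF this, of "0::real"] show ?thesis using that by metis
  qed
  define U' where "U' = {z :: 'a ambient. vtl z \<in> ?U}"
  have cv: "continuous_on UNIV (vtl :: 'a ambient \<Rightarrow> _)" by (rule linear_continuous_on[OF bounded_linear_vtl])
  have oU': "open U'"
    unfolding U'_def using open_vimage[OF open_ball cv, of x0 R] by (simp add: vimage_def)
  have clC: "closed {z :: 'a ambient. vtl z \<in> cball x0 r}" for r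
    using closed_vimage[OF closed_cball cv, of x0 r] by (simp add: vimage_def)
  note C1v = C1_on_compose_linear[OF bounded_linear_vtl, where U = ?U, folded U'_def]
  have C1n: "C1_on U' (\<lambda>z. g (z $ None))" if "C1_on UNIV g" for g :: "real \<Rightarrow> real"
    using C1_on_subset[OF C1_on_compose_linear[OF bounded_linear_vec_nth that, of None]] by simp
  define G where "G z = \<phi> (vtl z) + t *\<^sub>R V (\<phi> (vtl z)) + (z $ None) *\<^sub>R \<nu> (\<phi> (vtl z))" for z
  define F where "F z = (if z \<in> U' then (\<beta> (vtl z) * \<gamma> (z $ None)) *\<^sub>R G z else 0)" for z
  define w where "w z = (if z \<in> U' then a (z $ None) *\<^sub>R Z (\<phi> (vtl z)) else 0)" for z
  have C1G: "C1_on U' G"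
    unfolding G_def
    by (intro C1_on_add C1_on_scaleR C1_on_const C1v C1_\<phi> C1s C1n C1_on_ident)
  have C1a: "C1_on UNIV a"
    by (rule C1_onI[where g' = "\<lambda>s h. h * a' s"]) (use a in \<open>auto simp: has_field_derivative_def mult_commute_abs intro!: continuous_intros\<close>)
  have C1F: "C1_on UNIV F"
    unfolding F_def
  proof (rule C1_on_extend[OF oU' clC[of "3 * R / 4"]])
    show "C1_on U' (\<lambda>z. (\<beta> (vtl z) * \<gamma> (z $ None)) *\<^sub>R G z)"
      by (intro C1_on_scaleR C1_on_mult C1v C1n C1G \<gamma> C1_on_subset[OF \<beta>(1)]) auto
  qed (use R \<beta>(3) in \<open>auto simp: U'_def\<close>)
  have C1w: "C1_on UNIV w"
    unfolding w_def
  proof (rule C1_on_extend[OF oU' clC[of "R / 4"]])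
    show "C1_on U' (\<lambda>z. a (z $ None) *\<^sub>R Z (\<phi> (vtl z)))"
      by (intro C1_on_scaleR C1v[OF C1s(2)] C1n C1a)
  qed (use R Zsupp in \<open>auto simp: U'_def\<close>)
  let ?F' = "\<lambda>z. frechet_derivative F (at z)" and ?w' = "\<lambda>z. frechet_derivative w (at z)"
  define R0 where "R0 = norm x0 + R + 3"
  have far: "R0 < norm z \<Longrightarrow> 3 * R / 4 \<le> dist x0 (vtl z) \<or> 3 \<le> \<bar>z $ None\<bar>" for z :: "'a ambient"
  proof -
    assume "R0 < norm z"
    then have "norm x0 + R + 3 < norm (vtl z) + \<bar>z $ None\<bar>" using norm_le_vtl[of z] by (simp add: R0_def)
    moreover have "norm (vtl z) \<le> norm x0 + dist x0 (vtl z)"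
      using norm_triangle_ineq2[of "vtl z" x0] by (simp add: dist_norm norm_minus_commute)
    ultimately show ?thesis using R by linarith
  qed
  have null: "(\<integral>z. ddet (matrix (?F' z)) (matrix (?w' z)) \<partial>lborel) = 0"
  proof (rule null_lagrangian_ddet[where F = F and w = w and R = R0])
    show "(F has_derivative ?F' z) (at z)" "(w has_derivative ?w' z) (at z)" for z
      using C1_on_frechet(1)[OF C1F] C1_on_frechet(1)[OF C1w] by auto
    show "F z = 0" "w z = 0" if "R0 < norm z" for z
      using far[OF that] \<beta>(3)[of "vtl z"] \<gamma>(3)[of "z $ None"] Zsupp[of "vtl z"] a(3)[of "z $ None"] R
      by (auto simp: F_def w_def U'_def)
  qed (intro C1_on_matrix_frechet C1F C1w)+
  \<comment> \<open>The Jacobians of F and w are ambient matrices at p times the same frame matrix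
    E. After splitting off det E this is what remains; the term with \<open>a'\<close> comes from
    differentiating a(s) in s.\<close>
  define Q where "Q p s = ddet (mat 1 + s *\<^sub>R ?W p + t *\<^sub>R ?DV p) (a s *\<^sub>R ?DZ p + a' s *\<^sub>R outer (Z p) (\<nu> p))" for p s
  have a'0: "a' s = 0" if "1 < \<bar>s\<bar>" for s
  proof -
    have "open {s :: real. 1 < \<bar>s\<bar>}" by (intro open_Collect_less continuous_intros)
    then have "((\<lambda>_. 0) has_real_derivative a' s) (at s)"
      by (intro has_field_derivative_transform_within_open[OF a(1)[of s]]) (use that a(3) in auto)
    then show ?thesis by (rule DERIV_unique) simp
  qed
  have w'0: "?w' z = (\<lambda>_. 0)" if "R / 4 < dist x0 (vtl z) \<or> 1 < \<bar>z $ None\<bar>" for z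
  proof -
    let ?O = "{z :: 'a ambient. R / 4 < dist x0 (vtl z)} \<union> {z. 1 < \<bar>z $ None\<bar>}"
    have "open ?O"
      by (intro open_Un open_Collect_less continuous_intros cv)
    then have "((\<lambda>_. 0) has_derivative ?w' z) (at z)"
      by (intro has_derivative_transform_within_open[OF C1_on_frechet(1)[OF C1w]])
         (use that Zsupp a(3) in \<open>auto simp: w_def U'_def\<close>)
    then show ?thesis by (rule has_derivative_unique) simp
  qed
  have Dh: "E (vtl z) *v h = (h $ None) *\<^sub>R \<nu> (\<phi> (vtl z)) + D (vtl z) (vtl h)" if "z \<in> U'" for z h
    using E_mult[of "vtl z" h] that by (simp add: U'_def vtl_def)
  have point: "ddet (matrix (?F' z)) (matrix (?w' z)) = det (E (vtl z)) * Q (\<phi> (vtl z)) (z $ None)" if zU: "z \<in> U'" for z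
  proof -
    let ?y = "vtl z" and ?s = "z $ None"
    let ?p = "\<phi> ?y"
    have y: "?y \<in> ?U" using zU by (simp add: U'_def)
    have dv: "((\<lambda>z. g (vtl z)) has_derivative (\<lambda>h. g' (vtl h))) (at z)"
      if "(g has_derivative g') (at ?y)" for g :: "real ^ 'a \<Rightarrow> 'b::real_normed_vector" and g'
      using has_derivative_compose[OF bounded_linear_imp_has_derivative[OF bounded_linear_vtl] that] .
    have dn: "((\<lambda>z::'a ambient. z $ None) has_derivative (\<lambda>h. h $ None)) (at z)"
      by (rule bounded_linear_imp_has_derivative[OF bounded_linear_vec_nth])
    have da: "((\<lambda>z::'a ambient. a (z $ None)) has_derivative (\<lambda>h. h $ None * a' ?s)) (at z)"
      using has_derivative_compose[OF dn a(1)[unfolded has_field_derivative_def]] by (simp add: mult.commute)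
    have dZ: "((\<lambda>y. Z (\<phi> y)) has_derivative frechet_derivative (\<lambda>y. Z (\<phi> y)) (at ?y)) (at ?y)"
      by (rule C1_on_frechet(1)[OF C1s(2) y])
    have "((\<lambda>z. a (z $ None) *\<^sub>R Z (\<phi> (vtl z))) has_derivative
        (\<lambda>h. a ?s *\<^sub>R frechet_derivative (\<lambda>y. Z (\<phi> y)) (at ?y) (vtl h) + (h $ None * a' ?s) *\<^sub>R Z ?p)) (at z)"
      by (rule has_derivative_scaleR[OF da dv[OF dZ]])
    then have dw: "(w has_derivative
        (\<lambda>h. a ?s *\<^sub>R frechet_derivative (\<lambda>y. Z (\<phi> y)) (at ?y) (vtl h) + (h $ None * a' ?s) *\<^sub>R Z ?p)) (at z)"
      by (rule has_derivative_transform_within_open[OF _ oU' zU]) (simp add: w_def)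
    have w'h: "?w' z h = a ?s *\<^sub>R frechet_derivative (\<lambda>y. Z (\<phi> y)) (at ?y) (vtl h) + (h $ None * a' ?s) *\<^sub>R Z ?p" for h
      by (rule fun_cong[OF frechet_derivative_at[OF dw], of h, symmetric])
    have lw: "linear (?w' z)" using C1_on_frechet(1)[OF C1w] has_derivative_linear by blast
    have mw: "matrix (?w' z) = (a ?s *\<^sub>R ?DZ ?p + a' ?s *\<^sub>R outer (Z ?p) (\<nu> ?p)) ** E ?y"
    proof -
      have "(a ?s *\<^sub>R ?DZ ?p + a' ?s *\<^sub>R outer (Z ?p) (\<nu> ?p)) *v (E ?y *v h) = ?w' z h" for h
        unfolding Dh[OF zU] w'h
        by (simp add: matrix_vector_mult_add_rdistrib matrix_vector_right_distrib matrix_vector_mult_scaleR outer_mult_vec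
            dmat_\<nu>[OF y C1s(2)] dmat_D[OF y C1s(2)] inner_add_right \<nu>_D[OF y] unit'[OF in_M[OF y]] mult.commute
            flip: scaleR_matrix_vector_assoc)
      moreover have "matrix (?w' z) *v h = ?w' z h" for h using lw by (simp add: matrix_works)
      ultimately show ?thesis unfolding matrix_eq by (simp only: matrix_vector_mul_assoc[symmetric] simp_thms)
    qed
    show ?thesis
    proof (cases "dist x0 ?y < R / 2 \<and> \<bar>?s\<bar> < 2")
      case True
      let ?O = "{z \<in> U'. dist x0 (vtl z) < R / 2 \<and> \<bar>z $ None\<bar> < 2}"
      have oO: "open ?O"
      proof -
        have "?O = U' \<inter> ({z. dist x0 (vtl z) < R / 2} \<inter> {z. \<bar>z $ None\<bar> < 2})" by auto
        moreover have "open ({z :: 'a ambient. dist x0 (vtl z) < R / 2} \<inter> {z. \<bar>z $ None\<bar> < 2})"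
          by (intro open_Int open_Collect_less continuous_intros cv)
        ultimately show ?thesis using oU' by (simp add: open_Int)
      qed
      let ?f = "\<lambda>g. frechet_derivative (\<lambda>y. g (\<phi> y)) (at ?y)"
      have dV: "((\<lambda>y. V (\<phi> y)) has_derivative ?f V) (at ?y)" and dN: "((\<lambda>y. \<nu> (\<phi> y)) has_derivative ?f \<nu>) (at ?y)"
        by (rule C1_on_frechet(1)[OF C1s(1) y] C1_on_frechet(1)[OF C1s(3) y])+
      have "(G has_derivative (\<lambda>h. D ?y (vtl h) + t *\<^sub>R ?f V (vtl h) + (?s *\<^sub>R ?f \<nu> (vtl h) + h $ None *\<^sub>R \<nu> ?p))) (at z)"
        unfolding G_def
        by (intro has_derivative_add has_derivative_scaleR_right has_derivative_scaleR[OF dn dv[OF dN]] dv[OF dV] dv[OF deriv_\<phi>[OF y]])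
      then have dF: "(F has_derivative (\<lambda>h. D ?y (vtl h) + t *\<^sub>R ?f V (vtl h) + (?s *\<^sub>R ?f \<nu> (vtl h) + h $ None *\<^sub>R \<nu> ?p))) (at z)"
        by (rule has_derivative_transform_within_open[OF _ oO]) (use True zU \<beta>(2) \<gamma>(2) in \<open>auto simp: F_def\<close>)
      have F'h: "?F' z h = D ?y (vtl h) + t *\<^sub>R ?f V (vtl h) + (?s *\<^sub>R ?f \<nu> (vtl h) + h $ None *\<^sub>R \<nu> ?p)" for h
        by (rule fun_cong[OF frechet_derivative_at[OF dF], of h, symmetric])
      have lF: "linear (?F' z)" using C1_on_frechet(1)[OF C1F] has_derivative_linear by blast
      have mF: "matrix (?F' z) = (mat 1 + ?s *\<^sub>R ?W ?p + t *\<^sub>R ?DV ?p) ** E ?y"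
      proof -
        have "(mat 1 + ?s *\<^sub>R ?W ?p + t *\<^sub>R ?DV ?p) *v (E ?y *v h) = ?F' z h" for h
          unfolding Dh[OF zU] F'h
          by (simp add: matrix_vector_mult_add_rdistrib matrix_vector_right_distrib matrix_vector_mult_scaleR
              dmat_\<nu>[OF y C1s(1)] dmat_D[OF y C1s(1)] dmat_\<nu>[OF y C1s(3)] dmat_D[OF y C1s(3)] scaleR_add_right
              flip: scaleR_matrix_vector_assoc)
        moreover have "matrix (?F' z) *v h = ?F' z h" for h using lF by (simp add: matrix_works)
        ultimately show ?thesis unfolding matrix_eq by (simp only: matrix_vector_mul_assoc[symmetric] simp_thms)
      qed
      show ?thesis unfolding mF mw ddet_mult_right Q_def by (simp add: mult.commute)
    next
      \<comment> \<open>Here the derivative of w vanishes, hence the left side is 0. Its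
        factorization through E gives \<open>Q\<close> times det E = 0, and E is invertible.\<close>
      case False
      then have out: "R / 4 < dist x0 ?y \<or> 1 < \<bar>?s\<bar>" using R by auto
      have l0: "ddet (matrix (?F' z)) (matrix (?w' z)) = 0"
        unfolding w'0[OF out] matrix_zero_map by (rule ddet_zero)
      have "(a ?s *\<^sub>R ?DZ ?p + a' ?s *\<^sub>R outer (Z ?p) (\<nu> ?p)) ** E ?y = 0"
        using mw w'0[OF out] matrix_zero_map by metis
      then have "ddet (mat 1 + ?s *\<^sub>R ?W ?p + t *\<^sub>R ?DV ?p) (a ?s *\<^sub>R ?DZ ?p + a' ?s *\<^sub>R outer (Z ?p) (\<nu> ?p)) * det (E ?y) = 0"
        unfolding ddet_mult_right[symmetric] by (simp add: ddet_zero)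
      then show ?thesis using det_E[OF y] l0 by (simp add: Q_def)
    qed
  qed
  have out: "ddet (matrix (?F' z)) (matrix (?w' z)) = 0" if "z \<notin> U'" for z
  proof -
    have "R / 4 < dist x0 (vtl z)" using that R by (auto simp: U'_def)
    then show ?thesis using w'0[of z] by (simp add: matrix_zero_map ddet_zero)
  qed
  define h where "h p = (\<Sum>i\<le>?N. \<Sum>j\<le>?N.
      (m i * dco (?W p) (?DV p) (?DZ p) i j 1 + m' i * dco (?W p) (?DV p) (outer (Z p) (\<nu> p)) i j 1) * t ^ j)" for p
  have ca: "continuous_on UNIV a" by (rule C1_on_imp_continuous_on[OF C1a])
  have ia: "integrable lborel (\<lambda>s. a s * s ^ i)" "integrable lborel (\<lambda>s. a' s * s ^ i)" for i
    by (rule integrable_compact_support(1)[where R = 1];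
        use ca a a'0 in \<open>auto intro!: continuous_intros\<close>)+
  \<comment> \<open>Expanding Q in powers of s leaves only the moments of a and a' after integration
    over the normal variable.\<close>
  have Qint: "(\<integral>s. Q p s \<partial>lborel) = h p" for p
  proof -
    have "Q p s = (\<Sum>i\<le>?N. \<Sum>j\<le>?N. (dco (?W p) (?DV p) (?DZ p) i j 1 * t ^ j) * (a s * s ^ i) +
        (dco (?W p) (?DV p) (outer (Z p) (\<nu> p)) i j 1 * t ^ j) * (a' s * s ^ i))" for s
      unfolding Q_def dco_ddet[symmetric] dco_add dco_scaleR
      by (intro sum.cong refl) (simp add: algebra_simps)
    then have "(\<integral>s. Q p s \<partial>lborel) = (\<Sum>i\<le>?N. \<Sum>j\<le>?N. (dco (?W p) (?DV p) (?DZ p) i j 1 * t ^ j) * m i +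
        (dco (?W p) (?DV p) (outer (Z p) (\<nu> p)) i j 1 * t ^ j) * m' i)"
      unfolding m_def m'_def by (simp only: integral_double_sum[OF ia])
    also have "\<dots> = h p"
      unfolding h_def by (intro sum.cong refl) (simp add: algebra_simps)
    finally show ?thesis .
  qed
  have "integrable lborel (\<lambda>z. ddet (matrix (?F' z)) (matrix (?w' z)))"
  proof (rule integrable_compact_support(1))
    show "continuous_on UNIV (\<lambda>z. ddet (matrix (?F' z)) (matrix (?w' z)))"
      unfolding ddet_def
    proof (intro continuous_on_sum continuous_on_det continuous_on_vec_lambda)
      fix i l
      show "continuous_on UNIV (\<lambda>z. if l = i then matrix (?w' z) $ l else matrix (?F' z) $ l)"
        using C1_on_matrix_frechet[OF C1F] C1_on_matrix_frechet[OF C1w] by (cases "l = i") (auto intro: continuous_on_component)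
    qed
    fix z :: "'a ambient" assume "R0 < norm z"
    from far[OF this] have "R / 4 < dist x0 (vtl z) \<or> 1 < \<bar>z $ None\<bar>" using R by auto
    then show "ddet (matrix (?F' z)) (matrix (?w' z)) = 0" using w'0[of z] by (simp add: matrix_zero_map ddet_zero)
  qed
  from fubini_vec_cons[OF this] null
  have "(\<integral>y. (\<integral>s. ddet (matrix (?F' (vec_cons (y, s)))) (matrix (?w' (vec_cons (y, s)))) \<partial>lborel) \<partial>lborel) = 0" by simp
  moreover have "(\<integral>s. ddet (matrix (?F' (vec_cons (y, s)))) (matrix (?w' (vec_cons (y, s)))) \<partial>lborel) =
      indicator ?U y * (det (E y) * h (\<phi> y))" for y
  proof (cases "y \<in> ?U")
    case True
    then have "ddet (matrix (?F' (vec_cons (y, s)))) (matrix (?w' (vec_cons (y, s)))) = det (E y) * Q (\<phi> y) s" for s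
      using point[of "vec_cons (y, s)"] by (simp add: U'_def)
    with True show ?thesis by (simp add: Qint)
  next
    case False
    then show ?thesis using out[of "vec_cons (y, _)"] by (simp add: U'_def)
  qed
  ultimately have zero: "(\<integral>y. indicator ?U y * (det (E y) * h (\<phi> y)) \<partial>lborel) = 0" by simp
  \<comment> \<open>The null Lagrangian comes with det E, the area with |det E|. On a connected
    chart domain they differ by a constant sign; this is a reason for working with balls.\<close>
  obtain \<sigma> :: real where \<sigma>: "\<sigma> \<noteq> 0" "\<And>y. y \<in> ?U \<Longrightarrow> det (E y) = \<sigma> * \<bar>det (E y)\<bar>"
  proof -
    have c: "continuous_on ?U (\<lambda>y. det (E y))" by (intro continuous_on_det continuous_E)
    have "connected ((\<lambda>y. det (E y)) ` ?U)" by (rule connected_continuous_image[OF c connected_ball])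
    then have conn: "is_interval ((\<lambda>y. det (E y)) ` ?U)" by (simp add: is_interval_connected_1)
    have "(\<forall>y\<in>?U. det (E y) > 0) \<or> (\<forall>y\<in>?U. det (E y) < 0)"
    proof (rule ccontr)
      assume "\<not> ?thesis"
      then obtain y1 y2 where "y1 \<in> ?U" "det (E y1) \<le> 0" "y2 \<in> ?U" "det (E y2) \<ge> 0" by force
      then have "0 \<in> (\<lambda>y. det (E y)) ` ?U" using conn unfolding is_interval_1 by (meson imageI)
      then show False using det_E by auto
    qed
    then show ?thesis
    proof
      assume pos: "\<forall>y\<in>?U. det (E y) > 0"
      have "det (E y) = 1 * \<bar>det (E y)\<bar>" if "y \<in> ?U" for y using bspec[OF pos that] by simp
      then show ?thesis by (intro that[of 1]) simp_all
    next
      assume neg: "\<forall>y\<in>?U. det (E y) < 0"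
      have "det (E y) = (- 1) * \<bar>det (E y)\<bar>" if "y \<in> ?U" for y using bspec[OF neg that] by simp
      then show ?thesis by (intro that[of "- 1"]) simp_all
    qed
  qed
  have "continuous_on M h"
    unfolding h_def using continuous_on_dmat V Z C1_field_\<nu> continuous_on_C1_field[OF Z] cont_\<nu>
    by (intro continuous_intros continuous_on_dco)
       (auto intro!: continuous_on_matrix continuous_intros simp: outer_def)
  then have "(\<integral>p. h p \<partial>\<mu>) = (\<integral>y. indicator ?U y * (\<bar>det (E y)\<bar> * h (\<phi> y)) \<partial>lborel)"
  proof (intro integral_chart[OF ch] measurable_continuous)
    fix p assume "p \<in> M - \<phi> ` ?U"
    then have "Z p = 0" "?DZ p = 0" using Zout by auto
    moreover have "dco W A 0 i j 1 = 0" for W A :: "real ^ 'a option ^ 'a option" and i j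
      using linear_0[OF linear_dco] .
    ultimately show "h p = 0" by (simp add: h_def outer_zero del: One_nat_def)
  qed
  moreover have "\<sigma> * (\<integral>y. indicator ?U y * (\<bar>det (E y)\<bar> * h (\<phi> y)) \<partial>lborel) =
      (\<integral>y. indicator ?U y * (det (E y) * h (\<phi> y)) \<partial>lborel)"
    unfolding integral_mult_right_zero[symmetric]
  proof (rule Bochner_Integration.integral_cong[OF refl])
    fix y
    show "\<sigma> * (indicator ?U y * (\<bar>det (E y)\<bar> * h (\<phi> y))) = indicator ?U y * (det (E y) * h (\<phi> y))"
    proof (cases "y \<in> ?U")
      case True
      have "\<sigma> * (\<bar>det (E y)\<bar> * h (\<phi> y)) = det (E y) * h (\<phi> y)"
        unfolding mult.assoc[symmetric] \<sigma>(2)[OF True, symmetric] ..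
      with True show ?thesis by simp
    qed simp
  qed
  ultimately have "(\<integral>p. h p \<partial>\<mu>) = 0" using \<sigma>(1) zero by simp
  then show ?thesis by (simp only: h_def)
qed

section \<open>The integrated identity\<close>

context hypersurface
begin

lemma C1_fieldI:
  assumes "\<And>U \<phi>. chart M \<nu> U \<phi> \<Longrightarrow> C1_on U (\<lambda>y. Z (\<phi> y))"
  shows "C1_field Z"
  unfolding C1_field_def
proof (intro allI impI)
  fix U \<phi> assume "local_param M U \<phi>"
  then interpret chart M \<nu> U \<phi> by unfold_locales
  show "C1_on U (\<lambda>x. Z (\<phi> x))" by (rule assms) unfold_locales
qed

lemma dmat_sum:
  assumes Z: "\<And>i. i \<in> S \<Longrightarrow> C1_field (Z i)" and V: "C1_field V"
    and eq: "\<And>q. q \<in> M \<Longrightarrow> V q = (\<Sum>i\<in>S. Z i q)" and p: "p \<in> M"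
  shows "dmat V p = (\<Sum>i\<in>S. dmat (Z i) p)"
proof -
  obtain U \<phi> x where c: "chart M \<nu> U \<phi>" and x: "x \<in> U" "\<phi> x = p" using p by (rule chart_at)
  interpret chart M \<nu> U \<phi> by (rule c)
  have ZC: "C1_on U (\<lambda>y. Z i (\<phi> y))" if "i \<in> S" for i using C1_fieldD Z that by blast
  have VC: "C1_on U (\<lambda>y. V (\<phi> y))" using C1_fieldD V by blast
  let ?Zd = "\<lambda>i. frechet_derivative (\<lambda>y. Z i (\<phi> y)) (at x)"
  have "((\<lambda>y. \<Sum>i\<in>S. Z i (\<phi> y)) has_derivative (\<lambda>v. \<Sum>i\<in>S. ?Zd i v)) (at x)"
    by (rule has_derivative_sum) (rule C1_on_frechet(1)[OF ZC x(1)])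
  then have d: "((\<lambda>y. V (\<phi> y)) has_derivative (\<lambda>v. \<Sum>i\<in>S. ?Zd i v)) (at x)"
    by (rule has_derivative_transform_within_open[OF _ open_U x(1)]) (simp add: eq in_M)
  have "dmat V (\<phi> x) = (\<Sum>i\<in>S. dmat (Z i) (\<phi> x))"
  proof (rule matrix_eqI_chart[OF x(1)])
    show "dmat V (\<phi> x) *v \<nu> (\<phi> x) = (\<Sum>i\<in>S. dmat (Z i) (\<phi> x)) *v \<nu> (\<phi> x)"
      by (simp add: sum_matrix_vector_mult dmat_\<nu>[OF x(1)] VC ZC)
    show "dmat V (\<phi> x) *v D x v = (\<Sum>i\<in>S. dmat (Z i) (\<phi> x)) *v D x v" for v
      using fun_cong[OF frechet_derivative_at[OF d], of v]
      by (simp add: sum_matrix_vector_mult dmat_D[OF x(1)] VC ZC)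
  qed
  then show ?thesis by (simp add: x)
qed

lemma dmat_zero:
  assumes Z: "C1_field Z" and p: "p \<in> M" "open O'" "p \<in> O'" and z: "\<And>q. q \<in> M \<Longrightarrow> q \<in> O' \<Longrightarrow> Z q = 0"
  shows "dmat Z p = 0"
proof -
  obtain U \<phi> x where c: "chart M \<nu> U \<phi>" and x: "x \<in> U" "\<phi> x = p" using p(1) by (rule chart_at)
  interpret chart M \<nu> U \<phi> by (rule c)
  have ZC: "C1_on U (\<lambda>y. Z (\<phi> y))" using C1_fieldD Z by blast
  have o: "open (U \<inter> \<phi> -` O')"
    by (rule continuous_open_preimage[OF C1_on_imp_continuous_on[OF C1_\<phi>] open_U p(2)])
  have "frechet_derivative (\<lambda>y. Z (\<phi> y)) (at x) v = 0" for v
    by (rule const_derivative[OF o _ _ C1_on_frechet(1)[OF ZC x(1)]]) (use x p z in_M in auto)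
  then have "dmat Z (\<phi> x) = 0"
    by (intro matrix_eqI_chart[OF x(1)]) (simp_all add: dmat_\<nu>[OF x(1) ZC] dmat_D[OF x(1) ZC])
  then show ?thesis by (simp add: x)
qed

end

text \<open>\<open>local_identity\<close> is linear in the variation field Z, since Z enters with
  exponent one only, while the field V in the deformation stays fixed. Summing over Z p = (b p / B)
  V, with b p / B a partition of unity on M, puts V itself in the place of Z.\<close>

lemma (in measured_hypersurface) global_identity:
  assumes V: "C1_field V"
    and a: "\<And>s. (a has_real_derivative a' s) (at s)" "continuous_on UNIV a'" "\<And>s. 1 \<le> \<bar>s\<bar> \<Longrightarrow> a s = 0"
  defines "m \<equiv> \<lambda>i. \<integral>s. a s * s ^ i \<partial>lborel" and "m' \<equiv> \<lambda>i. \<integral>s. a' s * s ^ i \<partial>lborel"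
  shows "(\<integral>p. (\<Sum>i\<le>CARD('a option). \<Sum>j\<le>CARD('a option).
      (m i * dco (dmat \<nu> p) (dmat V p) (dmat V p) i j 1 + m' i * dco (dmat \<nu> p) (dmat V p) (outer (V p) (\<nu> p)) i j 1) * t ^ j) \<partial>\<mu>) = 0"
proof -
  \<comment> \<open>The part of M within \<delta> of p lies over the quarter ball. A bump supported
    there meets the support condition of \<open>local_identity\<close>.\<close>
  have "\<exists>x R \<phi> \<delta>. chart M \<nu> (ball x R) \<phi> \<and> R > 0 \<and> \<delta> > 0 \<and>
      (\<forall>q\<in>M. dist p q \<le> \<delta> \<longrightarrow> q \<in> \<phi> ` ball x (R / 4))" if p: "p \<in> M" for p
  proof -
    obtain x R \<phi> where c: "chart M \<nu> (ball x R) \<phi>" and R: "R > 0" "\<phi> x = p" using p by (rule ball_chart)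
    interpret chart M \<nu> "ball x R" \<phi> by (rule c)
    have "local_param M (ball x (R / 4)) \<phi>" by (rule local_param_subset[OF param]) (use R in auto)
    then have "openin (top_of_set M) (\<phi> ` ball x (R / 4))" by (simp add: local_param_def)
    then obtain O' where O': "open O'" "\<phi> ` ball x (R / 4) = M \<inter> O'" by (auto simp: openin_open)
    have "\<phi> x \<in> \<phi> ` ball x (R / 4)" using R(1) by simp
    then have "p \<in> O'" using O'(2) R(2) by auto
    then obtain \<delta> where \<delta>: "\<delta> > 0" "cball p \<delta> \<subseteq> O'" using O'(1) open_contains_cball by blast
    then have "\<forall>q\<in>M. dist p q \<le> \<delta> \<longrightarrow> q \<in> \<phi> ` ball x (R / 4)" using O'(2) by auto
    with c R(1) \<delta>(1) show ?thesis by blast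
  qed
  then obtain X R \<Phi> \<Delta> where ch: "\<And>p. p \<in> M \<Longrightarrow> chart M \<nu> (ball (X p) (R p)) (\<Phi> p)"
      and R: "\<And>p. p \<in> M \<Longrightarrow> R p > 0" and \<Delta>: "\<And>p. p \<in> M \<Longrightarrow> \<Delta> p > 0"
      and near: "\<And>p q. p \<in> M \<Longrightarrow> q \<in> M \<Longrightarrow> dist p q \<le> \<Delta> p \<Longrightarrow> q \<in> \<Phi> p ` ball (X p) (R p / 4)"
    by metis
  obtain S where S: "S \<subseteq> M" "finite S" "M \<subseteq> (\<Union>p\<in>S. ball p (\<Delta> p))"
  proof (rule compactE_image[OF compact_M, of M "\<lambda>p. ball p (\<Delta> p)"])
    show "M \<subseteq> (\<Union>p\<in>M. ball p (\<Delta> p))" using \<Delta> by force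
  qed (use that in auto)
  define b where "b p q = pos_sq ((\<Delta> p)\<^sup>2 - (q - p) \<bullet> (q - p))" for p q :: "'a ambient"
  define B where "B q = (\<Sum>p\<in>S. b p q)" for q
  have b0: "b p q = 0" if "\<Delta> p \<le> dist p q" "p \<in> M" for p q
  proof -
    have "(\<Delta> p)\<^sup>2 \<le> (dist p q)\<^sup>2" using that \<Delta>[of p] by (intro power_mono) auto
    then show ?thesis by (simp add: b_def pos_sq_def dot_square_norm dist_norm norm_minus_commute)
  qed
  have bpos: "b p q > 0" if "dist p q < \<Delta> p" for p q
  proof -
    have "(dist p q)\<^sup>2 < (\<Delta> p)\<^sup>2" using that by (intro power_strict_mono) auto
    then show ?thesis by (simp add: b_def pos_sq_def dot_square_norm dist_norm norm_minus_commute max_def)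
  qed
  have bnn: "b p q \<ge> 0" for p q by (simp add: b_def pos_sq_def)
  have Bpos: "B q > 0" if q: "q \<in> M" for q
  proof -
    obtain p where p: "p \<in> S" "dist p q < \<Delta> p" using subsetD[OF S(3) q] by auto
    then show ?thesis unfolding B_def using S(2) bnn bpos by (intro sum_pos2[of S p]) auto
  qed
  define Z where "Z p q = (b p q * inverse (B q)) *\<^sub>R V q" for p q
  have CZ: "C1_field (Z p)" for p
  proof (rule C1_fieldI)
    fix U \<phi> assume c: "chart M \<nu> U \<phi>"
    interpret chart M \<nu> U \<phi> by (rule c)
    have Cb: "C1_on U (\<lambda>y. b p (\<phi> y))" for p
      unfolding b_def by (intro C1_on_pos_sq C1_on_diff C1_on_const C1_on_inner C1_\<phi>)
    have "C1_on U (\<lambda>y. B (\<phi> y))" unfolding B_def by (intro C1_on_sum Cb)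
    moreover have "B (\<phi> y) \<noteq> 0" if "y \<in> U" for y using Bpos[OF in_M[OF that]] by simp
    ultimately have "C1_on U (\<lambda>y. inverse (B (\<phi> y)))" by (rule C1_on_inverse)
    moreover have "C1_on U (\<lambda>y. V (\<phi> y))" using C1_fieldD V by blast
    ultimately show "C1_on U (\<lambda>y. Z p (\<phi> y))"
      unfolding Z_def by (intro C1_on_scaleR C1_on_mult Cb)
  qed
  have sumZ: "V q = (\<Sum>p\<in>S. Z p q)" if "q \<in> M" for q
  proof -
    have "(\<Sum>p\<in>S. Z p q) = (B q * inverse (B q)) *\<^sub>R V q"
      by (simp add: Z_def B_def sum_distrib_right scaleR_sum_left)
    then show ?thesis using Bpos[OF that] by simp
  qed
  let ?N = "CARD('a option)" and ?W = "dmat \<nu>" and ?DV = "dmat V"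
  define h where "h N T p = (\<Sum>i\<le>N. \<Sum>j\<le>N.
      (m i * dco (?W p) (?DV p) (dmat T p) i j 1 + m' i * dco (?W p) (?DV p) (outer (T p) (\<nu> p)) i j 1) * t ^ j)"
    for N :: nat and T p
  have hZ: "(\<integral>q. h ?N (Z p) q \<partial>\<mu>) = 0" if p: "p \<in> S" for p
    unfolding h_def m_def m'_def
  proof (rule local_identity[OF ch R V CZ _ _ a])
    have pM: "p \<in> M" using p S(1) by blast
    then show "p \<in> M" "p \<in> M" by auto
    interpret chart M \<nu> "ball (X p) (R p)" "\<Phi> p" by (rule ch[OF pM])
    show "Z p (\<Phi> p y) = 0" if y: "y \<in> ball (X p) (R p)" "R p / 4 \<le> dist (X p) y" for y
    proof -
      have "\<Phi> p y \<notin> \<Phi> p ` ball (X p) (R p / 4)"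
      proof
        assume "\<Phi> p y \<in> \<Phi> p ` ball (X p) (R p / 4)"
        then obtain y' where y': "y' \<in> ball (X p) (R p / 4)" "\<Phi> p y = \<Phi> p y'" by blast
        obtain \<psi> where "homeomorphism (ball (X p) (R p)) (\<Phi> p ` ball (X p) (R p)) (\<Phi> p) \<psi>"
          using param by (auto simp: local_param_def)
        then have inj: "inj_on (\<Phi> p) (ball (X p) (R p))"
          by (intro inj_on_inverseI[of _ \<psi>]) (simp add: homeomorphism_def)
        have "y' \<in> ball (X p) (R p)" using y'(1) R[OF pM] by auto
        then have "y = y'" using inj_onD[OF inj y'(2) y(1)] by blast
        with y(2) y'(1) show False by simp
      qed
      then have "\<not> dist p (\<Phi> p y) \<le> \<Delta> p" using near[OF pM in_M[OF y(1)]] by blast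
      then show ?thesis using b0[of p "\<Phi> p y"] pM by (simp add: Z_def)
    qed
    show "Z p q = 0 \<and> dmat (Z p) q = 0" if q: "q \<in> M - \<Phi> p ` ball (X p) (R p)" for q
    proof -
      have "ball (X p) (R p / 4) \<subseteq> ball (X p) (R p)" using R[OF pM] by auto
      then have "\<not> dist p q \<le> \<Delta> p" using near[OF pM, of q] q by blast
      then have far: "\<Delta> p < dist p q" by simp
      have zero: "Z p q' = 0" if "\<Delta> p < dist p q'" for q' using b0[of p q'] that pM by (simp add: Z_def)
      have "dmat (Z p) q = 0"
        by (rule dmat_zero[OF CZ, of q "{q'. \<Delta> p < dist p q'}"])
           (use q far zero in \<open>auto intro!: open_Collect_less continuous_intros\<close>)
      with zero far show ?thesis by blast
    qed
  qed
  have cont: "continuous_on M (h N T)" if T: "C1_field T" for N T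
    unfolding h_def using continuous_on_dmat V T C1_field_\<nu> continuous_on_C1_field[OF T] cont_\<nu>
    by (intro continuous_intros continuous_on_dco)
       (auto intro!: continuous_on_matrix continuous_intros simp: outer_def)
  have hV: "h N V q = (\<Sum>p\<in>S. h N (Z p) q)" if q: "q \<in> M" for N q
  proof -
    have d: "?DV q = (\<Sum>p\<in>S. dmat (Z p) q)" by (rule dmat_sum[OF CZ V sumZ q])
    have o: "outer (V q) (\<nu> q) = (\<Sum>p\<in>S. outer (Z p q) (\<nu> q))"
      unfolding sumZ[OF q] by (simp add: outer_def vec_eq_iff sum_distrib_right)
    have "dco (?W q) (?DV q) (\<Sum>p\<in>S. dmat (Z p) q) i j 1 = (\<Sum>p\<in>S. dco (?W q) (?DV q) (dmat (Z p) q) i j 1)" for i j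
      by (rule linear_sum[OF linear_dco])
    then have "dco (?W q) (?DV q) (?DV q) i j 1 = (\<Sum>p\<in>S. dco (?W q) (?DV q) (dmat (Z p) q) i j 1)" for i j
      unfolding d[symmetric] .
    moreover have "dco (?W q) (?DV q) (outer (V q) (\<nu> q)) i j 1 = (\<Sum>p\<in>S. dco (?W q) (?DV q) (outer (Z p q) (\<nu> q)) i j 1)" for i j
      unfolding o by (rule linear_sum[OF linear_dco])
    ultimately have "h N V q = (\<Sum>i\<le>N. \<Sum>j\<le>N. \<Sum>p\<in>S.
        (m i * dco (?W q) (?DV q) (dmat (Z p) q) i j 1 + m' i * dco (?W q) (?DV q) (outer (Z p q) (\<nu> q)) i j 1) * t ^ j)"
      unfolding h_def by (simp only: sum_distrib_left sum_distrib_right sum.distrib distrib_right)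
    also have "\<dots> = (\<Sum>i\<le>N. \<Sum>p\<in>S. \<Sum>j\<le>N.
        (m i * dco (?W q) (?DV q) (dmat (Z p) q) i j 1 + m' i * dco (?W q) (?DV q) (outer (Z p q) (\<nu> q)) i j 1) * t ^ j)"
      by (intro sum.cong refl sum.swap)
    also have "\<dots> = (\<Sum>p\<in>S. h N (Z p) q)" unfolding h_def by (rule sum.swap)
    finally show ?thesis .
  qed
  have "(\<integral>q. h ?N V q \<partial>\<mu>) = (\<integral>q. (\<Sum>p\<in>S. h ?N (Z p) q) \<partial>\<mu>)"
    by (rule Bochner_Integration.integral_cong) (simp_all add: space_\<mu> hV del: card_option)
  also have "\<dots> = (\<Sum>p\<in>S. \<integral>q. h ?N (Z p) q \<partial>\<mu>)"
    by (rule Bochner_Integration.integral_sum) (intro integrable_continuous cont CZ)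
  also have "\<dots> = 0" by (rule sum.neutral) (use hZ in blast)
  finally show ?thesis unfolding h_def .
qed

text \<open>The fundamental theorem of calculus for a(s) s^i on [-1, 1], where a vanishes at both
  ends. For i = 0 the truncated exponent \<open>i - 1\<close> is harmless because of the factor
  \<open>real i\<close>.\<close>

lemma integral_moment_by_parts:
  fixes a a' :: "real \<Rightarrow> real"
  assumes a: "\<And>s. (a has_real_derivative a' s) (at s)" "continuous_on UNIV a'" "\<And>s. 1 \<le> \<bar>s\<bar> \<Longrightarrow> a s = 0"
  shows "(\<integral>s. a' s * s ^ i \<partial>lborel) = - real i * (\<integral>s. a s * s ^ (i - 1) \<partial>lborel)"
proof -
  have ca: "continuous_on UNIV a" using a(1) by (meson DERIV_isCont continuous_at_imp_continuous_on)
  have a'0: "a' s = 0" if "1 < \<bar>s\<bar>" for s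
  proof -
    have "open {s :: real. 1 < \<bar>s\<bar>}" by (intro open_Collect_less continuous_intros)
    then have "((\<lambda>_. 0) has_real_derivative a' s) (at s)"
      by (intro has_field_derivative_transform_within_open[OF a(1)[of s]]) (use that a(3) in auto)
    then show ?thesis by (rule DERIV_unique) simp
  qed
  let ?f = "\<lambda>s. a' s * s ^ i + real i * (a s * s ^ (i - 1))"
  have i1: "integrable lborel (\<lambda>s. a' s * s ^ i)" "integrable lborel (\<lambda>s. a s * s ^ (i - 1))"
    by (rule integrable_compact_support(1)[where R = 1]; use ca a a'0 in \<open>auto intro!: continuous_intros\<close>)+
  have "integral\<^sup>L lborel ?f = integral (cball 0 1) ?f"
    by (rule integrable_compact_support(2)) (use ca a a'0 in \<open>auto intro!: continuous_intros\<close>)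
  also have "\<dots> = 0"
  proof -
    have "(?f has_integral (a 1 * 1 ^ i - a (- 1) * (- 1) ^ i)) {- 1..1}"
    proof (rule fundamental_theorem_of_calculus)
      fix s :: real
      have "((\<lambda>s. a s * s ^ i) has_real_derivative ?f s) (at s)"
        by (auto intro!: derivative_eq_intros a(1) simp: mult_ac)
      then show "((\<lambda>s. a s * s ^ i) has_vector_derivative ?f s) (at s within {- 1..1})"
        by (simp add: has_real_derivative_iff_has_vector_derivative has_vector_derivative_at_within)
    qed simp
    then show ?thesis using a(3)[of 1] a(3)[of "- 1"] by (simp add: cball_eq_atLeastAtMost integral_unique)
  qed
  finally show ?thesis using i1 by simp
qed

lemma sum_shift_index:
  fixes g x :: "nat \<Rightarrow> real"
  assumes "x (Suc N) = 0"
  shows "(\<Sum>i\<le>N. real i * g (i - 1) * x i) = (\<Sum>i\<le>N. real (Suc i) * g i * x (Suc i))"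
proof -
  have "(\<Sum>i\<le>N. real i * g (i - 1) * x i) = (\<Sum>i\<le>Suc N. real i * g (i - 1) * x i)" using assms by simp
  also have "\<dots> = (\<Sum>i\<le>N. real (Suc i) * g i * x (Suc i))" by (subst sum.atMost_Suc_shift) simp
  finally show ?thesis .
qed

text \<open>The hypothesis says that the integral of \<rho> P^2 is zero, with P = \<Sum> G_j s^j and
  \<rho> the weight. As \<rho> > 0 on (-1, 1), P vanishes there and has infinitely many
  roots.\<close>

lemma weighted_moments_zero:
  fixes G :: "nat \<Rightarrow> real"
  assumes "(\<Sum>i\<le>N. G i * (\<integral>s. (pos_sq (1 - s\<^sup>2) * (\<Sum>j\<le>N. G j * s ^ j)) * s ^ i \<partial>lborel)) = 0" "i \<le> N"
  shows "G i = 0"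
proof -
  let ?P = "\<lambda>s::real. \<Sum>j\<le>N. G j * s ^ j"
  let ?\<rho> = "\<lambda>s::real. pos_sq (1 - s\<^sup>2)"
  have c\<rho>: "continuous_on UNIV ?\<rho>" unfolding pos_sq_def by (intro continuous_intros)
  have \<rho>0: "?\<rho> s = 0" if "1 < norm s" for s
  proof -
    have "1 < s\<^sup>2" using that by (simp add: abs_square_less_1[symmetric] not_less[symmetric]) (simp add: abs_square_le_1 not_le[symmetric])
    then show ?thesis by (simp add: pos_sq_def)
  qed
  have ii: "integrable lborel (\<lambda>s. (?\<rho> s * ?P s) * s ^ i)" for i
    by (rule integrable_compact_support(1)[where R = 1]) (use \<rho>0 in \<open>auto intro!: continuous_intros c\<rho>\<close>)
  have "(\<integral>s. ?\<rho> s * (?P s)\<^sup>2 \<partial>lborel) = (\<integral>s. (\<Sum>i\<le>N. G i * ((?\<rho> s * ?P s) * s ^ i)) \<partial>lborel)"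
    by (intro Bochner_Integration.integral_cong refl)
       (simp add: power2_eq_square sum_distrib_left sum_distrib_right mult_ac)
  also have "\<dots> = (\<Sum>i\<le>N. G i * (\<integral>s. (?\<rho> s * ?P s) * s ^ i \<partial>lborel))"
    using ii by (subst Bochner_Integration.integral_sum) auto
  finally have "(\<integral>s. ?\<rho> s * (?P s)\<^sup>2 \<partial>lborel) = 0" using assms(1) by simp
  moreover have "(\<integral>s. ?\<rho> s * (?P s)\<^sup>2 \<partial>lborel) = integral (cball 0 1) (\<lambda>s. ?\<rho> s * (?P s)\<^sup>2)"
    by (rule integrable_compact_support(2)) (use \<rho>0 in \<open>auto intro!: continuous_intros c\<rho>\<close>)
  ultimately have I: "integral {- 1..1} (\<lambda>s. ?\<rho> s * (?P s)\<^sup>2) = 0" by (simp add: cball_eq_atLeastAtMost)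
  have "continuous_on {- 1..1} (\<lambda>s. ?\<rho> s * (?P s)\<^sup>2)"
    by (intro continuous_intros continuous_on_subset[OF c\<rho>]) auto
  then have "(integral {- 1..1} (\<lambda>s. ?\<rho> s * (?P s)\<^sup>2) = 0) = (\<forall>s\<in>{- 1..1}. ?\<rho> s * (?P s)\<^sup>2 = 0)"
    by (rule integral_eq_0_iff) (simp_all add: pos_sq_def)
  then have z: "?\<rho> s * (?P s)\<^sup>2 = 0" if "s \<in> {- 1..1}" for s using that unfolding I by blast
  have "{- 1<..<1} \<subseteq> {s. ?P s = 0}"
  proof
    fix s :: real assume s: "s \<in> {- 1<..<1}"
    then have "s\<^sup>2 < 1" by (simp add: abs_square_less_1 abs_less_iff)
    then have "?\<rho> s \<noteq> 0" by (simp add: pos_sq_def max_def)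
    then show "s \<in> {s. ?P s = 0}" using z[of s] s by auto
  qed
  then have "infinite {s. ?P s = 0}" by (rule infinite_super) (simp add: infinite_Ioo)
  then show ?thesis using polyfun_finite_roots[of G N] assms(2) by blast
qed

text \<open>Integration by parts in s replaces the moments of a' by those of a. Every admissible
  profile a then yields a linear relation \<Sum> G_i m_i = 0 between the defects G_i, and a suitable
  profile forces all of them to vanish.\<close>

lemma (in measured_hypersurface) integrated_coefficients:
  assumes V: "C1_field V"
  defines "D \<equiv> \<lambda>i j. \<integral>p. dco (dmat \<nu> p) (dmat V p) (dmat V p) i j 1 \<partial>\<mu>"
    and "D' \<equiv> \<lambda>i j. \<integral>p. dco (dmat \<nu> p) (dmat V p) (outer (V p) (\<nu> p)) i j 1 \<partial>\<mu>"
  assumes i: "i \<le> CARD('a option)" "j \<le> CARD('a option)"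
  shows "D i j = real (Suc i) * D' (Suc i) j"
proof -
  obtain N where N: "N = CARD('a option)" by simp
  define G where "G i = D i j - real (Suc i) * D' (Suc i) j" for i
  \<comment> \<open>The profile is built from the unknown defects themselves: \<Sum> G_i m_i becomes
    the weighted square integral of \<Sum> G_i s^i.\<close>
  define a where "a s = pos_sq (1 - s\<^sup>2) * (\<Sum>i\<le>N. G i * s ^ i)" for s
  define a' where "a' s = 2 * max 0 (1 - s\<^sup>2) * (- 2 * s) * (\<Sum>i\<le>N. G i * s ^ i) +
      (\<Sum>i\<le>N. G i * (real i * s ^ (i - 1))) * pos_sq (1 - s\<^sup>2)" for s
  have a: "(a has_real_derivative a' s) (at s)" for s
    unfolding a_def[abs_def] a'_def
  proof (rule DERIV_mult)
    have "((\<lambda>s. 1 - s\<^sup>2) has_real_derivative - 2 * s) (at s)" by (auto intro!: derivative_eq_intros)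
    then show "((\<lambda>s. pos_sq (1 - s\<^sup>2)) has_real_derivative 2 * max 0 (1 - s\<^sup>2) * (- 2 * s)) (at s)"
      by (rule DERIV_chain2[OF DERIV_pos_sq])
    show "((\<lambda>s. \<Sum>i\<le>N. G i * s ^ i) has_real_derivative (\<Sum>i\<le>N. G i * (real i * s ^ (i - 1)))) (at s)"
      by (auto intro!: derivative_eq_intros simp: mult_ac)
  qed
  have ca': "continuous_on UNIV a'"
    unfolding a'_def pos_sq_def by (intro continuous_intros)
  have a0: "a s = 0" if "1 \<le> \<bar>s\<bar>" for s
  proof -
    have "1 \<le> s\<^sup>2" using that by (metis abs_le_square_iff abs_one one_power2)
    then show ?thesis by (simp add: a_def pos_sq_def)
  qed
  define m where "m i = (\<integral>s. a s * s ^ i \<partial>lborel)" for i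
  define m' where "m' i = (\<integral>s. a' s * s ^ i \<partial>lborel)" for i
  have m': "m' i = - real i * m (i - 1)" for i
    unfolding m_def m'_def by (rule integral_moment_by_parts[OF a ca' a0])
  let ?d = "\<lambda>p i j. dco (dmat \<nu> p) (dmat V p) (dmat V p) i j 1"
  let ?d' = "\<lambda>p i j. dco (dmat \<nu> p) (dmat V p) (outer (V p) (\<nu> p)) i j 1"
  have int: "integrable \<mu> (\<lambda>p. ?d p i j)" "integrable \<mu> (\<lambda>p. ?d' p i j)" for i j
    using continuous_on_dmat[OF V] continuous_on_dmat[OF C1_field_\<nu>] continuous_on_C1_field[OF V] cont_\<nu>
    by (auto intro!: integrable_continuous continuous_on_dco continuous_on_matrix continuous_intros simp: outer_def)
  have "(\<Sum>j\<le>N. (\<Sum>i\<le>N. m i * D i j + m' i * D' i j) * t ^ j) = (\<Sum>j\<le>N. 0 * t ^ j)" for t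
  proof -
    have "(\<integral>p. (\<Sum>i\<le>N. \<Sum>j\<le>N. (m i * ?d p i j + m' i * ?d' p i j) * t ^ j) \<partial>\<mu>) = 0"
      unfolding N m_def m'_def by (rule global_identity[OF V a ca' a0])
    then have "(\<Sum>i\<le>N. \<Sum>j\<le>N. (m i * D i j + m' i * D' i j) * t ^ j) = 0"
      using int by (simp add: D_def D'_def del: One_nat_def)
    then show ?thesis by (subst (asm) sum.swap) (simp add: sum_distrib_right)
  qed
  then have "\<forall>j\<le>N. (\<Sum>i\<le>N. m i * D i j + m' i * D' i j) = 0"
    using polyfun_eq_coeffs[where n = N and c = "\<lambda>j. \<Sum>i\<le>N. m i * D i j + m' i * D' i j" and d = "\<lambda>_. 0"] by blast
  then have "(\<Sum>i\<le>N. m i * D i j + m' i * D' i j) = 0" using i(2) unfolding N by blast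
  then have "(\<Sum>i\<le>N. m i * D i j) - (\<Sum>i\<le>N. real i * m (i - 1) * D' i j) = 0"
    by (simp add: m' sum_subtractf mult.assoc)
  \<comment> \<open>Boundary term of the index shift: the exponent exceeds the size of the
    matrices.\<close>
  moreover have "D' (Suc N) j = 0" unfolding D'_def using N by (simp add: dco_eq_0)
  ultimately have "(\<Sum>i\<le>N. m i * D i j) - (\<Sum>i\<le>N. real (Suc i) * m i * D' (Suc i) j) = 0"
    using sum_shift_index[of "\<lambda>i. D' i j" N m] by simp
  then have "(\<Sum>i\<le>N. G i * m i) = 0"
    by (simp add: G_def right_diff_distrib left_diff_distrib sum_subtractf mult_ac)
  then have "G i = 0"
    unfolding m_def a_def using i(1) N by (intro weighted_moments_zero) auto
  then show ?thesis by (simp add: G_def)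
qed

text \<open>In the proof \<open>T\<close> is the first and \<open>2 * Q\<close> the second
  derivative of \<open>\<sigma>\<^sub>k\<close> at the Weingarten map in direction Hess f, and
  \<open>G\<close> is the curvature term. Pointwise k / (k - 1) times 2 Q is at most T^2 /
  \<open>\<sigma>\<^sub>k\<close>, while the integral of 2 Q is k - 1 times that of G.\<close>

theorem theorem1p4:
  fixes M :: "('n::finite) ambient set"
    and \<nu> :: "'n ambient \<Rightarrow> 'n ambient"
    and \<mu> :: "'n ambient measure"
    and k :: nat
    and f :: "'n ambient \<Rightarrow> real"
  assumes "1 < k" and "k \<le> CARD('n)"
    and "closed_hypersurface M"
    and "outward_unit_normal M \<nu>"
    and "area_measure M \<mu>"
    and "k_convex k M \<nu>"
    and "C2_function M f"
  shows "(\<integral>p. (tr_sigma_dot_hess k M \<nu> f p)\<^sup>2 / sigma_curv k M \<nu> p \<partial>\<mu>)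
    \<ge> real k * (\<integral>p. weingarten_grad_sigma_dot k M \<nu> f p \<partial>\<mu>)"
proof -
  interpret measured_hypersurface M \<nu> \<mu>
    using assms by unfold_locales (auto simp: outward_unit_normal_def)
  let ?V = "gradient M f" and ?W = "dmat \<nu>"
  let ?u = "\<lambda>p. ?W p *v ?V p"
  let ?A = "\<lambda>p. dmat ?V p + outer (\<nu> p) (?u p)"
  have kN: "0 < k" "k \<le> CARD('n option)" "2 \<le> k" using assms by auto
  have CV: "C1_field ?V"
  proof (rule C1_fieldI)
    fix U \<phi> assume "chart M \<nu> U \<phi>"
    then interpret chart M \<nu> U \<phi> .
    interpret chart_function M \<nu> U \<phi> f by unfold_locales (rule assms)
    show "C1_on U (\<lambda>y. ?V (\<phi> y))" by (rule C1_V)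
  qed
  define \<sigma> where "\<sigma> p = msym k (?W p)" for p
  define T where "T p = dco (?W p) 0 (?A p) (k - 1) 0 1" for p
  define Q where "Q p = dco (?W p) 0 (?A p) (k - 2) 0 2" for p
  define G where "G p = dco (?W p) 0 (outer (?V p) (?u p)) (k - 1) 0 1" for p
  have point: "sigma_curv k M \<nu> p = \<sigma> p \<and> \<sigma> p > 0 \<and> tr_sigma_dot_hess k M \<nu> f p = T p \<and>
      weingarten_grad_sigma_dot k M \<nu> f p = G p \<and>
      2 * real k * Q p * \<sigma> p \<le> (real k - 1) * (T p)\<^sup>2 \<and>
      dco (?W p) (dmat ?V p) (dmat ?V p) (k - 2) 1 1 = 2 * Q p \<and>
      dco (?W p) (dmat ?V p) (outer (?V p) (\<nu> p)) (k - 1) 1 1 = G p" if p: "p \<in> M" for p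
  proof -
    obtain U \<phi> x where c: "chart M \<nu> U \<phi>" and x: "x \<in> U" "\<phi> x = p" using p by (rule chart_at)
    interpret chart M \<nu> U \<phi> by (rule c)
    interpret chart_function M \<nu> U \<phi> f by unfold_locales (rule assms)
    have A: "A p = ?A p" by (simp add: A_def)
    have sc: "sigma_curv j M \<nu> p = msym j (?W p)" if "j \<le> k" for j
      using sigma_curv_eq[OF x(1), of j] kN that by (simp add: x del: card_option)
    have pos: "msym j (?W p) > 0" if "j \<in> {1..k}" for j
    proof -
      have "sigma_curv j M \<nu> p > 0" using assms(6) p that unfolding k_convex_def by blast
      then show ?thesis using sc[of j] that by simp
    qed
    have Ws: "transpose (?W p) = ?W p" and Wn: "?W p *v \<nu> p = 0"
      using W_symmetric[OF x(1)] W_\<nu>[OF x(1)] by (simp_all add: x)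
    have As: "transpose (?A p) = ?A p" and An: "?A p *v \<nu> p = 0"
      using A_symmetric[OF x(1)] A_\<nu>[OF x(1)] by (simp_all only: x A)
    have Vn: "?V p \<bullet> \<nu> p = 0" using V_\<nu>[OF x(1)] by (simp add: x inner_commute)
    have un: "?u p \<bullet> \<nu> p = 0" using matrix_self_adjoint[OF Ws, of "?V p" "\<nu> p"] Wn by simp
    have Wt: "transpose (?W p) *v \<nu> p = 0" and At: "transpose (?A p) *v \<nu> p = 0"
      unfolding Ws As by (rule Wn An)+
    have DV: "dmat ?V p = ?A p - outer (\<nu> p) (?u p)" by simp
    \<comment> \<open>The border \<open>outer (\<nu> p) (?u p)\<close> in the derivative of the
      gradient meets the variation \<nabla>f \<otimes> \<nu>; together they give \<nabla>f \<otimes>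
      W\<nabla>f, and the exponent of t drops from 1 to 0.\<close>
    have b1: "dco (?W p) (dmat ?V p) (outer (?V p) (\<nu> p)) (k - 1) (Suc 0) 1 = dco (?W p) (?A p) (outer (?V p) (?u p)) (k - 1) 0 1"
      using dco_border(1)[OF unit[OF p] Wn Wt An At un Vn, of "k - 1" 0] by simp
    have b2: "dco (?W p) (dmat ?V p) 0 (k - 2) 2 0 = dco (?W p) (?A p) 0 (k - 2) 2 0"
      using dco_border(2)[OF unit[OF p] Wn Wt An At un Vn, of "k - 2" 2] by simp
    have "dco (?W p) (?A p) (outer (?V p) (?u p)) (k - 1) 0 1 = G p"
      unfolding G_def using dco_swap dco_independent by metis
    with b1 have g: "dco (?W p) (dmat ?V p) (outer (?V p) (\<nu> p)) (k - 1) 1 1 = G p" by simp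
    \<comment> \<open>In the term quadratic in the derivative of the gradient the border is
      invisible, so that it may be replaced by the Hessian. The factor 2 is b + 1 at b = 1 in
      \<open>dco_double\<close>.\<close>
    have q: "dco (?W p) (dmat ?V p) (dmat ?V p) (k - 2) 1 1 = 2 * Q p"
      using dco_double[of "?W p" "dmat ?V p" "k - 2" 1] b2 dco_swap[of "?W p" "?A p" 0 "k - 2" 2 0]
      by (simp add: Q_def numeral_2_eq_2)
    have t: "tr_sigma_dot_hess k M \<nu> f p = T p"
      using tr_sigma_dot_hess_eq[OF x(1) kN(1,2)] by (simp add: x A T_def)
    have w: "weingarten_grad_sigma_dot k M \<nu> f p = G p"
      using weingarten_grad_eq[OF x(1) kN(1,2)] by (simp add: x G_def)
    have "2 * real k * Q p * \<sigma> p \<le> (real k - 1) * (T p)\<^sup>2"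
      unfolding Q_def T_def \<sigma>_def by (rule garding_matrix[OF Ws As kN(3,2) pos])
    then show ?thesis using sc[of k] pos[of k] kN t w q g by (simp add: \<sigma>_def)
  qed
  have cW: "continuous_on M ?W" by (rule continuous_on_dmat[OF C1_field_\<nu>])
  have cV: "continuous_on M ?V" by (rule continuous_on_C1_field[OF CV])
  have cu: "continuous_on M ?u"
    unfolding matrix_vector_mult_def by (intro continuous_on_vec_lambda continuous_intros cW cV)
  have co: "continuous_on M (\<lambda>p. outer (g p) (h p))"
    if "continuous_on M g" "continuous_on M h" for g h :: "'n ambient \<Rightarrow> 'n ambient"
    unfolding outer_def using that by (intro continuous_on_vec_lambda continuous_intros)
  have cA: "continuous_on M ?A"
    by (intro continuous_on_add continuous_on_dmat CV co cont_\<nu> cu)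
  have cT: "continuous_on M T" and cQ: "continuous_on M Q" and cG: "continuous_on M G" and c\<sigma>: "continuous_on M \<sigma>"
    unfolding T_def Q_def G_def \<sigma>_def
    by (intro continuous_on_dco continuous_on_msym continuous_on_const cW cA co cV cu)+
  \<comment> \<open>The coefficient of s^(k-2) t in the integrated identity; the shift of the
    exponent of s to k - 1 brings the factor k - 1.\<close>
  have key: "2 * (\<integral>p. Q p \<partial>\<mu>) = (real k - 1) * (\<integral>p. G p \<partial>\<mu>)"
  proof -
    have "(\<integral>p. 2 * Q p \<partial>\<mu>) = (\<integral>p. dco (?W p) (dmat ?V p) (dmat ?V p) (k - 2) 1 1 \<partial>\<mu>)"
      by (rule Bochner_Integration.integral_cong) (use point in \<open>auto simp: space_\<mu>\<close>)
    also have "\<dots> = real (Suc (k - 2)) * (\<integral>p. dco (?W p) (dmat ?V p) (outer (?V p) (\<nu> p)) (Suc (k - 2)) 1 1 \<partial>\<mu>)"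
      by (rule integrated_coefficients[OF CV]) (use kN in auto)
    also have "Suc (k - 2) = k - 1" using kN by simp
    also have "(\<integral>p. dco (?W p) (dmat ?V p) (outer (?V p) (\<nu> p)) (k - 1) 1 1 \<partial>\<mu>) = (\<integral>p. G p \<partial>\<mu>)"
      by (rule Bochner_Integration.integral_cong) (use point in \<open>auto simp: space_\<mu>\<close>)
    finally show ?thesis using kN by (simp add: of_nat_diff)
  qed
  have ineq: "real k / (real k - 1) * (2 * Q p) \<le> (T p)\<^sup>2 / \<sigma> p" if "p \<in> M" for p
  proof -
    have "2 * real k * Q p * \<sigma> p \<le> (real k - 1) * (T p)\<^sup>2" "\<sigma> p > 0" using point[OF that] by auto
    moreover have "real k - 1 > 0" using kN by simp
    ultimately show ?thesis by (simp add: field_simps)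
  qed
  have "real k * (\<integral>p. weingarten_grad_sigma_dot k M \<nu> f p \<partial>\<mu>) = real k * (\<integral>p. G p \<partial>\<mu>)"
    by (intro arg_cong2[where f = "(*)"] refl Bochner_Integration.integral_cong) (use point in \<open>auto simp: space_\<mu>\<close>)
  also have "\<dots> = real k / (real k - 1) * (2 * (\<integral>p. Q p \<partial>\<mu>))"
    unfolding key using kN by (simp add: field_simps)
  also have "\<dots> = (\<integral>p. real k / (real k - 1) * (2 * Q p) \<partial>\<mu>)" by simp
  also have "\<dots> \<le> (\<integral>p. (T p)\<^sup>2 / \<sigma> p \<partial>\<mu>)"
  proof (rule integral_mono)
    show "integrable \<mu> (\<lambda>p. real k / (real k - 1) * (2 * Q p))"
      by (intro integrable_continuous continuous_intros cQ)
    show "integrable \<mu> (\<lambda>p. (T p)\<^sup>2 / \<sigma> p)"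
      using point by (intro integrable_continuous continuous_on_divide continuous_on_power cT c\<sigma>) force
  qed (use ineq in \<open>simp add: space_\<mu>\<close>)
  also have "\<dots> = (\<integral>p. (tr_sigma_dot_hess k M \<nu> f p)\<^sup>2 / sigma_curv k M \<nu> p \<partial>\<mu>)"
    by (rule Bochner_Integration.integral_cong) (use point in \<open>auto simp: space_\<mu>\<close>)
  finally show ?thesis .
qed

end
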